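(* Let $p\in\mathbb{N}$ and let $\mathbf{a},\mathbf{b}\in\mathbb{C}^p$ be arbitrary with $-\mathbf{b}\notin\mathbb{N}_0$. Then $\mathcal{G}_1=\mathcal{G}_1(\mathbf{a},\mathbf{b})$ is a continuous linear functional on $\mathcal{CB}^\infty[0,1]$, and its definition is independent of the choice of the nonnegative integer $n>-\min(a,\Re(\psi))$ in it.
   Context: $\mathbb{N}_0=\mathbb{N}\cup\{0\}$. For a vector $\mathbf{a}=(a_1,\dots,a_p)$: $\Gamma(\mathbf{a})=\prod_i\Gamma(a_i)$, $(\mathbf{a})_j=\prod_i(a_i)_j$, $\mathbf{a}+\mu=(a_1+\mu,\dots,a_p+\mu)$; conditions such as $-\mathbf{a}\notin\mathbb{N}_0$ are element-wise. $a=\min(\Re a_1,\dots,\Re a_p)$, $\psi=\sum_{k=1}^p(b_k-a_k)$. For $0<t<1$ and $-\mathbf{a}\notin\mathbb{N}_0$, $$\widehat{G}_n(t)=G^{p,1}_{p+1,p+1}\!\left(t\,\Big|\begin{array}{l}n,\mathbf{b}+n-1\\ \mathbf{a}+n-1,0\end{array}\right)=\frac{1}{2\pi i}\int_{\mathcal{L}}\frac{\Gamma(\mathbf{a}+n-1+s)\,\Gamma(1-n-s)}{\Gamma(\mathbf{b}+n-1+s)\,\Gamma(1-s)}\,t^{-s}\,ds,$$ where $\mathcal{L}$ is a left loop (starting and ending at $-\infty$, traversed counterclockwise) that leaves all the points $1-a_j-n-l$, $l\in\mathbb{N}_0$, on its left and all the points $1-n+k$, $k\in\mathbb{N}_0$,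 on its right. If some components of $\mathbf{a}$ are non-positive integers, $\widehat{G}_n(t)/\Gamma(\mathbf{a})$ denotes its extension by continuity in $\mathbf{a}$, namely $\frac{t^{n-1}}{(n-1)!}\sum_{j=0}^{n-1}\frac{(1-n)_j(\mathbf{a})_j}{\Gamma(\mathbf{b}+j)\,j!}t^{-j}$ (and $0$ if $n=0$). $\mathcal{CB}^\infty[0,1]$ is the space of functions on $[0,1]$ having derivatives of all orders, all bounded on $[0,1]$; $\varphi_j\to\varphi$ in $\mathcal{CB}^\infty[0,1]$ means $\max_{x\in[0,1]}|\varphi_j^{(k)}(x)-\varphi^{(k)}(x)|\to0$ for each $k\in\mathbb{N}_0$. Definition of $\mathcal{G}_1(\mathbf{a},\mathbf{b})$: choose a nonnegative integer $n>-\min(a,\Re(\psi))$ and set, for $\varphi\in\mathcal{CB}^\infty[0,1]$, $$\langle\mathcal{G}_1,\varphi\rangle=\sum_{k=0}^{n-1}\frac{(-1)^k\varphi^{(k)}(1)}{k!}\,{}_{p+1}F_p\!\left(\begin{matrix}\mathbf{a},-k\\\mathbf{b}\end{matrix}\,\Big|\,1\right)+\frac{(-1)^n\Gamma(\mathbf{b})}{\Gamma(\mathbf{a})}\int_0^1\widehat{G}_n(t)\varphi^{(n)}(t)\,dt$$ (the finite sum is empty if $n=0$). *)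

theory Defs
  imports "HOL-Complex_Analysis.Complex_Analysis"
begin

text \<open>Vectors in $C^p$ are lists of length $p$.\<close>

definition Gamma_vec :: "complex list \<Rightarrow> complex" where
  "Gamma_vec xs = (\<Prod>x\<leftarrow>xs. Gamma x)"

definition pochhammer_vec :: "complex list \<Rightarrow> nat \<Rightarrow> complex" where
  "pochhammer_vec xs j = (\<Prod>x\<leftarrow>xs. pochhammer x j)"

definition shift_vec :: "complex list \<Rightarrow> complex \<Rightarrow> complex list" where
  "shift_vec xs \<mu> = map (\<lambda>x. x + \<mu>) xs"

definition min_Re :: "complex list \<Rightarrow> real" where
  "min_Re xs = Min (Re ` set xs)"

definition psi :: "complex list \<Rightarrow> complex list \<Rightarrow> complex" where
  "psi a b = (\<Sum>k<length a. b ! k - a ! k)"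

definition hypergeometric :: "complex list \<Rightarrow> complex list \<Rightarrow> complex \<Rightarrow> complex" where
  "hypergeometric a b z = (\<Sum>j. pochhammer_vec a j / pochhammer_vec b j * z ^ j / fact j)"

text \<open>
  A left loop is encoded by its middle part \<open>g\<close>: the loop comes in from minus infinity
  along the horizontal ray ending at \<open>pathstart g\<close>, follows \<open>g\<close>, and leaves to minus infinity
  along the horizontal ray starting at \<open>pathfinish g\<close>, which lies above the incoming one.
\<close>

definition left_loop :: "(real \<Rightarrow> complex) \<Rightarrow> bool" where
  "left_loop g \<longleftrightarrow> valid_path g \<and> Im (pathstart g) < Im (pathfinish g)"

definition loop_integral :: "(real \<Rightarrow> complex) \<Rightarrow> (complex \<Rightarrow> complex) \<Rightarrow> complex" where
  "loop_integral g f =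
     (LBINT r:{0..}. f (pathstart g - of_real r))
     + contour_integral g f
     - (LBINT r:{0..}. f (pathfinish g - of_real r))"

text \<open>
  The sides of a loop are given by winding numbers of the closed curves obtained by cutting
  both rays at distance \<open>R\<close> and joining the two ends by a segment. For a simple loop these
  are its two sides; simplicity itself is not required, as the winding numbers determine
  the integrals below.
\<close>

definition truncated_loop :: "(real \<Rightarrow> complex) \<Rightarrow> real \<Rightarrow> real \<Rightarrow> complex" where
  "truncated_loop g R =
     linepath (pathstart g - of_real R) (pathstart g) +++ g
     +++ linepath (pathfinish g) (pathfinish g - of_real R)
     +++ linepath (pathfinish g - of_real R) (pathstart g - of_real R)"

definition on_left_of_loop :: "(real \<Rightarrow> complex) \<Rightarrow> complex \<Rightarrow> bool" where
  "on_left_of_loop g z \<longleftrightarrow>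
     (\<forall>\<^sub>F R in at_top. z \<notin> path_image (truncated_loop g R) \<and>
                      winding_number (truncated_loop g R) z = 1)"

definition on_right_of_loop :: "(real \<Rightarrow> complex) \<Rightarrow> complex \<Rightarrow> bool" where
  "on_right_of_loop g z \<longleftrightarrow>
     (\<forall>\<^sub>F R in at_top. z \<notin> path_image (truncated_loop g R) \<and>
                      winding_number (truncated_loop g R) z = 0)"

definition separating_loop :: "nat \<Rightarrow> complex list \<Rightarrow> (real \<Rightarrow> complex) \<Rightarrow> bool" where
  "separating_loop n a g \<longleftrightarrow>
     left_loop g \<and>
     (\<forall>x\<in>set a. \<forall>l::nat. on_left_of_loop g (1 - x - of_nat n - of_nat l)) \<and>
     (\<forall>k::nat. on_right_of_loop g (1 - of_nat n + of_nat k))"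

text \<open>
  Here \<open>Gamma\<close> vanishes at its poles, so that \<open>1 / Gamma\<close> has the correct value \<open>0\<close> there;
  the points where \<open>Gamma (1 - n - s)\<close> or \<open>Gamma (1 - s)\<close> has a pole are off the loop.
\<close>

definition G_integrand ::
    "nat \<Rightarrow> complex list \<Rightarrow> complex list \<Rightarrow> real \<Rightarrow> complex \<Rightarrow> complex" where
  "G_integrand n a b t s =
     Gamma_vec (shift_vec a (of_nat n - 1 + s)) * Gamma (1 - of_nat n - s) /
     (Gamma_vec (shift_vec b (of_nat n - 1 + s)) * Gamma (1 - s)) *
     of_real t powr (- s)"

text \<open>
  Meaningful for \<open>0 < t < 1\<close> and no component of \<open>a\<close> a non-positive integer;
  the value does not depend on the chosen separating loop.
\<close>

definition G_hat :: "nat \<Rightarrow> complex list \<Rightarrow> complex list \<Rightarrow> real \<Rightarrow> complex" where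
  "G_hat n a b t =
     loop_integral (SOME g. separating_loop n a g) (G_integrand n a b t) / (2 * of_real pi * \<i>)"

text \<open>
  \<open>G_hat / Gamma_vec a\<close>, extended by continuity in \<open>a\<close> to vectors having
  non-positive integer components.
\<close>

definition G_hat_over_Gamma :: "nat \<Rightarrow> complex list \<Rightarrow> complex list \<Rightarrow> real \<Rightarrow> complex" where
  "G_hat_over_Gamma n a b t =
     (if \<exists>x\<in>set a. x \<in> \<int>\<^sub>\<le>\<^sub>0 then
        if n = 0 then 0
        else of_real t ^ (n - 1) / fact (n - 1) *
             (\<Sum>j=0..n-1. pochhammer (1 - of_nat n) j * pochhammer_vec a j /
                        (Gamma_vec (shift_vec b (of_nat j)) * fact j) * of_real t powi (- int j))
      else G_hat n a b t / Gamma_vec a)"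

text \<open>
  Functions on $[0,1]$ are represented by functions on the reals whose values outside
  $[0,1]$ are ignored; derivatives at the end points are one-sided.
\<close>

definition nderiv :: "nat \<Rightarrow> (real \<Rightarrow> complex) \<Rightarrow> real \<Rightarrow> complex" where
  "nderiv k = (\<lambda>f x. vector_derivative f (at x within {0..1})) ^^ k"

definition CB_inf :: "(real \<Rightarrow> complex) set" where
  "CB_inf = {\<phi>. \<forall>k. (\<forall>x\<in>{0..1}. nderiv k \<phi> differentiable (at x within {0..1})) \<and>
                    bounded (nderiv k \<phi> ` {0..1})}"

definition CB_inf_tendsto :: "(nat \<Rightarrow> real \<Rightarrow> complex) \<Rightarrow> (real \<Rightarrow> complex) \<Rightarrow> bool" where
  "CB_inf_tendsto \<Phi> \<phi> \<longleftrightarrow>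
     (\<forall>k. (\<lambda>j. SUP x\<in>{0..1}. norm (nderiv k (\<Phi> j) x - nderiv k \<phi> x)) \<longlonglongrightarrow> 0)"

definition continuous_linear_functional :: "((real \<Rightarrow> complex) \<Rightarrow> complex) \<Rightarrow> bool" where
  "continuous_linear_functional F \<longleftrightarrow>
     (\<forall>\<phi>\<in>CB_inf. \<forall>\<eta>\<in>CB_inf. F (\<lambda>x. \<phi> x + \<eta> x) = F \<phi> + F \<eta>) \<and>
     (\<forall>c. \<forall>\<phi>\<in>CB_inf. F (\<lambda>x. c * \<phi> x) = c * F \<phi>) \<and>
     (\<forall>\<Phi> \<phi>. (\<forall>j. \<Phi> j \<in> CB_inf) \<longrightarrow> \<phi> \<in> CB_inf \<longrightarrow> CB_inf_tendsto \<Phi> \<phi> \<longrightarrow>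
              (\<lambda>j. F (\<Phi> j)) \<longlonglongrightarrow> F \<phi>)"

definition admissible :: "complex list \<Rightarrow> complex list \<Rightarrow> nat \<Rightarrow> bool" where
  "admissible a b n \<longleftrightarrow> real n > - min (min_Re a) (Re (psi a b))"

definition G1 ::
    "complex list \<Rightarrow> complex list \<Rightarrow> nat \<Rightarrow> (real \<Rightarrow> complex) \<Rightarrow> complex" where
  "G1 a b n \<phi> =
     (\<Sum>k<n. (-1) ^ k * nderiv k \<phi> 1 / fact k * hypergeometric (a @ [- of_nat k]) b 1)
     + (-1) ^ n * Gamma_vec b *
       (LBINT t:{0<..<1}. G_hat_over_Gamma n a b t * nderiv n \<phi> t)"

end

theory Submission
  imports Defs
begin

text \<open>
  Put $u = s + n - 1$ and $\Phi(u) = \Gamma(\mathbf{a}+u)/\Gamma(\mathbf{b}+u)$; since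
  $\Gamma(-u)/\Gamma(n-u) = 1/(-u)_n$, the integrand of $\widehat{G}_n$ is
  $\Phi(u)\,t^{n-1-u}/(-u)_n$. Fix a non-integer $c > -a$ below the smaller of the two orders to be
  compared. The separating loop can be replaced by the three straight pieces of the loop through
  $c \pm iM$, at the price of the residues at the integers $0 \le k < c$, which are monomials in $t$.
  On the new loop $\Phi(u)/(-u)_n = O(|u|^{-\Re\psi-n})$ and $\Re u \le c < n$, so integrating
  $t^{n-1-u}$ over $(0,1)$ first gives an absolutely convergent double integral. Fubini and one
  integration by parts for each $u$, with $(-u)_n (n-u) = (-u)_{n+1}$, turn order $n$ into order
  $n+1$. The boundary term is $\int \Phi(u)/(-u)_{n+1}\,du$, a sum of residues at the integers
  $c < k \le n$, because the loop integral tends to $0$ when the loop is blown up; together with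
  the monomials it is the terminating hypergeometric sum. If some $a_j$ is a non-positive integer,
  only the monomials remain.
\<close>

section \<open>Quotients of Gamma functions\<close>

text \<open>For fixed t < 1 the factor t^(-s) decays exponentially towards the left, so the defining
  loop integral converges for every n. Integrating over t destroys this decay and leaves only a
  factor 1/(n - Re u); with \<Phi>(u)/(-u)_n the rays then carry O(|u|^(-1 - (Re \<psi> + n))),
  which n > -Re \<psi> makes integrable. The condition n > -a leaves room for an abscissa c to the
  right of all left poles with Re u < n on the whole loop. Hence the growth of \<Phi> must be known
  on entire horizontal lines up to Re u = -infinity, not only in a sector around the positive axis:
  the region where |Im u| or Re u is large contains the rays and all that the loop sweeps when it is
  blown up. An arbitrary separating loop may have rays at smaller heights; there a bound at the left
  end of a pole-free strip suffices. Taking c between n - 1 and n, for the smaller order n, keeps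
  the vertical side away from the zeros of (-u)_m for all m at once, so one loop serves every order
  m \<ge> n.\<close>

lemma holomorphic_second_order_bound:
  fixes f :: "complex \<Rightarrow> complex"
  assumes "f holomorphic_on ball 0 r" "r > 0" "deriv f 0 = 0"
  obtains C \<delta> where "C \<ge> 0" "0 < \<delta>" "\<delta> \<le> r" "\<And>w. norm w < \<delta> \<Longrightarrow> norm (f w - f 0) \<le> C * norm w ^ 2"
proof -
  define d where "d = r / 2"
  have d: "0 < d" "cball 0 d \<subseteq> ball (0::complex) r" using assms(2) by (auto simp: d_def)
  have hd: "(deriv ^^ i) f holomorphic_on ball 0 r" for i
    using assms(1) by (intro holomorphic_higher_deriv) auto
  have "continuous_on (cball 0 d) ((deriv ^^ 2) f)"
    using hd[of 2] d(2) holomorphic_on_imp_continuous_on continuous_on_subset by blast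
  then have "bounded ((deriv ^^ 2) f ` cball 0 d)"
    by (intro compact_imp_bounded compact_continuous_image) auto
  then obtain B where B: "B > 0" "\<And>x. x \<in> cball 0 d \<Longrightarrow> norm ((deriv ^^ 2) f x) \<le> B"
    unfolding bounded_pos by auto
  show ?thesis
  proof (rule that[of B d])
    fix w :: complex assume w: "norm w < d"
    have "norm ((deriv ^^ 0) f w - (\<Sum>i\<le>1. (deriv ^^ i) f 0 * (w - 0) ^ i / fact i))
        \<le> B * norm (w - 0) ^ Suc 1 / fact 1"
    proof (rule complex_Taylor[where S = "cball 0 d"])
      fix i :: nat and x :: complex assume x: "x \<in> cball 0 d" and "i \<le> 1"
      have "x \<in> ball 0 r" using x d by auto
      then show "((deriv ^^ i) f has_field_derivative (deriv ^^ Suc i) f x) (at x within cball 0 d)"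
        using holomorphic_derivI[OF hd[of i]] by (auto intro: has_field_derivative_at_within)
    qed (use B w d in \<open>auto simp: numeral_2_eq_2\<close>)
    then show "norm (f w - f 0) \<le> B * norm w ^ 2"
      using assms(3) by (simp add: power2_eq_square)
  qed (use B d in \<open>auto simp: d_def\<close>)
qed

lemma not_nonpos_Int_region:
  fixes x u :: complex
  assumes "norm x < K" "K \<le> \<bar>Im u\<bar> \<or> K \<le> Re u"
  shows "x + u \<notin> \<int>\<^sub>\<le>\<^sub>0"
proof
  assume "x + u \<in> \<int>\<^sub>\<le>\<^sub>0"
  then obtain n where n: "x + u = - of_nat n" by (auto elim!: nonpos_Ints_cases')
  have "Im x + Im u = 0" "Re x + Re u \<le> 0" using n by (simp_all add: complex_eq_iff)
  then show False using assms abs_Re_le_cmod[of x] abs_Im_le_cmod[of x] by linarith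
qed

text \<open>
  The correction factor between \<open>u\<close> and \<open>u + 1\<close> is a function of \<open>1 / u\<close> that is holomorphic at \<open>0\<close>
  with value \<open>1\<close> and vanishing derivative; the errors $O(|u+k|^{-2})$ accumulated on the way to
  infinity are therefore summable.
\<close>

lemma Gamma_quotient_step:
  fixes a b :: complex
  obtains C K where "C \<ge> 0" "K \<ge> 1" "K > norm a" "K > norm b"
    "\<And>u. K \<le> \<bar>Im u\<bar> \<or> K \<le> Re u \<Longrightarrow>
       norm (Gamma (a + u) / Gamma (b + u) * exp ((b - a) * Ln u))
     \<le> norm (Gamma (a + (u + 1)) / Gamma (b + (u + 1)) * exp ((b - a) * Ln (u + 1))) * exp (C / norm u ^ 2)"
proof -
  define Q where "Q = (\<lambda>w. (1 + b * w) / (1 + a * w) * exp ((a - b) * Ln (1 + w)))"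
  \<comment> \<open>The radius keeps |a w| < 1, away from the zero of the denominator, and |w| < 1,
    away from the cut of \<open>Ln (1 + w)\<close>.\<close>
  define r where "r = 1 / (1 + norm a)"
  have r: "r > 0" "r \<le> 1" by (auto simp: r_def field_simps add_pos_nonneg)
  have nz: "1 + a * w \<noteq> 0" "1 + w \<notin> \<real>\<^sub>\<le>\<^sub>0" if "w \<in> ball 0 r" for w
  proof -
    have w: "norm w < r" using that by simp
    have "norm (a * w) \<le> norm a * r" using w by (simp add: norm_mult mult_left_mono)
    also have "\<dots> < 1" by (simp add: r_def field_simps add_pos_nonneg)
    finally have "norm (a * w) < 1" .
    then show "1 + a * w \<noteq> 0"
      by (metis add_eq_0_iff norm_minus_cancel norm_one less_irrefl)
    have "\<bar>Re w\<bar> < 1" using w r abs_Re_le_cmod[of w] by linarith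
    then show "1 + w \<notin> \<real>\<^sub>\<le>\<^sub>0" by (auto simp: complex_nonpos_Reals_iff)
  qed
  have "Q holomorphic_on ball 0 r"
    unfolding Q_def using nz by (intro holomorphic_intros) auto
  \<comment> \<open>The first-order terms are b - a from the fraction and a - b from the power;
    their cancellation is the reason for the exponent b - a in the comparison.\<close>
  moreover have "(Q has_field_derivative 0) (at 0)"
    unfolding Q_def by (auto intro!: derivative_eq_intros)
  then have "deriv Q 0 = 0" by (rule DERIV_imp_deriv)
  ultimately obtain C \<delta> where C: "C \<ge> 0" "0 < \<delta>" "\<delta> \<le> r"
     "\<And>w. norm w < \<delta> \<Longrightarrow> norm (Q w - Q 0) \<le> C * norm w ^ 2"
    using holomorphic_second_order_bound[of Q r] r by metis
  \<comment> \<open>The norms of \<open>a\<close> and \<open>b\<close> keep \<open>a + u\<close> and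
    \<open>b + u\<close> off the poles; the last term places 1/u in the disc of radius
    \<delta>.\<close>
  define K where "K = 1 + norm a + norm b + 2 / \<delta>"
  show ?thesis
  proof (rule that[of C K])
    fix u :: complex assume u: "K \<le> \<bar>Im u\<bar> \<or> K \<le> Re u"
    have Kp: "1 + norm a + norm b < K" "2 / \<delta> < K"
      using C by (simp_all add: K_def add_pos_nonneg)
    have nu: "norm u \<ge> K" using u abs_Re_le_cmod[of u] abs_Im_le_cmod[of u] by linarith
    have K0: "K > 0" using Kp norm_ge_zero[of a] norm_ge_zero[of b] by linarith
    have u0: "u \<noteq> 0" "Im u \<noteq> 0 \<or> Re u > 0" using u K0 by auto
    have w: "norm (1 / u) < \<delta>"
    proof -
      have "1/\<delta> < 2/\<delta>" using C by (simp add: field_simps)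
      then have "1 / \<delta> < norm u" using nu Kp by linarith
      then show ?thesis using C u0 by (simp add: norm_divide field_simps)
    qed
    have wb: "1 / u \<in> ball 0 r" using w C by simp
    have notnp: "x + u \<notin> \<int>\<^sub>\<le>\<^sub>0" if "norm x < K" for x
      using not_nonpos_Int_region[OF that u] .
    have a: "a + u \<notin> \<int>\<^sub>\<le>\<^sub>0" and b: "b + u \<notin> \<int>\<^sub>\<le>\<^sub>0"
      by (rule notnp; use Kp(1) norm_ge_zero[of a] norm_ge_zero[of b] in linarith)+
    \<comment> \<open>\<open>Re u\<close> may be very negative, so additivity of \<open>Ln\<close>
      is a question of branches. The imaginary parts of u and 1 + 1/u have opposite signs and the
      argument of 1 + 1/u is below pi/2 in modulus, so the sum of the arguments stays in (-pi, pi].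
      For real u the region forces u > 0.\<close>
    have Lsum: "Ln (u + 1) = Ln u + Ln (1 + 1 / u)"
    proof -
      have v: "1 + 1 / u = (u + 1) / u" using u0 by (simp add: field_simps)
      have v0: "1 + 1 / u \<noteq> 0" using nz(2)[OF wb] by force
      have Imv: "Im (1 + 1 / u) = - Im u / (norm u)\<^sup>2" by (simp add: Im_divide cmod_power2)
      have Rev: "Re (1 + 1 / u) > 0"
        using wb r abs_Re_le_cmod[of "1/u"] by simp
      have vh: "\<bar>Im (Ln (1 + 1 / u))\<bar> < pi / 2"
        using Rev Re_Ln_pos_lt[OF v0] by blast
      have nu2: "(norm u)\<^sup>2 > 0" using u0 by simp
      have "- pi < Im (Ln u) + Im (Ln (1 + 1 / u)) \<and> Im (Ln u) + Im (Ln (1 + 1 / u)) \<le> pi"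
      proof (cases "Im u" "0::real" rule: linorder_cases)
        case equal
        then have "Re u > 0" using u0 by auto
        then have "\<bar>Im (Ln u)\<bar> < pi / 2" using Re_Ln_pos_lt[OF u0(1)] by blast
        then show ?thesis using vh by linarith
      next
        case less
        then have "0 < Im (1 + 1 / u)" unfolding Imv using nu2 by (simp add: divide_neg_pos)
        then have "0 < Im (Ln (1 + 1 / u))" using Im_Ln_pos_lt[OF v0] by simp
        moreover have "- pi < Im (Ln u)" "Im (Ln u) < 0"
          using less u0 mpi_less_Im_Ln[of u] Im_Ln_le_pi[of u] Im_Ln_pos_le[of u] by force+
        ultimately show ?thesis using vh pi_gt_zero by linarith
      next
        case greater
        then have "Im (1 + 1 / u) < 0" unfolding Imv using nu2 by (simp add: divide_pos_pos)
        then have "Im (Ln (1 + 1 / u)) < 0" using Im_Ln_pos_le[OF v0] Im_Ln_le_pi[OF v0] by fastforce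
        moreover have "Im (Ln u) > 0" "Im (Ln u) \<le> pi"
          using greater u0 Im_Ln_le_pi[of u] Im_Ln_pos_lt[of u] by auto
        ultimately show ?thesis using vh pi_gt_zero by linarith
      qed
      then have "Ln (u * (1 + 1 / u)) = Ln u + Ln (1 + 1 / u)"
        using Ln_times_simple[OF u0(1) v0] by simp
      moreover have "u * (1 + 1 / u) = u + 1" using u0 by (simp add: field_simps)
      ultimately show ?thesis by simp
    qed
    have "Q (1 / u) = (b + u) / (a + u) * exp ((a - b) * Ln (1 + 1 / u))"
    proof -
      have "a + u \<noteq> 0" using a by auto
      moreover have "1 + b * (1 / u) = (b + u) / u" "1 + a * (1 / u) = (a + u) / u"
        using u0 by (simp_all add: add_divide_distrib)
      ultimately have "(1 + b * (1 / u)) / (1 + a * (1 / u)) = (b + u) / (a + u)"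
        using u0 by simp
      then show ?thesis unfolding Q_def by (simp only:)
    qed
    moreover have "exp ((b - a) * Ln (u + 1)) * exp ((a - b) * Ln (1 + 1 / u)) = exp ((b - a) * Ln u)"
      unfolding Lsum by (simp add: exp_add[symmetric] algebra_simps)
    moreover have "Gamma (a + (u + 1)) = (a + u) * Gamma (a + u)"
      "Gamma (b + (u + 1)) = (b + u) * Gamma (b + u)"
      using Gamma_plus1[OF a] Gamma_plus1[OF b] by (simp_all add: add_ac)
    moreover have "a + u \<noteq> 0" "b + u \<noteq> 0" using a b by auto
    moreover have "(A * g) / (B * h) * x * (B / A * y) = g / h * (x * y)"
      if "A \<noteq> 0" "B \<noteq> 0" for A B g h x y :: complex using that by simp
    ultimately have eq: "Gamma (a + u) / Gamma (b + u) * exp ((b - a) * Ln u)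
      = Gamma (a + (u + 1)) / Gamma (b + (u + 1)) * exp ((b - a) * Ln (u + 1)) * Q (1 / u)"
      by (metis (no_types))
    have "norm (Q (1 / u)) \<le> 1 + norm (Q (1 / u) - 1)"
      using norm_triangle_ineq[of 1 "Q (1 / u) - 1"] by simp
    also have "\<dots> \<le> 1 + C / norm u ^ 2"
      using C(4)[OF w] by (simp add: Q_def norm_divide power_divide)
    also have "\<dots> \<le> exp (C / norm u ^ 2)" by (rule exp_ge_add_one_self)
    finally show "norm (Gamma (a + u) / Gamma (b + u) * exp ((b - a) * Ln u))
     \<le> norm (Gamma (a + (u + 1)) / Gamma (b + (u + 1)) * exp ((b - a) * Ln (u + 1))) * exp (C / norm u ^ 2)"
      unfolding eq norm_mult[of _ "Q (1 / u)"] by (intro mult_left_mono) auto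
  qed (use C in \<open>auto simp: K_def add_nonneg_pos add_pos_nonneg intro!: add_nonneg_nonneg\<close>)
qed

text \<open>The bound is independent of \<open>x\<close>: compare with the telescoping differences of \<open>arctan\<close>.\<close>

lemma sum_inverse_square_shift_le:
  fixes x :: real
  shows "(\<Sum>k<n. 1 / (1 + (x + real k)\<^sup>2)) \<le> 3 * pi"
proof -
  \<comment> \<open>The mean value theorem gives an intermediate z with |z| \<le> |y| + 1, and 2|y|
    \<le> 1 + y^2 bounds 1 + z^2 by 3(1 + y^2); this is the constant 3.\<close>
  have step: "1 / (1 + y\<^sup>2) \<le> 3 * (arctan (y + 1) - arctan y)" for y :: real
  proof -
    have "\<exists>z. y < z \<and> z < y + 1 \<and> arctan (y + 1) - arctan y = (y + 1 - y) * inverse (1 + z\<^sup>2)"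
      by (rule MVT2) (auto intro!: derivative_eq_intros)
    then obtain z where z: "y < z" "z < y + 1" "arctan (y + 1) - arctan y = inverse (1 + z\<^sup>2)" by auto
    have "z\<^sup>2 \<le> (\<bar>y\<bar> + 1)\<^sup>2" using z by (intro abs_le_square_iff[THEN iffD1]) auto
    also have "\<dots> \<le> 2 + 3 * y\<^sup>2"
      using zero_le_power2[of "\<bar>y\<bar> - 1"] zero_le_power2[of y]
      unfolding power2_sum power2_diff power2_abs power_one by linarith
    finally have "1 + z\<^sup>2 \<le> 3 * (1 + y\<^sup>2)" by simp
    moreover have "1 + z\<^sup>2 > 0" "1 + y\<^sup>2 > 0" by (auto simp: add_pos_nonneg)
    ultimately show ?thesis unfolding z(3) by (simp add: field_simps)
  qed
  have "(\<Sum>k<n. 1 / (1 + (x + real k)\<^sup>2)) \<le> (\<Sum>k<n. 3 * (arctan (x + real (Suc k)) - arctan (x + real k)))"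
    using step[of "x + real k" for k] by (intro sum_mono) (simp add: add_ac)
  also have "\<dots> = 3 * (arctan (x + real n) - arctan x)"
    by (simp only: sum_distrib_left[symmetric] sum_lessThan_telescope[of "\<lambda>k. arctan (x + real k)"]) simp
  also have "\<dots> \<le> 3 * pi" using arctan_bounded[of "x + real n"] arctan_bounded[of x] by simp
  finally show ?thesis .
qed

text \<open>Gauss's product: \<open>Gamma_series z N\<close> tends to \<open>Gamma z\<close>, and
  Gamma(z + N + 1) equals Gamma(z) N! N^z divided by \<open>Gamma_series z N\<close>. In the
  quotient N! cancels, and the remaining power of N is compared with that of u + N + 1, whose ratio
  to N tends to 1.\<close>

lemma Gamma_quotient_limit:
  fixes a b u :: complex
  assumes "a + u \<notin> \<int>\<^sub>\<le>\<^sub>0" "b + u \<notin> \<int>\<^sub>\<le>\<^sub>0"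
  shows "(\<lambda>N. Gamma (a + u + of_nat N) / Gamma (b + u + of_nat N)
            * exp ((b - a) * Ln (u + of_nat N))) \<longlonglongrightarrow> 1"
proof -
  define A B where "A = a + u" and "B = b + u"
  have nz: "Gamma A \<noteq> 0" "Gamma B \<noteq> 0" using assms by (auto simp: A_def B_def Gamma_eq_zero_iff)
  have "(\<lambda>N. (Gamma A / Gamma_series A N) / (Gamma B / Gamma_series B N) * exp ((b - a) * (Ln ((u + of_nat (N + 1)) / of_nat N))))
     \<longlonglongrightarrow> (Gamma A / Gamma A) / (Gamma B / Gamma B) * exp ((b - a) * Ln 1)"
  proof (intro tendsto_intros)
    have "(\<lambda>N. (u + of_nat (N + 1)) / of_nat N :: complex) \<longlonglongrightarrow> 0 + 1"
    proof -
      have "(\<lambda>N. (u + 1) / of_nat N + of_nat N / of_nat N :: complex) \<longlonglongrightarrow> 0 + 1"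
      proof (intro tendsto_add)
        show "(\<lambda>N. (u + 1) / of_nat N) \<longlonglongrightarrow> 0" by (rule lim_const_over_n)
        show "(\<lambda>N. of_nat N / of_nat N :: complex) \<longlonglongrightarrow> 1"
          by (rule tendsto_eventually) (auto intro!: eventually_sequentiallyI[of 1])
      qed
      then show ?thesis by (simp add: add_divide_distrib add_ac)
    qed
    then show "(\<lambda>N. (u + of_nat (N + 1)) / of_nat N :: complex) \<longlonglongrightarrow> 1" by simp
  qed (use nz in auto)
  then have "(\<lambda>N. (Gamma A / Gamma_series A N) / (Gamma B / Gamma_series B N) * exp ((b - a) * (Ln ((u + of_nat (N + 1)) / of_nat N))))
     \<longlonglongrightarrow> 1" using nz by simp
  moreover have "eventually (\<lambda>N. (Gamma A / Gamma_series A N) / (Gamma B / Gamma_series B N) * exp ((b - a) * (Ln ((u + of_nat (N + 1)) / of_nat N)))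
     = Gamma (a + u + of_nat (N + 1)) / Gamma (b + u + of_nat (N + 1))
            * exp ((b - a) * Ln (u + of_nat (N + 1)))) sequentially"
  proof -
    have "eventually (\<lambda>N. real N > norm u) sequentially"
      by (metis filterlim_at_top_dense filterlim_real_sequentially)
    then show ?thesis using eventually_gt_at_top[of 0]
    proof eventually_elim
      case (elim N)
      have "u + of_nat (N + 1) \<noteq> 0"
      proof
        assume "u + of_nat (N + 1) = 0"
        then have "u = - of_nat (N+1)" by (metis eq_neg_iff_add_eq_0)
        then have "norm u = real (N + 1)" by (metis norm_minus_cancel norm_of_nat)
        then show False using elim by simp
      qed
      then have L: "Ln ((u + of_nat (N + 1)) / of_nat N) = Ln (u + of_nat (N + 1)) - of_real (ln (real N))"
        using Ln_divide_of_real[of "real N" "u + of_nat (N+1)"] elim by simp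
      have G: "Gamma (z + of_nat (N + 1)) = (Gamma z / Gamma_series z N) * (fact N * exp (z * of_real (ln (real N))))"
        if "z \<notin> \<int>\<^sub>\<le>\<^sub>0" for z :: complex
      proof -
        have "pochhammer z (N + 1) \<noteq> 0" using that by (auto simp: pochhammer_eq_0_iff)
        then show ?thesis using pochhammer_Gamma[OF that, of "N+1"] that
          by (simp add: Gamma_series_def Gamma_eq_zero_iff field_simps)
      qed
      have E: "exp ((b - a) * (Ln (u + of_nat (N + 1)) - of_real (ln (real N))))
         = exp (A * of_real (ln (real N))) / exp (B * of_real (ln (real N))) * exp ((b - a) * Ln (u + of_nat (N + 1)))"
        by (simp add: exp_diff[symmetric] exp_add[symmetric] A_def B_def algebra_simps)
      show ?case unfolding L E
        using G[of A] G[of B] assms by (simp add: A_def[symmetric] B_def[symmetric] mult_ac)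
    qed
  qed
  ultimately have "(\<lambda>N. Gamma (a + u + of_nat (N + 1)) / Gamma (b + u + of_nat (N + 1))
            * exp ((b - a) * Ln (u + of_nat (N + 1)))) \<longlonglongrightarrow> 1"
    by (rule Lim_transform_eventually)
  \<comment> \<open>The computation runs at N + 1 because \<open>Gamma_series z N\<close> contains
    \<open>pochhammer z (N + 1)\<close>.\<close>
  then show ?thesis by (rule LIMSEQ_offset)
qed

text \<open>The region is invariant under adding 1 to u, so the one-step comparison can be iterated
  N times. As N grows the far end tends to 1, and the accumulated error stays below a constant
  independent of u and N. Only a fixed distance from the negative axis is required, not one
  proportional to |u|.\<close>

lemma Gamma_quotient_bound:
  fixes a b :: complex
  obtains C K where "C \<ge> 0" "K \<ge> 1" "K > norm a" "K > norm b"
    "\<And>u. K \<le> \<bar>Im u\<bar> \<or> K \<le> Re u \<Longrightarrow>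
       norm (Gamma (a + u) / Gamma (b + u)) \<le> C * norm u powr Re (a - b)"
proof -
  define h where "h = (\<lambda>u. Gamma (a + u) / Gamma (b + u) * exp ((b - a) * Ln u))"
  obtain C K where CK: "C \<ge> 0" "K \<ge> 1" "K > norm a" "K > norm b"
    and step: "\<And>u. K \<le> \<bar>Im u\<bar> \<or> K \<le> Re u \<Longrightarrow> norm (h u) \<le> norm (h (u + 1)) * exp (C / norm u ^ 2)"
    unfolding h_def using Gamma_quotient_step[of a b] by metis
  have iter: "norm (h u) \<le> norm (h (u + of_nat N)) * exp (\<Sum>k<N. C / norm (u + of_nat k) ^ 2)"
    if u: "K \<le> \<bar>Im u\<bar> \<or> K \<le> Re u" for u N
  proof (induction N)
    case (Suc N)
    have "norm (h (u + of_nat N)) \<le> norm (h (u + of_nat N + 1)) * exp (C / norm (u + of_nat N) ^ 2)"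
      using u by (intro step) auto
    then have "norm (h (u + of_nat N)) * exp (\<Sum>k<N. C / norm (u + of_nat k) ^ 2)
       \<le> norm (h (u + of_nat N + 1)) * exp (C / norm (u + of_nat N) ^ 2) * exp (\<Sum>k<N. C / norm (u + of_nat k) ^ 2)"
      by (intro mult_right_mono) auto
    also have "\<dots> = norm (h (u + of_nat (Suc N))) * exp (\<Sum>k<Suc N. C / norm (u + of_nat k) ^ 2)"
      by (simp add: exp_add add_ac mult_ac)
    finally show ?case using Suc by linarith
  qed simp
  \<comment> \<open>6 pi is twice the bound 3 pi: since |Im u| \<ge> 1 or |Re u + k| \<ge> 1, the
    square |u + k|^2 is at least half of 1 + (Re u + k)^2.\<close>
  define E where "E = exp (C * (6 * pi))"
  have hb: "norm (h u) \<le> E" if u: "K \<le> \<bar>Im u\<bar> \<or> K \<le> Re u" for u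
  proof -
    have sb: "(\<Sum>k<N. C / norm (u + of_nat k) ^ 2) \<le> C * (6 * pi)" for N
    proof -
      have "C / norm (u + of_nat k) ^ 2 \<le> 2 * C * (1 / (1 + (Re u + real k)\<^sup>2))" for k
      proof -
        have aux: "1 + B \<le> 2 * (B + A)" if "1 \<le> A \<or> 1 \<le> B" "0 \<le> A" "0 \<le> B" for A B :: real
          using that by auto
        have "1 \<le> (Im u)\<^sup>2 \<or> 1 \<le> (Re u + real k)\<^sup>2"
        proof -
          from u have "1 \<le> \<bar>Im u\<bar> \<or> 1 \<le> \<bar>Re u + real k\<bar>" using CK(2) by linarith
          then show ?thesis using abs_le_square_iff[of 1 "Im u"] abs_le_square_iff[of 1 "Re u + real k"] by simp
        qed
        then have "1 + (Re u + real k)\<^sup>2 \<le> 2 * norm (u + of_nat k) ^ 2"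
          using aux[of "(Im u)\<^sup>2" "(Re u + real k)\<^sup>2"]
          by (simp add: cmod_power2)
        moreover have "1 + (Re u + real k)\<^sup>2 > 0" by (simp add: add_pos_nonneg)
        ultimately have "norm (u + of_nat k) ^ 2 > 0" "1 + (Re u + real k)\<^sup>2 > 0"
          "1 + (Re u + real k)\<^sup>2 \<le> 2 * norm (u + of_nat k) ^ 2" by linarith+
        then have "1 / norm (u + of_nat k) ^ 2 \<le> 2 * (1 / (1 + (Re u + real k)\<^sup>2))"
          by (simp add: field_simps)
        from mult_left_mono[OF this CK(1)] show ?thesis by (simp add: mult_ac)
      qed
      then have "(\<Sum>k<N. C / norm (u + of_nat k) ^ 2) \<le> 2 * C * (\<Sum>k<N. 1 / (1 + (Re u + real k)\<^sup>2))"
        unfolding sum_distrib_left by (intro sum_mono) auto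
      also have "\<dots> \<le> 2 * C * (3 * pi)"
        using CK by (intro mult_left_mono sum_inverse_square_shift_le) auto
      finally show ?thesis by simp
    qed
    have lim: "(\<lambda>N. norm (h (u + of_nat N)) * E) \<longlonglongrightarrow> norm (1::complex) * E"
      unfolding h_def using Gamma_quotient_limit[of a u b] not_nonpos_Int_region[OF _ u] CK
      by (intro tendsto_intros) (auto simp: add_ac)
    have "norm (h u) \<le> norm (h (u + of_nat N)) * E" for N
      unfolding E_def by (rule order_trans[OF iter[OF u, of N]]) (use sb[of N] in \<open>simp add: mult_left_mono\<close>)
    then show ?thesis using LIMSEQ_le_const[OF lim] by simp
  qed
  \<comment> \<open>The exponential pays for replacing the modulus of
    \<open>exp ((b - a) * Ln u)\<close> by a real power of |u|: the imaginary part of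
    \<open>Ln u\<close> is at most pi in modulus.\<close>
  define D where "D = E * exp (pi * \<bar>Im (b - a)\<bar>)"
  show ?thesis
  proof (rule that[of D K])
    fix u :: complex assume u: "K \<le> \<bar>Im u\<bar> \<or> K \<le> Re u"
    have u0: "u \<noteq> 0" using u CK by auto
    have "norm (exp ((b - a) * Ln u)) = exp (Re (b - a) * ln (norm u) - Im (b - a) * Im (Ln u))"
      using Re_Ln[OF u0] by (simp add: norm_exp_eq_Re)
    moreover have "Im (b - a) * Im (Ln u) \<le> pi * \<bar>Im (b - a)\<bar>"
    proof -
      have "\<bar>Im (Ln u)\<bar> \<le> pi" using Im_Ln_le_pi[OF u0] mpi_less_Im_Ln[OF u0] by linarith
      then have "\<bar>Im (Ln u)\<bar> * \<bar>Im (b - a)\<bar> \<le> pi * \<bar>Im (b - a)\<bar>" by (intro mult_right_mono) auto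
      then show ?thesis by (metis abs_le_D1 abs_mult mult.commute)
    qed
    ultimately have "norm (exp ((b - a) * Ln u)) \<ge> exp (Re (b - a) * ln (norm u)) * exp (- (pi * \<bar>Im (b - a)\<bar>))"
      using Re_Ln[OF u0] by (simp add: exp_add[symmetric])
    from mult_left_mono[OF this norm_ge_zero[of "Gamma (a + u) / Gamma (b + u)"]]
    have "norm (Gamma (a + u) / Gamma (b + u)) * (exp (Re (b - a) * ln (norm u)) * exp (- (pi * \<bar>Im (b - a)\<bar>))) \<le> E"
      using hb[OF u] unfolding h_def norm_mult by linarith
    moreover have "exp (Re (b - a) * ln (norm u)) = inverse (norm u powr Re (a - b))"
      using u0 by (simp add: powr_def exp_minus[symmetric] algebra_simps)
    moreover have fl: "N \<le> E' * q * p" if "N * (inverse p * inverse q) \<le> E'" "p > 0" "q > 0" for N p q E' :: real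
      using that by (simp add: field_simps)
    ultimately show "norm (Gamma (a + u) / Gamma (b + u)) \<le> D * norm u powr Re (a - b)"
      using u0 unfolding D_def by (intro fl) (simp_all add: exp_minus)
  qed (use CK in \<open>auto simp: D_def E_def\<close>)
qed

section \<open>Gamma quotients of vectors and their growth\<close>

definition Gamma_quot :: "complex list \<Rightarrow> complex list \<Rightarrow> complex \<Rightarrow> complex" where
  "Gamma_quot a b u = Gamma_vec (shift_vec a u) / Gamma_vec (shift_vec b u)"

lemma Gamma_quot_Nil [simp]: "Gamma_quot [] [] u = 1"
  by (simp add: Gamma_quot_def Gamma_vec_def shift_vec_def)

lemma Gamma_quot_Cons: "Gamma_quot (x # a) (y # b) u = Gamma (x + u) / Gamma (y + u) * Gamma_quot a b u"
  by (simp add: Gamma_quot_def Gamma_vec_def shift_vec_def)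

lemma psi_Cons: "psi (x # a) (y # b) = (y - x) + psi a b"
  by (simp add: psi_def sum.lessThan_Suc_shift del: sum.lessThan_Suc)

text \<open>The regions \<open>R K\<close> shrink as \<open>K\<close> grows, so the thresholds of
  the components are merged by a maximum. With \<open>R\<close> abstract, one induction serves both
  the region of large |Im u| or Re u and the left end of a strip.\<close>

lemma Gamma_quot_bound_family:
  fixes R :: "real \<Rightarrow> complex set"
  assumes "length a = length b" and R: "\<And>K K'. K \<le> K' \<Longrightarrow> R K' \<subseteq> R K" "0 \<notin> R 1"
    and "\<And>x y. x \<in> set a \<Longrightarrow> \<exists>C\<ge>0. \<exists>K. \<forall>u\<in>R K. norm (Gamma (x + u) / Gamma (y + u)) \<le> C * norm u powr Re (x - y)"
  shows "\<exists>C\<ge>0. \<exists>K. \<forall>u\<in>R K. norm (Gamma_quot a b u) \<le> C * norm u powr (- Re (psi a b))"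
  using assms(1,4)
proof (induction rule: list_induct2)
  case Nil
  have "norm (Gamma_quot [] [] u) \<le> 1 * norm u powr (- Re (psi [] []))" if "u \<in> R 1" for u
  proof -
    \<comment> \<open>At u = 0 the bound would read 1 \<le> 0, because
      \<open>0 powr 0 = 0\<close>.\<close>
    have "u \<noteq> 0" using that R(2) by auto
    then show ?thesis by (simp add: psi_def)
  qed
  then show ?case by (intro exI[of _ 1]) auto
next
  case (Cons x a y b)
  obtain C K where 1: "C \<ge> 0" "\<And>u. u \<in> R K \<Longrightarrow> norm (Gamma_quot a b u) \<le> C * norm u powr (- Re (psi a b))"
    using Cons by (metis list.set_intros(2))
  obtain C' K' where 2: "C' \<ge> 0" "\<And>u. u \<in> R K' \<Longrightarrow> norm (Gamma (x + u) / Gamma (y + u)) \<le> C' * norm u powr Re (x - y)"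
    using Cons.prems[of x y] by auto
  have "norm (Gamma_quot (x # a) (y # b) u) \<le> (C' * C) * norm u powr (- Re (psi (x # a) (y # b)))"
    if "u \<in> R (max K K')" for u
  proof -
    have u: "u \<in> R K" "u \<in> R K'" using that R(1)[of K "max K K'"] R(1)[of K' "max K K'"] by auto
    have "norm (Gamma_quot (x # a) (y # b) u) \<le> (C' * norm u powr Re (x - y)) * (C * norm u powr (- Re (psi a b)))"
      unfolding Gamma_quot_Cons norm_mult using u 1 2 by (intro mult_mono) auto
    also have "\<dots> = (C' * C) * (norm u powr Re (x - y) * norm u powr (- Re (psi a b)))" by simp
    finally show ?thesis by (simp add: powr_add[symmetric] psi_Cons)
  qed
  with 1 2 show ?case by (intro exI[of _ "C' * C"] conjI exI[of _ "max K K'"]) auto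
qed

lemma Gamma_quot_bound:
  assumes "length a = length b"
  obtains C K where "C \<ge> 0" "K \<ge> 1" "\<And>x. x \<in> set a \<Longrightarrow> norm x < K"
    "\<And>u. K \<le> \<bar>Im u\<bar> \<or> K \<le> Re u \<Longrightarrow> norm (Gamma_quot a b u) \<le> C * norm u powr (- Re (psi a b))"
proof -
  define R where "R = (\<lambda>K. {u. K \<le> \<bar>Im u\<bar> \<or> K \<le> Re u})"
  have "\<exists>C\<ge>0. \<exists>K. \<forall>u\<in>R K. norm (Gamma (x + u) / Gamma (y + u)) \<le> C * norm u powr Re (x - y)" for x y
    using Gamma_quotient_bound[of x y] unfolding R_def by (metis mem_Collect_eq)
  moreover have "R K' \<subseteq> R K" if "K \<le> K'" for K K' using that unfolding R_def by (blast intro: order_trans)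
  moreover have "0 \<notin> R 1" by (simp add: R_def)
  ultimately obtain C K where CK: "C \<ge> 0" "\<And>u. u \<in> R K \<Longrightarrow> norm (Gamma_quot a b u) \<le> C * norm u powr (- Re (psi a b))"
    using Gamma_quot_bound_family[OF assms, of R] by blast
  \<comment> \<open>Besides the growth threshold, \<open>K'\<close> exceeds every |x|, so that it
    can serve as the height of a loop around all left poles.\<close>
  define K' where "K' = Max (insert (max K 1) (norm ` set a)) + 1"
  have m: "y \<le> Max (insert (max K 1) (norm ` set a))" if "y \<in> insert (max K 1) (norm ` set a)" for y
    using that by (intro Max_ge) auto
  show ?thesis
  proof (rule that[OF CK(1), of K'])
    have mK: "max K 1 \<le> Max (insert (max K 1) (norm ` set a))" by (rule m) simp
    then show "1 \<le> K'" unfolding K'_def by linarith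
    have "K \<le> K'" using mK unfolding K'_def by linarith
    show "norm x < K'" if x: "x \<in> set a" for x
    proof -
      have "norm x \<le> Max (insert (max K 1) (norm ` set a))" by (rule m) (use x in auto)
      then show ?thesis unfolding K'_def by linarith
    qed
    fix u assume "K' \<le> \<bar>Im u\<bar> \<or> K' \<le> Re u"
    then show "norm (Gamma_quot a b u) \<le> C * norm u powr (- Re (psi a b))"
      using \<open>K \<le> K'\<close> by (intro CK(2)) (auto simp: R_def)
  qed
qed

text \<open>For z = x + iy, |sin z|^2 equals both cosh(y)^2 - cos(x)^2 and sinh(y)^2 + sin(x)^2. The
  resulting bounds do not depend on x, as a strip that is infinite to the left demands.\<close>

lemma norm_sin_le_cosh: "norm (sin z) \<le> cosh (Im z)"
  and abs_sinh_le_norm_sin: "\<bar>sinh (Im z)\<bar> \<le> norm (sin z)" for z :: complex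
proof -
  have eq: "(norm (sin z))\<^sup>2 = (cosh (Im z))\<^sup>2 - (cos (Re z))\<^sup>2" "(norm (sin z))\<^sup>2 = (sinh (Im z))\<^sup>2 + (sin (Re z))\<^sup>2"
  proof -
    have "Re (sin z) = sin (Re z) * cosh (Im z)" "Im (sin z) = cos (Re z) * sinh (Im z)"
      by (simp_all add: Re_sin Im_sin cosh_def sinh_def)
    then have "(norm (sin z))\<^sup>2 = (sin (Re z))\<^sup>2 * (cosh (Im z))\<^sup>2 + (cos (Re z))\<^sup>2 * (sinh (Im z))\<^sup>2"
      by (simp add: cmod_power2 power_mult_distrib)
    then show "(norm (sin z))\<^sup>2 = (cosh (Im z))\<^sup>2 - (cos (Re z))\<^sup>2" "(norm (sin z))\<^sup>2 = (sinh (Im z))\<^sup>2 + (sin (Re z))\<^sup>2"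
      by (simp_all add: cosh_square_eq cos_squared_eq algebra_simps)
  qed
  show "norm (sin z) \<le> cosh (Im z)"
    by (rule power2_le_imp_le) (auto simp: eq(1))
  show "\<bar>sinh (Im z)\<bar> \<le> norm (sin z)"
    by (rule power2_le_imp_le) (auto simp: eq(2))
qed

text \<open>In a strip, the reflection formula reduces the left end to the right half-plane.\<close>

lemma Gamma_quotient_strip_bound:
  fixes a b :: complex
  assumes "\<And>y. y1 \<le> y \<Longrightarrow> y \<le> y2 \<Longrightarrow> y \<noteq> - Im a"
  obtains C \<rho> where "C \<ge> 0" "\<rho> < 0"
    "\<And>u. y1 \<le> Im u \<Longrightarrow> Im u \<le> y2 \<Longrightarrow> Re u \<le> \<rho> \<Longrightarrow>
       norm (Gamma (a + u) / Gamma (b + u)) \<le> C * norm u powr Re (a - b)"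
proof (cases "y1 \<le> y2")
  case False
  then show ?thesis using that[of 0 "-1"] by fastforce
next
  case True
  \<comment> \<open>Reflection exchanges the parameters: the quotient at u becomes that of 1 - b and
    1 - a at -u, whose exponent Re ((1 - b) - (1 - a)) is again Re (a - b).\<close>
  obtain C K where CK: "C \<ge> 0" "K \<ge> 1" "K > norm (1 - b)" "K > norm (1 - a)"
    "\<And>u. K \<le> \<bar>Im u\<bar> \<or> K \<le> Re u \<Longrightarrow>
       norm (Gamma ((1 - b) + u) / Gamma ((1 - a) + u)) \<le> C * norm u powr Re ((1 - b) - (1 - a))"
    using Gamma_quotient_bound[of "1 - b" "1 - a"] by metis
  \<comment> \<open>By hypothesis Im a + y has no zero on [y1, y2], so sinh does not vanish there
    and compactness bounds the quotient of the sines uniformly in Re u.\<close>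
  have cont: "continuous_on {y1..y2} (\<lambda>y. cosh (pi * (Im b + y)) / \<bar>sinh (pi * (Im a + y))\<bar>)"
    using assms by (intro continuous_intros) (force simp: add_eq_0_iff)
  then have "bounded ((\<lambda>y. cosh (pi * (Im b + y)) / \<bar>sinh (pi * (Im a + y))\<bar>) ` {y1..y2})"
    by (intro compact_imp_bounded compact_continuous_image) auto
  then obtain B where B: "B > 0" "\<And>y. y \<in> {y1..y2} \<Longrightarrow> norm (cosh (pi * (Im b + y)) / \<bar>sinh (pi * (Im a + y))\<bar>) \<le> B"
    unfolding bounded_pos by auto
  show ?thesis
  proof (rule that[of "B * C" "- K"])
    fix u assume u: "y1 \<le> Im u" "Im u \<le> y2" "Re u \<le> - K"
    have a0: "Im a + Im u \<noteq> 0" using assms[OF u(1,2)] by auto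
    have s0: "sin (pi * (a + u)) \<noteq> 0"
    proof
      assume "sin (pi * (a + u)) = 0"
      with abs_sinh_le_norm_sin[of "pi * (a + u)"] a0 show False by simp
    qed
    have G0: "Gamma (1 - b - u) \<noteq> 0" "Gamma (1 - a - u) \<noteq> 0"
      using not_nonpos_Int_region[of "1 - b" K "- u"] not_nonpos_Int_region[of "1 - a" K "- u"] u CK
      by (auto simp: Gamma_eq_zero_iff)
    have refl: "Gamma (z + u) * Gamma (1 - z - u) = pi / sin (pi * (z + u))" for z
      using Gamma_reflection_complex[of "z + u"] by (simp add: algebra_simps)
    have "Gamma (a + u) / Gamma (b + u) = sin (pi * (b + u)) / sin (pi * (a + u)) * (Gamma (1 - b - u) / Gamma (1 - a - u))"
    proof -
      have A: "Gamma (a + u) = pi / sin (pi * (a + u)) / Gamma (1 - a - u)"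
       and B: "Gamma (b + u) = pi / sin (pi * (b + u)) / Gamma (1 - b - u)"
        using refl[of a] refl[of b] G0 by (metis nonzero_eq_divide_eq)+
      show ?thesis unfolding A B using s0 G0 by simp
    qed
    also have "norm \<dots> = norm (sin (pi * (b + u))) / norm (sin (pi * (a + u))) * norm (Gamma (1 - b + (- u)) / Gamma (1 - a + (- u)))"
      by (simp add: norm_mult norm_divide)
    also have "\<dots> \<le> (cosh (pi * (Im b + Im u)) / \<bar>sinh (pi * (Im a + Im u))\<bar>) * (C * norm (- u) powr Re ((1 - b) - (1 - a)))"
    proof (intro mult_mono frac_le)
      show "norm (Gamma (1 - b + (- u)) / Gamma (1 - a + (- u))) \<le> C * norm (- u) powr Re ((1 - b) - (1 - a))"
        using u by (intro CK(5)) auto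
      show "norm (sin (pi * (b + u))) \<le> cosh (pi * (Im b + Im u))"
        using norm_sin_le_cosh[of "pi * (b + u)"] by simp
      show "\<bar>sinh (pi * (Im a + Im u))\<bar> \<le> norm (sin (pi * (a + u)))"
        using abs_sinh_le_norm_sin[of "pi * (a + u)"] by simp
    qed (use a0 CK in auto)
    also have "\<dots> \<le> B * (C * norm (- u) powr Re ((1 - b) - (1 - a)))"
      using B(2)[of "Im u"] u CK by (intro mult_right_mono) auto
    finally show "norm (Gamma (a + u) / Gamma (b + u)) \<le> B * C * norm u powr Re (a - b)" by simp
  qed (use B CK in auto)
qed

lemma Gamma_quot_strip_bound:
  assumes "length a = length b" "\<And>x y. x \<in> set a \<Longrightarrow> y1 \<le> y \<Longrightarrow> y \<le> y2 \<Longrightarrow> y \<noteq> - Im x"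
  obtains C \<rho> where "C \<ge> 0" "\<rho> < 0"
    "\<And>u. y1 \<le> Im u \<Longrightarrow> Im u \<le> y2 \<Longrightarrow> Re u \<le> \<rho> \<Longrightarrow>
       norm (Gamma_quot a b u) \<le> C * norm u powr (- Re (psi a b))"
proof -
  define R where "R = (\<lambda>K. {u. y1 \<le> Im u \<and> Im u \<le> y2 \<and> Re u \<le> - K})"
  have "\<exists>C\<ge>0. \<exists>K. \<forall>u\<in>R K. norm (Gamma (x + u) / Gamma (y + u)) \<le> C * norm u powr Re (x - y)" if xa: "x \<in> set a" for x y
  proof -
    obtain C \<rho> where "C \<ge> 0" "\<And>u. y1 \<le> Im u \<Longrightarrow> Im u \<le> y2 \<Longrightarrow> Re u \<le> \<rho> \<Longrightarrow>
        norm (Gamma (x + u) / Gamma (y + u)) \<le> C * norm u powr Re (x - y)"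
      using Gamma_quotient_strip_bound[of y1 y2 x y] assms(2)[OF xa] by metis
    then show ?thesis by (intro exI[of _ C] conjI exI[of _ "- \<rho>"]) (auto simp: R_def)
  qed
  moreover have "R K' \<subseteq> R K" if "K \<le> K'" for K K' using that by (auto simp: R_def)
  moreover have "0 \<notin> R 1" by (simp add: R_def)
  ultimately obtain C K where CK: "C \<ge> 0" "\<And>u. u \<in> R K \<Longrightarrow> norm (Gamma_quot a b u) \<le> C * norm u powr (- Re (psi a b))"
    using Gamma_quot_bound_family[OF assms(1), of R] by blast
  show ?thesis
    by (rule that[OF CK(1), of "min (- K) (- 1)"]) (auto simp: R_def intro!: CK(2))
qed

section \<open>Integrals over left loops\<close>

lemma closed_segment_Re_Im:
  assumes "z \<in> closed_segment a b"
  shows "min (Re a) (Re b) \<le> Re z" "Re z \<le> max (Re a) (Re b)"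
    "min (Im a) (Im b) \<le> Im z" "Im z \<le> max (Im a) (Im b)"
proof -
  obtain u where u: "0 \<le> u" "u \<le> 1" "z = (1 - u) *\<^sub>R a + u *\<^sub>R b"
    using assms by (auto simp: in_segment)
  have m: "min x y \<le> (1 - u) * x + u * y" "(1 - u) * x + u * y \<le> max x y" for x y :: real
  proof -
    have "(1 - u) * min x y + u * min x y \<le> (1 - u) * x + u * y"
      using u by (intro add_mono mult_left_mono) auto
    then show "min x y \<le> (1 - u) * x + u * y" by (simp add: algebra_simps)
    have "(1 - u) * x + u * y \<le> (1 - u) * max x y + u * max x y"
      using u by (intro add_mono mult_left_mono) auto
    then show "(1 - u) * x + u * y \<le> max x y" by (simp add: algebra_simps)
  qed
  show "min (Re a) (Re b) \<le> Re z" "Re z \<le> max (Re a) (Re b)"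
    "min (Im a) (Im b) \<le> Im z" "Im z \<le> max (Im a) (Im b)"
    using m[of "Re a" "Re b"] m[of "Im a" "Im b"] u(3) by auto
qed

text \<open>Near any point only finitely many elements of \<open>L\<close> are present, so
  \<open>L\<close> has no accumulation point. Pole sets running off to -infinity are of this
  kind.\<close>

lemma closed_if_finite_right:
  fixes L :: "complex set"
  assumes "\<And>x. finite {z\<in>L. x \<le> Re z}"
  shows "closed L"
proof -
  have "\<exists>T. open T \<and> z \<in> T \<and> T \<subseteq> - L" if "z \<in> - L" for z
  proof (intro exI conjI)
    show "open (- {p\<in>L. Re z - 1 \<le> Re p} \<inter> {p. Re z - 1 < Re p})"
      using assms by (intro open_Int open_Compl finite_imp_closed open_halfspace_Re_gt)
  qed (use that in auto)
  then have "open (- L)" by (subst open_subopen) blast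
  then show ?thesis by (simp add: open_closed)
qed

text \<open>A primitive of 1/(w - z), divided by 2 pi i, is a branch of the logarithm on
  \<open>H\<close>. The winding number of an open path in \<open>H\<close> is the increment of this
  branch, so identities between winding numbers of polygons become linear relations between its
  values at the corners.\<close>

lemma winding_number_linepath_primitive:
  assumes "open H" "convex H" "z \<notin> H"
  obtains l where "\<And>a b. a \<in> H \<Longrightarrow> b \<in> H \<Longrightarrow> winding_number (linepath a b) z = l b - l a"
proof -
  have "(\<lambda>w. 1 / (w - z)) holomorphic_on H" using assms by (auto intro!: holomorphic_intros)
  then obtain g where g: "\<And>x. x \<in> H \<Longrightarrow> (g has_field_derivative 1 / (x - z)) (at x within H)"
    using holomorphic_convex_primitive' assms by blast
  show ?thesis
  proof (rule that[of "\<lambda>w. g w / (2 * pi * \<i>)"])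
    fix a b assume ab: "a \<in> H" "b \<in> H"
    have sub: "path_image (linepath a b) \<subseteq> H" using ab assms by (simp add: closed_segment_subset)
    have "((\<lambda>w. 1 / (w - z)) has_contour_integral (g b - g a)) (linepath a b)"
      using contour_integral_primitive[OF g, of "linepath a b"] sub by auto
    then show "winding_number (linepath a b) z = g b / (2 * pi * \<i>) - g a / (2 * pi * \<i>)"
      using sub assms by (subst winding_number_valid_path) (auto simp: contour_integral_unique diff_divide_distrib)
  qed
qed

lemma convex_halfplanes: "convex {z. Re z < x}" "convex {z. x < Re z}" "convex {z. Im z < x}" "convex {z. x < Im z}"
  using convex_halfspace_Re_lt[of x] convex_halfspace_Re_gt[of x] convex_halfspace_Im_lt[of x] convex_halfspace_Im_gt[of x]
  by auto

text \<open>Logarithm branches below, above and to the left of \<open>z\<close>. Two of them differ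
  by a constant on a quadrant that they share, which glues the pieces of different contours.\<close>

lemma winding_number_linepath_halfplanes:
  obtains l1 l2 l3 where "\<And>a b. Im a < Im z \<Longrightarrow> Im b < Im z \<Longrightarrow> winding_number (linepath a b) z = l1 b - l1 a"
    and "\<And>a b. Im z < Im a \<Longrightarrow> Im z < Im b \<Longrightarrow> winding_number (linepath a b) z = l2 b - l2 a"
    and "\<And>a b. Re a < Re z \<Longrightarrow> Re b < Re z \<Longrightarrow> winding_number (linepath a b) z = l3 b - l3 a"
proof -
  obtain l1 where l1: "\<And>a b. Im a < Im z \<Longrightarrow> Im b < Im z \<Longrightarrow> winding_number (linepath a b) z = l1 b - l1 a"
    using winding_number_linepath_primitive[OF open_halfspace_Im_lt convex_halfplanes(3), of z "Im z"] by auto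
  obtain l2 where l2: "\<And>a b. Im z < Im a \<Longrightarrow> Im z < Im b \<Longrightarrow> winding_number (linepath a b) z = l2 b - l2 a"
    using winding_number_linepath_primitive[OF open_halfspace_Im_gt convex_halfplanes(4), of z "Im z"] by auto
  obtain l3 where l3: "\<And>a b. Re a < Re z \<Longrightarrow> Re b < Re z \<Longrightarrow> winding_number (linepath a b) z = l3 b - l3 a"
    using winding_number_linepath_primitive[OF open_halfspace_Re_lt convex_halfplanes(1), of z "Re z"] by auto
  show ?thesis by (rule that[OF l1 l2 l3])
qed

lemma path_image_truncated_loop:
  assumes "left_loop g"
  shows "path_image (truncated_loop g R) =
    closed_segment (pathstart g - of_real R) (pathstart g) \<union> path_image g \<union>
    closed_segment (pathfinish g) (pathfinish g - of_real R) \<union>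
    closed_segment (pathfinish g - of_real R) (pathstart g - of_real R)"
  unfolding truncated_loop_def by (auto simp: path_image_join)

lemma winding_number_truncated_loop:
  assumes "left_loop g" "z \<notin> path_image (truncated_loop g R)"
  shows "winding_number (truncated_loop g R) z =
    winding_number (linepath (pathstart g - of_real R) (pathstart g)) z + winding_number g z
    + winding_number (linepath (pathfinish g) (pathfinish g - of_real R)) z
    + winding_number (linepath (pathfinish g - of_real R) (pathstart g - of_real R)) z"
proof -
  have p: "path g" using assms(1) by (simp add: left_loop_def valid_path_imp_path)
  have "z \<notin> closed_segment (pathstart g - of_real R) (pathstart g)" "z \<notin> path_image g"
    "z \<notin> closed_segment (pathfinish g) (pathfinish g - of_real R)"
    "z \<notin> closed_segment (pathfinish g - of_real R) (pathstart g - of_real R)"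
    using assms by (auto simp: path_image_truncated_loop)
  then show ?thesis unfolding truncated_loop_def using p
    by (simp add: winding_number_join path_image_join)
qed

text \<open>All translates z - l lie left of the loop. For large l the translate is beyond the
  bounded middle part; if its height were outside the strip between the two rays, a vertical ray to
  infinity would avoid the truncated loop and force winding number 0 instead of 1.\<close>

lemma left_loop_pole_height:
  assumes g: "left_loop g" and left: "\<And>l::nat. on_left_of_loop g (z - of_nat l)"
  shows "Im (pathstart g) < Im z" "Im z < Im (pathfinish g)"
proof -
  define A B where "A = pathstart g" and "B = pathfinish g"
  have AB: "Im A < Im B" using g by (simp add: left_loop_def A_def B_def)
  have p: "valid_path g" using g by (simp add: left_loop_def)
  have "bounded (path_image g)" using p by (simp add: bounded_path_image valid_path_imp_path)
  then obtain K where K: "\<And>w. w \<in> path_image g \<Longrightarrow> norm w \<le> K" unfolding bounded_iff by auto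
  have ReK: "- K \<le> Re w" if "w \<in> path_image g" for w
    using K[OF that] abs_Re_le_cmod[of w] by linarith
  have "A \<in> path_image g" "B \<in> path_image g" by (auto simp: A_def B_def)
  note ABK = ReK[OF this(1)] ReK[OF this(2)]
  obtain l :: nat where l: "real l > Re z + K" using reals_Archimedean2 by blast
  define z' where "z' = z - of_nat l"
  have z': "Re z' < - K" "Im z' = Im z" using l by (auto simp: z'_def)
  have "eventually (\<lambda>R. z' \<notin> path_image (truncated_loop g R) \<and> winding_number (truncated_loop g R) z' = 1) at_top"
    using left[of l] by (simp add: on_left_of_loop_def z'_def)
  then have "eventually (\<lambda>R. z' \<notin> path_image (truncated_loop g R) \<and> winding_number (truncated_loop g R) z' = 1 \<and>
     R > Re A - Re z' \<and> R > Re B - Re z') at_top"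
    using eventually_gt_at_top[of "Re A - Re z'"] eventually_gt_at_top[of "Re B - Re z'"]
    by eventually_elim auto
  then obtain R where R: "z' \<notin> path_image (truncated_loop g R)" "winding_number (truncated_loop g R) z' = 1"
    "R > Re A - Re z'" "R > Re B - Re z'"
    using eventually_happens'[OF trivial_limit_at_top_linorder] by blast
  note img = path_image_truncated_loop[OF g, of R, folded A_def B_def]
  \<comment> \<open>A translate at the height of an end point would lie on the loop itself.\<close>
  have onray: "z' \<in> closed_segment (P - of_real R) P" if "Im P = Im z'" "Re z' \<le> Re P" "R > Re P - Re z'" for P
  proof -
    have "z' = (1 - (R - (Re P - Re z')) / R) *\<^sub>R (P - of_real R) + ((R - (Re P - Re z')) / R) *\<^sub>R P"
      using that by (auto simp: complex_eq_iff field_simps)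
    then show ?thesis unfolding in_segment using that by (intro exI[of _ "(R - (Re P - Re z')) / R"]) auto
  qed
  have noA: "Im z' \<noteq> Im A" using onray[of A] R z' ABK unfolding img by auto
  have noB: "Im z' \<noteq> Im B" using onray[of B] R z' ABK unfolding img by (auto simp: closed_segment_commute)
  \<comment> \<open>A vertical ray from \<open>z'\<close> avoiding the loop puts \<open>z'\<close> in the unbounded component.\<close>
  have outs: False if s: "s = 1 \<or> s = - 1" and off: "\<And>r. r \<ge> 0 \<Longrightarrow> z' + of_real (s * r) * \<i> \<notin> path_image (truncated_loop g R)" for s :: real
  proof -
    define V where "V = (\<lambda>r. z' + of_real (s * r) * \<i>) ` {0..}"
    have "connected V" unfolding V_def by (intro connected_continuous_image continuous_intros) auto
    moreover have "V \<subseteq> - path_image (truncated_loop g R)" using off by (auto simp: V_def)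
    moreover have "z' \<in> V" unfolding V_def by (rule image_eqI[of _ _ 0]) auto
    ultimately have "V \<subseteq> connected_component_set (- path_image (truncated_loop g R)) z'"
      by (intro connected_component_maximal)
    moreover have "\<not> bounded V"
    proof
      assume "bounded V"
      then obtain b where b: "\<And>w. w \<in> V \<Longrightarrow> norm w \<le> b" unfolding bounded_iff by auto
      define r where "r = \<bar>b\<bar> + norm z' + 1"
      have "z' + of_real (s * r) * \<i> \<in> V" unfolding V_def by (rule image_eqI[of _ _ r]) (auto simp: r_def add_nonneg_nonneg)
      from b[OF this] have "norm (of_real (s * r) * \<i>) - norm z' \<le> b"
        using norm_triangle_ineq2[of "of_real (s * r) * \<i>" "- z'"] by (simp add: add.commute)
      moreover have "norm (of_real (s * r) * \<i>) = r" proof -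
        have "r \<ge> 0" by (simp add: r_def)
        then show ?thesis using s by (auto simp: norm_mult)
      qed
      ultimately show False by (auto simp: r_def)
    qed
    ultimately have "\<not> bounded (connected_component_set (- path_image (truncated_loop g R)) z')"
      using bounded_subset by metis
    then have "z' \<in> outside (path_image (truncated_loop g R))"
      using R(1) by (simp add: outside_def)
    moreover have "path (truncated_loop g R)" "pathfinish (truncated_loop g R) = pathstart (truncated_loop g R)"
      unfolding truncated_loop_def using p by (auto simp: valid_path_imp_path)
    ultimately have "winding_number (truncated_loop g R) z' = 0"
      using winding_number_zero_in_outside by blast
    with R show False by simp
  qed
  have up: False if "Im z' > Im B"
  proof (rule outs[of 1])
    fix r :: real assume r: "r \<ge> 0"
    let ?w = "z' + of_real (1 * r) * \<i>"
    have w: "Im ?w > Im B" "Im ?w > Im A" "Re ?w < - K" using r that AB z' by auto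
    show "?w \<notin> path_image (truncated_loop g R)"
    proof -
      have "?w \<notin> path_image g" using w(3) ReK by (metis not_less)
      moreover have "?w \<notin> closed_segment P Q" if "Im ?w > Im P" "Im ?w > Im Q" for P Q
        using that closed_segment_Re_Im(4)[of ?w P Q] by linarith
      ultimately show ?thesis unfolding img using w by simp
    qed
  qed auto
  have down: False if "Im z' < Im A"
  proof (rule outs[of "-1"])
    fix r :: real assume r: "r \<ge> 0"
    let ?w = "z' + of_real (- 1 * r) * \<i>"
    have w: "Im ?w < Im B" "Im ?w < Im A" "Re ?w < - K" using r that AB z' by auto
    show "?w \<notin> path_image (truncated_loop g R)"
    proof -
      have "?w \<notin> path_image g" using w(3) ReK by (metis not_less)
      moreover have "?w \<notin> closed_segment P Q" if "Im ?w < Im P" "Im ?w < Im Q" for P Q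
        using that closed_segment_Re_Im(3)[of ?w P Q] by linarith
      ultimately show ?thesis unfolding img using w by simp
    qed
  qed auto
  show "Im (pathstart g) < Im z" "Im z < Im (pathfinish g)"
  proof -
    have "\<not> Im B < Im z'" "\<not> Im z' < Im A" using up down by blast+
    then show "Im (pathstart g) < Im z" "Im z < Im (pathfinish g)"
      using noA noB z' by (fold A_def B_def) linarith+
  qed
qed

text \<open>The exponent below -1 makes every ray in the strip integrable, and uniformity over the
  strip makes vertical connections far to the left negligible, so that rays can be moved up and
  down. A negative \<open>\<rho>\<close> keeps the base \<open>- Re z\<close> positive.\<close>

definition ray_decay :: "(complex \<Rightarrow> complex) \<Rightarrow> real \<Rightarrow> real \<Rightarrow> bool" where
  "ray_decay f y1 y2 \<longleftrightarrow> (\<exists>C \<delta> \<rho>. 0 < \<delta> \<and> \<rho> < 0 \<and>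
     (\<forall>z. y1 \<le> Im z \<longrightarrow> Im z \<le> y2 \<longrightarrow> Re z \<le> \<rho> \<longrightarrow> norm (f z) \<le> C * (- Re z) powr (- 1 - \<delta>)))"

text \<open>Oriented from -infinity towards \<open>P\<close>; a ray leaving to -infinity therefore
  enters with a minus sign.\<close>

definition ray_integral :: "(complex \<Rightarrow> complex) \<Rightarrow> complex \<Rightarrow> complex" where
  "ray_integral f P = (LBINT r:{0..}. f (P - of_real r))"

lemma set_integrable_powr_tail:
  fixes \<delta> a :: real
  assumes "\<delta> > 0" "a > 0"
  shows "set_integrable lborel {a..} (\<lambda>r. r powr (- 1 - \<delta>))"
proof -
  have "((\<lambda>r. r powr (- 1 - \<delta>)) has_integral -(a powr (- 1 - \<delta> + 1)) / (- 1 - \<delta> + 1)) {a..}"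
    by (rule has_integral_powr_to_inf) (use assms in auto)
  then have "(\<lambda>r. r powr (- 1 - \<delta>)) absolutely_integrable_on {a..}"
    by (intro nonnegative_absolutely_integrable_1) (auto simp: has_integral_integrable)
  then show ?thesis
    unfolding set_integrable_def
    by (subst (asm) integrable_completion) (auto intro!: borel_measurable_continuous_on_indicator continuous_intros)
qed

lemma ray_set_integrable:
  assumes cont: "continuous_on ((\<lambda>r. P - of_real r) ` {0..}) f" and "ray_decay f y1 y2" "y1 \<le> Im P" "Im P \<le> y2"
  shows "set_integrable lborel {0..} (\<lambda>r. f (P - of_real r))"
proof -
  obtain C \<delta> \<rho> where d: "\<delta> > 0" "\<rho> < 0"
    and C: "\<And>z. y1 \<le> Im z \<Longrightarrow> Im z \<le> y2 \<Longrightarrow> Re z \<le> \<rho> \<Longrightarrow> norm (f z) \<le> C * (- Re z) powr (- 1 - \<delta>)"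
    using assms unfolding ray_decay_def by blast
  have c: "continuous_on {0..} (\<lambda>r. f (P - of_real r))"
    by (rule continuous_on_compose2[OF cont]) (auto intro!: continuous_intros)
  \<comment> \<open>Beyond \<open>r0\<close> both r - Re P \<ge> r/2 and Re P - r \<le> \<rho> hold,
    so decay in Re z becomes decay in r.\<close>
  define r0 where "r0 = max 0 (2 * Re P) + (1 - \<rho>) * 2"
  have r0: "r0 > 0" using d by (auto simp: r0_def add_nonneg_pos)
  have "set_integrable lborel {0..r0} (\<lambda>r. f (P - of_real r))"
    using continuous_on_subset[OF c] by (intro borel_integrable_atLeastAtMost') auto
  moreover have "set_integrable lborel {r0..} (\<lambda>r. f (P - of_real r))"
  proof (rule set_integrable_bound)
    show "set_integrable lborel {r0..} (\<lambda>r. \<bar>C\<bar> * (1/2) powr (- 1 - \<delta>) * r powr (- 1 - \<delta>))"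
      using set_integrable_powr_tail[OF d(1) r0] by (rule set_integrable_mult_right)
    show "set_borel_measurable lborel {r0..} (\<lambda>r. f (P - of_real r))"
      using continuous_on_subset[OF c] r0 unfolding set_borel_measurable_def
      by (auto intro!: borel_measurable_continuous_on_indicator)
    show "AE r in lborel. r \<in> {r0..} \<longrightarrow> norm (f (P - of_real r)) \<le> norm (\<bar>C\<bar> * (1/2) powr (- 1 - \<delta>) * r powr (- 1 - \<delta>))"
    proof (intro AE_I2 impI)
      fix r assume r: "r \<in> {r0..}"
      have rr: "r / 2 \<le> r - Re P" "Re P - r \<le> \<rho>" "r > 0" using r r0 d by (auto simp: r0_def)
      have "norm (f (P - of_real r)) \<le> C * (r - Re P) powr (- 1 - \<delta>)"
        using C[of "P - of_real r"] rr assms by simp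
      also have "\<dots> \<le> \<bar>C\<bar> * ((1/2) * r) powr (- 1 - \<delta>)"
        using rr d by (intro mult_mono powr_mono2') auto
      finally show "norm (f (P - of_real r)) \<le> norm (\<bar>C\<bar> * (1/2) powr (- 1 - \<delta>) * r powr (- 1 - \<delta>))"
        using rr by (subst (asm) powr_mult) (auto simp: abs_mult mult_ac)
    qed
  qed
  ultimately have "set_integrable lborel ({0..r0} \<union> {r0..}) (\<lambda>r. f (P - of_real r))"
    by (intro set_integrable_Un) auto
  moreover have "{0..r0} \<union> {r0..} = {0..}" using r0 by auto
  ultimately show ?thesis by simp
qed

lemma ray_segment_integral:
  assumes "continuous_on (closed_segment (P - of_real R) P) f" "R \<ge> 0"
  shows "(LBINT r:{0..R}. f (P - of_real r)) = contour_integral (linepath (P - of_real R) P) f"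
proof (cases "R = 0")
  case True
  have "set_integrable lborel {0..0::real} (\<lambda>r. f (P - of_real r))"
    by (intro borel_integrable_atLeastAtMost') simp
  from set_borel_integral_eq_integral(2)[OF this] True show ?thesis by simp
next
  case False
  then have R: "R > 0" using assms by simp
  have "((\<lambda>x. f (linepath (P - of_real R) P x) * of_real R) has_integral contour_integral (linepath (P - of_real R) P) f) {0..1}"
    using has_contour_integral_integral[OF contour_integrable_continuous_linepath[OF assms(1)]]
    by (simp add: has_contour_integral_linepath)
  then have "((\<lambda>x. f (linepath (P - of_real R) P x) * of_real R) has_integral contour_integral (linepath (P - of_real R) P) f) (cbox 0 1)" by simp
  \<comment> \<open>The substitution x = 1 - r/R reverses the segment, since r counts the distance
    from \<open>P\<close>.\<close>
  from has_integral_affinity[OF this, of "- 1 / R" 1] R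
  have "((\<lambda>r. f (linepath (P - of_real R) P (- 1 / R * r + 1)) * of_real R) has_integral
     R *\<^sub>R contour_integral (linepath (P - of_real R) P) f) ((\<lambda>x. - (R * x) + R) ` cbox 0 1)"
    by (simp add: field_simps)
  moreover have "(\<lambda>x. - (R * x) + R) ` cbox 0 1 = {0..R}"
  proof -
    have "r \<in> (\<lambda>x. - (R * x) + R) ` cbox 0 1" if "r \<in> {0..R}" for r
      using that R by (intro image_eqI[of _ _ "1 - r / R"]) (auto simp: field_simps)
    moreover have "- (R * x) + R \<in> {0..R}" if "x \<in> cbox 0 1" for x
      using that R mult_left_mono[of x 1 R] by auto
    ultimately show ?thesis by blast
  qed
  moreover have "linepath (P - of_real R) P (- 1 / R * r + 1) = P - of_real r" for r
    using R by (simp add: linepath_def scaleR_conv_of_real field_simps)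
  ultimately have "((\<lambda>r. f (P - of_real r) * of_real R) has_integral
     R *\<^sub>R contour_integral (linepath (P - of_real R) P) f) {0..R}" by (simp only:)
  then have "((\<lambda>r. f (P - of_real r) * of_real R * of_real (1 / R)) has_integral
     R *\<^sub>R contour_integral (linepath (P - of_real R) P) f * of_real (1 / R)) {0..R}" by (rule has_integral_mult_left)
  then have hi: "((\<lambda>r. f (P - of_real r)) has_integral contour_integral (linepath (P - of_real R) P) f) {0..R}"
    using R by (simp add: scaleR_conv_of_real)
  have "P - of_real r \<in> closed_segment (P - of_real R) P" if "r \<in> {0..R}" for r
    unfolding in_segment using that R
    by (intro exI[of _ "1 - r / R"]) (auto simp: scaleR_conv_of_real field_simps)
  then have "continuous_on {0..R} (\<lambda>r. f (P - of_real r))"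
    by (intro continuous_on_compose2[OF assms(1)]) (auto intro!: continuous_intros)
  then have "set_integrable lborel {0..R} (\<lambda>r. f (P - of_real r))"
    by (rule borel_integrable_atLeastAtMost')
  then show ?thesis using set_borel_integral_eq_integral(2) hi by (metis integral_unique)
qed

lemma ray_integral_tendsto:
  assumes cont: "continuous_on ((\<lambda>r. P - of_real r) ` {0..}) f" and "ray_decay f y1 y2" "y1 \<le> Im P" "Im P \<le> y2"
  shows "((\<lambda>R. contour_integral (linepath (P - of_real R) P) f) \<longlongrightarrow> ray_integral f P) at_top"
proof -
  have int: "set_integrable lborel {0..} (\<lambda>r. f (P - of_real r))" by (rule ray_set_integrable[OF assms])
  have "((\<lambda>R. LBINT r:{0..R}. f (P - of_real r)) \<longlongrightarrow> ray_integral f P) at_top"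
    unfolding ray_integral_def by (rule tendsto_set_lebesgue_integral_at_top) (use int in auto)
  moreover have "eventually (\<lambda>R. (LBINT r:{0..R}. f (P - of_real r)) = contour_integral (linepath (P - of_real R) P) f) at_top"
    using eventually_ge_at_top[of 0]
  proof eventually_elim
    case (elim R)
    have "closed_segment (P - of_real R) P \<subseteq> (\<lambda>r. P - of_real r) ` {0..}"
    proof
      fix w assume "w \<in> closed_segment (P - of_real R) P"
      then obtain u where "0 \<le> u" "u \<le> 1" "w = (1 - u) *\<^sub>R (P - of_real R) + u *\<^sub>R P"
        by (auto simp: in_segment)
      then show "w \<in> (\<lambda>r. P - of_real r) ` {0..}"
        using elim by (intro image_eqI[of _ _ "(1 - u) * R"]) (simp_all add: scaleR_conv_of_real algebra_simps mult_left_le)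
    qed
    then show ?case using elim by (intro ray_segment_integral continuous_on_subset[OF cont]) auto
  qed
  ultimately show ?thesis by (rule Lim_transform_eventually)
qed

text \<open>Cauchy's theorem between two parallel rays: a primitive on the convex set handles the
  truncation at distance R. The connection at the far end has the constant length |P - Q|, while the
  function there is O(R^(-1 - \<delta>)).\<close>

lemma ray_integral_diff:
  assumes f: "f holomorphic_on \<Omega>" "open \<Omega>" "convex \<Omega>"
    and PQ: "\<And>r. r \<ge> 0 \<Longrightarrow> P - of_real r \<in> \<Omega>" "\<And>r. r \<ge> 0 \<Longrightarrow> Q - of_real r \<in> \<Omega>"
    and decay: "ray_decay f (min (Im P) (Im Q)) (max (Im P) (Im Q))"
  shows "ray_integral f P - ray_integral f Q = contour_integral (linepath Q P) f"
proof -
  obtain F where F: "\<And>x. x \<in> \<Omega> \<Longrightarrow> (F has_field_derivative f x) (at x within \<Omega>)"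
    using holomorphic_convex_primitive' f by blast
  have seg: "contour_integral (linepath a b) f = F b - F a" if "a \<in> \<Omega>" "b \<in> \<Omega>" for a b
  proof -
    have "path_image (linepath a b) \<subseteq> \<Omega>" using that f by (simp add: closed_segment_subset)
    from contour_integral_primitive[OF F _ this] show ?thesis by (simp add: contour_integral_unique)
  qed
  have cont: "continuous_on \<Omega> f" using f holomorphic_on_imp_continuous_on by blast
  have "((\<lambda>R. contour_integral (linepath (P - of_real R) P) f) \<longlongrightarrow> ray_integral f P) at_top"
    by (rule ray_integral_tendsto[OF continuous_on_subset[OF cont] decay]) (use PQ in auto)
  moreover have "((\<lambda>R. contour_integral (linepath (Q - of_real R) Q) f) \<longlongrightarrow> ray_integral f Q) at_top"
    by (rule ray_integral_tendsto[OF continuous_on_subset[OF cont] decay]) (use PQ in auto)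
  ultimately have lim: "((\<lambda>R. contour_integral (linepath (P - of_real R) P) f - contour_integral (linepath (Q - of_real R) Q) f)
     \<longlongrightarrow> ray_integral f P - ray_integral f Q) at_top" by (intro tendsto_diff)
  have ev: "eventually (\<lambda>R. contour_integral (linepath (P - of_real R) P) f - contour_integral (linepath (Q - of_real R) Q) f
      = contour_integral (linepath Q P) f - contour_integral (linepath (Q - of_real R) (P - of_real R)) f) at_top"
    using eventually_ge_at_top[of 0]
  proof eventually_elim
    case (elim R)
    have "P \<in> \<Omega>" "Q \<in> \<Omega>" using PQ[of 0] by auto
    then show ?case using PQ[OF elim] by (simp add: seg)
  qed
  have zero: "((\<lambda>R. contour_integral (linepath (Q - of_real R) (P - of_real R)) f) \<longlongrightarrow> 0) at_top"
  proof -
    obtain C \<delta> \<rho> where d: "\<delta> > 0" "\<rho> < 0"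
      and C: "\<And>z. min (Im P) (Im Q) \<le> Im z \<Longrightarrow> Im z \<le> max (Im P) (Im Q) \<Longrightarrow> Re z \<le> \<rho> \<Longrightarrow> norm (f z) \<le> C * (- Re z) powr (- 1 - \<delta>)"
      using decay unfolding ray_decay_def by blast
    define x where "x = max (Re P) (Re Q)"
    have lim0: "((\<lambda>R. \<bar>C\<bar> * (R - x) powr (- 1 - \<delta>) * norm (P - Q)) \<longlongrightarrow> \<bar>C\<bar> * 0 * norm (P - Q)) at_top"
    proof (intro tendsto_intros)
      have "filterlim (\<lambda>R. R - x) at_top at_top"
        using filterlim_tendsto_add_at_top[OF tendsto_const[of "- x"] filterlim_ident] by (simp add: add.commute)
      then show "((\<lambda>R. (R - x) powr (- 1 - \<delta>)) \<longlongrightarrow> 0) at_top"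
        using d by (intro tendsto_neg_powr) auto
    qed
    have ev0: "eventually (\<lambda>R. norm (contour_integral (linepath (Q - of_real R) (P - of_real R)) f)
       \<le> \<bar>C\<bar> * (R - x) powr (- 1 - \<delta>) * norm (P - Q)) at_top"
      using eventually_ge_at_top[of 0] eventually_ge_at_top[of "x - \<rho>"]
    proof eventually_elim
      case (elim R)
      have "norm (contour_integral (linepath (Q - of_real R) (P - of_real R)) f)
         \<le> \<bar>C\<bar> * (R - x) powr (- 1 - \<delta>) * norm (P - of_real R - (Q - of_real R))"
      proof (rule contour_integral_bound_linepath)
        have "closed_segment (Q - of_real R) (P - of_real R) \<subseteq> \<Omega>"
          using PQ[OF elim(1)] f(3) by (simp add: closed_segment_subset)
        then show "f contour_integrable_on linepath (Q - of_real R) (P - of_real R)"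
          using continuous_on_subset[OF cont] by (intro contour_integrable_continuous_linepath) auto
        fix z assume z: "z \<in> closed_segment (Q - of_real R) (P - of_real R)"
        have zz: "Re z \<le> x - R" "min (Im P) (Im Q) \<le> Im z" "Im z \<le> max (Im P) (Im Q)"
          using closed_segment_Re_Im[OF z] by (auto simp: x_def min_def max_def split: if_splits)
        then have "norm (f z) \<le> C * (- Re z) powr (- 1 - \<delta>)" using elim by (intro C) auto
        also have "\<dots> \<le> \<bar>C\<bar> * (R - x) powr (- 1 - \<delta>)"
          using zz elim d by (intro mult_mono powr_mono2') auto
        finally show "norm (f z) \<le> \<bar>C\<bar> * (R - x) powr (- 1 - \<delta>)" .
      qed auto
      then show ?case by simp
    qed
    from lim0 have "((\<lambda>R. \<bar>C\<bar> * (R - x) powr (- 1 - \<delta>) * norm (P - Q)) \<longlongrightarrow> 0) at_top" by simp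
    then show ?thesis by (rule Lim_null_comparison[OF ev0])
  qed
  have "((\<lambda>R. contour_integral (linepath Q P) f - contour_integral (linepath (Q - of_real R) (P - of_real R)) f)
     \<longlongrightarrow> contour_integral (linepath Q P) f - 0) at_top" using zero by (intro tendsto_intros)
  from tendsto_unique[OF trivial_limit_at_top_linorder Lim_transform_eventually[OF lim ev] this]
  show ?thesis by simp
qed

text \<open>The four sides are kept apart because each of them is later replaced by the increment of
  a logarithm branch or matched with a side of another contour.\<close>

lemma winding_rectangle:
  fixes z :: complex
  assumes "\<bar>Im z\<bar> < M" "x < Re z" "Re z \<noteq> c" "x < c"
  shows "winding_number (linepath (Complex x (- M)) (Complex c (- M))) z
    + winding_number (linepath (Complex c (- M)) (Complex c M)) z
    + winding_number (linepath (Complex c M) (Complex x M)) z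
    + winding_number (linepath (Complex x M) (Complex x (- M))) z = (if Re z < c then 1 else 0)"
proof -
  let ?a = "Complex x (- M)" and ?b = "Complex c M"
  have off: "z \<notin> closed_segment (Complex x (- M)) (Complex c (- M))" "z \<notin> closed_segment (Complex c (- M)) (Complex c M)"
    "z \<notin> closed_segment (Complex c M) (Complex x M)" "z \<notin> closed_segment (Complex x M) (Complex x (- M))"
    using assms closed_segment_Re_Im[of z] by fastforce+
  have "winding_number (rectpath ?a ?b) z = winding_number (linepath (Complex x (- M)) (Complex c (- M))) z
    + winding_number (linepath (Complex c (- M)) (Complex c M)) z
    + winding_number (linepath (Complex c M) (Complex x M)) z
    + winding_number (linepath (Complex x M) (Complex x (- M))) z"
    using off by (simp add: rectpath_def Let_def winding_number_join path_image_join)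
  moreover have "winding_number (rectpath ?a ?b) z = (if Re z < c then 1 else 0)"
  proof (cases "Re z < c")
    case True
    then have "z \<in> box ?a ?b" using assms by (auto simp: in_box_complex_iff)
    then show ?thesis using winding_number_rectpath True by simp
  next
    case False
    then have "z \<notin> cbox ?a ?b" using assms by (auto simp: in_cbox_complex_iff)
    then show ?thesis using winding_number_rectpath_outside[of ?a ?b z] assms False by simp
  qed
  ultimately show ?thesis by simp
qed

text \<open>
  \<open>L\<close> is the set of poles to be enclosed, \<open>Rt\<close> the finite set of the remaining ones, and the reference loop
  consists of the line from \<open>c - iM\<close> to \<open>c + iM\<close> and two rays.
\<close>

locale poles =
  fixes L Rt :: "complex set" and f :: "complex \<Rightarrow> complex" and c M :: real
  assumes L_ne: "L \<noteq> {}" and L_shift: "z \<in> L \<Longrightarrow> z - 1 \<in> L"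
    and L_finite: "finite {z\<in>L. x \<le> Re z}" and Im_L_finite: "finite (Im ` L)"
    and L_Re: "z \<in> L \<Longrightarrow> Re z < c" and L_Im: "z \<in> L \<Longrightarrow> \<bar>Im z\<bar> < M"
    and Rt_finite: "finite Rt" and Rt_Re: "z \<in> Rt \<Longrightarrow> Re z \<noteq> c" and Rt_Im: "z \<in> Rt \<Longrightarrow> \<bar>Im z\<bar> < M"
    and disjoint: "L \<inter> Rt = {}" and holo: "f holomorphic_on - (L \<union> Rt)"
    and decay: "(\<And>z. z \<in> L \<Longrightarrow> Im z < y1 \<or> y2 < Im z) \<Longrightarrow> ray_decay f y1 y2"
begin

lemma L_shift_nat: "z \<in> L \<Longrightarrow> z - of_nat n \<in> L"
proof (induction n)
  case (Suc n)
  then show ?case using L_shift[of "z - of_nat n"] by (simp add: algebra_simps)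
qed simp

end

text \<open>\<open>w\<close> prescribes the winding numbers about the remaining poles: 0 for a
  separating loop, 1 for the blown-up loop, which surrounds all of them.\<close>

locale separated_loop = poles +
  fixes g :: "real \<Rightarrow> complex" and w :: "complex \<Rightarrow> complex"
  assumes g: "left_loop g" and left: "z \<in> L \<Longrightarrow> on_left_of_loop g z"
    and right: "z \<in> Rt \<Longrightarrow> \<forall>\<^sub>F R in at_top. z \<notin> path_image (truncated_loop g R) \<and> winding_number (truncated_loop g R) z = w z"
begin

abbreviation "A \<equiv> pathstart g"
abbreviation "B \<equiv> pathfinish g"

lemma pole_height: "z \<in> L \<Longrightarrow> Im A < Im z \<and> Im z < Im B"
  using left_loop_pole_height[OF g, of z] left L_shift_nat by blast

lemma path_g: "path g" "valid_path g" using g by (auto simp: left_loop_def valid_path_imp_path)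

lemma off_g: "z \<in> L \<union> Rt \<Longrightarrow> z \<notin> path_image g"
proof -
  assume "z \<in> L \<union> Rt"
  then have "\<forall>\<^sub>F R in at_top. z \<notin> path_image (truncated_loop g R)"
  proof
    assume "z \<in> L"
    from left[OF this] show ?thesis unfolding on_left_of_loop_def by (auto elim: eventually_mono)
  next
    assume "z \<in> Rt"
    from right[OF this] show ?thesis by (auto elim: eventually_mono)
  qed
  then obtain R where "z \<notin> path_image (truncated_loop g R)"
    using eventually_happens'[OF trivial_limit_at_top_linorder] by blast
  then show ?thesis by (simp add: path_image_truncated_loop[OF g])
qed

context
  fixes R0 :: real
  assumes R0: "R0 \<ge> 0" "Re A - R0 < c" "Re B - R0 < c"
    and R0_Rt: "z \<in> Rt \<Longrightarrow> Re A - R0 + 1 < Re z \<and> Re B - R0 + 1 < Re z"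
    and R0_right: "z \<in> Rt \<Longrightarrow> z \<notin> path_image (truncated_loop g R0) \<and> winding_number (truncated_loop g R0) z = w z"
begin

abbreviation "A0 \<equiv> A - of_real R0"
abbreviation "B0 \<equiv> B - of_real R0"
abbreviation "A1 \<equiv> Complex (Re A - R0) (- M)"
abbreviation "B1 \<equiv> Complex (Re B - R0) M"
abbreviation "C1 \<equiv> Complex c M"
abbreviation "C2 \<equiv> Complex c (- M)"

text \<open>
  The loop and the reference loop, cut at distance \<open>R0\<close>, differ by the closed path \<open>D\<close> and two half-strips
  free of poles.
\<close>

definition "D = linepath A0 A +++ g +++ linepath B B0 +++ linepath B0 B1 +++ linepath B1 C1
   +++ linepath C1 C2 +++ linepath C2 A1 +++ linepath A1 A0"

lemma D_path: "valid_path D" "pathfinish D = pathstart D"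
  unfolding D_def using path_g by (auto simp del: of_real_eq_0_iff)

lemma D_image: "path_image D = closed_segment A0 A \<union> path_image g \<union> closed_segment B B0 \<union> closed_segment B0 B1
   \<union> closed_segment B1 C1 \<union> closed_segment C1 C2 \<union> closed_segment C2 A1 \<union> closed_segment A1 A0"
  unfolding D_def using path_g by (auto simp: path_image_join)

lemma D_off:
  assumes "z \<in> L \<union> Rt" shows "z \<notin> path_image D"
proof -
  have "z \<notin> closed_segment A0 A \<and> z \<notin> closed_segment B B0 \<and>
    z \<notin> closed_segment B0 B1 \<and> z \<notin> closed_segment A1 A0"
  proof (cases "z \<in> L")
    case True
    then show ?thesis
      using pole_height[OF True] L_Im[OF True] closed_segment_Re_Im(3,4)[of z] by fastforce
  next
    case False
    then have z: "z \<in> Rt" using assms by auto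
    have "z \<notin> closed_segment B0 B1" "z \<notin> closed_segment A1 A0"
      using R0_Rt[OF z] closed_segment_Re_Im(1,2)[of z] by fastforce+
    then show ?thesis
      using R0_right[OF z] by (auto simp: path_image_truncated_loop[OF g])
  qed
  moreover have "z \<notin> closed_segment B1 C1" "z \<notin> closed_segment C1 C2" "z \<notin> closed_segment C2 A1"
    using assms L_Im[of z] Rt_Im[of z] L_Re[of z] Rt_Re[of z] closed_segment_Re_Im[of z] by fastforce+
  ultimately show ?thesis unfolding D_image using off_g[OF assms] by blast
qed

lemma D_winding_sum:
  assumes "z \<notin> path_image D"
  shows "winding_number D z = winding_number (linepath A0 A) z + winding_number g z + winding_number (linepath B B0) z
    + winding_number (linepath B0 B1) z + winding_number (linepath B1 C1) z + winding_number (linepath C1 C2) z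
    + winding_number (linepath C2 A1) z + winding_number (linepath A1 A0) z"
  using assms path_g unfolding D_image unfolding D_def
  by (simp add: winding_number_join path_image_join)

text \<open>\<open>D\<close> is a truncated loop run forwards and a rectangle run backwards, and
  each winds once around \<open>z\<close>. Their left ends need not match, but \<open>z\<close> lies
  strictly between the rays of both, so the mismatch consists of increments of the branches below,
  above and to the left.\<close>

lemma D_winding_left:
  assumes z: "z \<in> L" shows "winding_number D z = 0"
proof -
  have h: "Im A < Im z" "Im z < Im B" "Re z < c" "- M < Im z" "Im z < M"
    using pole_height[OF z] L_Re[OF z] L_Im[OF z] by auto
  have "\<forall>\<^sub>F R in at_top. (z \<notin> path_image (truncated_loop g R) \<and> winding_number (truncated_loop g R) z = 1) \<and>
     R \<ge> R0 \<and> R > Re A - Re z \<and> R > Re B - Re z"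
    by (rule eventually_conj[OF left[OF z, unfolded on_left_of_loop_def]])
      (intro eventually_conj eventually_ge_at_top; use eventually_gt_at_top in auto)
  then obtain R where R: "z \<notin> path_image (truncated_loop g R)" "winding_number (truncated_loop g R) z = 1"
    "R \<ge> R0" "Re A - R < Re z" "Re B - R < Re z"
    using eventually_happens'[OF trivial_limit_at_top_linorder] by (smt (verit))
  define x where "x = min (Re z) c - 1"
  obtain l1 l2 l3 where l1: "\<And>a b. Im a < Im z \<Longrightarrow> Im b < Im z \<Longrightarrow> winding_number (linepath a b) z = l1 b - l1 a"
    and l2: "\<And>a b. Im z < Im a \<Longrightarrow> Im z < Im b \<Longrightarrow> winding_number (linepath a b) z = l2 b - l2 a"
    and l3: "\<And>a b. Re a < Re z \<Longrightarrow> Re b < Re z \<Longrightarrow> winding_number (linepath a b) z = l3 b - l3 a"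
    by (rule winding_number_linepath_halfplanes) blast
  let ?AR = "A - of_real R" and ?BR = "B - of_real R" and ?q1 = "Complex x (- M)" and ?q4 = "Complex x M"
  have T: "l1 A - l1 ?AR + winding_number g z + (l2 ?BR - l2 B) + (l3 ?AR - l3 ?BR) = 1"
    using R(2) winding_number_truncated_loop[OF g R(1)] h R by (simp add: l1 l2 l3)
  have Dd: "winding_number D z = (l1 A - l1 A0) + winding_number g z + (l2 B0 - l2 B) + (l2 B1 - l2 B0) + (l2 C1 - l2 B1)
    + winding_number (linepath C1 C2) z + (l1 A1 - l1 C2) + (l1 A0 - l1 A1)"
    using D_winding_sum[OF D_off, of z] z h by (simp add: l1 l2)
  have rev: "winding_number (linepath C1 C2) z = - winding_number (linepath C2 C1) z"
    using winding_number_reversepath[of "linepath C2 C1" z] h closed_segment_Re_Im[of z C2 C1] by fastforce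
  have Q: "(l1 C2 - l1 ?q1) + winding_number (linepath C2 C1) z + (l2 ?q4 - l2 C1) + (l3 ?q1 - l3 ?q4) = 1"
    using winding_rectangle[of z M x c] h by (simp add: x_def l1 l2 l3)
  \<comment> \<open>The lower and the left branch differ by a constant on the quadrant below and to
    the left of \<open>z\<close>, which contains both corners.\<close>
  have k1: "l1 ?AR - l1 ?q1 = l3 ?AR - l3 ?q1"
    using l1[of ?q1 ?AR] l3[of ?q1 ?AR] h R by (simp add: x_def)
  have k2: "l2 ?BR - l2 ?q4 = l3 ?BR - l3 ?q4"
    using l2[of ?q4 ?BR] l3[of ?q4 ?BR] h R by (simp add: x_def)
  show ?thesis unfolding Dd rev using T Q k1 k2 by algebra
qed

text \<open>Here \<open>z\<close> may lie above or below the rays of the loop, so the segments along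
  them are not expressed by a branch; they occur both in \<open>D\<close> and in the loop truncated
  at \<open>R0\<close> and cancel. The cut lies left of \<open>z\<close>, hence the connections at
  the cut use the left branch.\<close>

lemma D_winding_right:
  assumes z: "z \<in> Rt" shows "winding_number D z = w z - (if Re z < c then 1 else 0)"
proof -
  have h: "- M < Im z" "Im z < M" "Re z \<noteq> c" using Rt_Re[OF z] Rt_Im[OF z] by auto
  have RR: "Re A - R0 < Re z" "Re B - R0 < Re z" using R0_Rt[OF z] by auto
  note R = R0_right[OF z]
  define x where "x = min (Re z) c - 1"
  obtain l1 l2 l3 where l1: "\<And>a b. Im a < Im z \<Longrightarrow> Im b < Im z \<Longrightarrow> winding_number (linepath a b) z = l1 b - l1 a"
    and l2: "\<And>a b. Im z < Im a \<Longrightarrow> Im z < Im b \<Longrightarrow> winding_number (linepath a b) z = l2 b - l2 a"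
    and l3: "\<And>a b. Re a < Re z \<Longrightarrow> Re b < Re z \<Longrightarrow> winding_number (linepath a b) z = l3 b - l3 a"
    by (rule winding_number_linepath_halfplanes) blast
  let ?q1 = "Complex x (- M)" and ?q4 = "Complex x M"
  have T: "winding_number (linepath A0 A) z + winding_number g z + winding_number (linepath B B0) z + (l3 A0 - l3 B0) = w z"
    using winding_number_truncated_loop[OF g, of z R0] R RR by (simp add: l3)
  have Dd: "winding_number D z = winding_number (linepath A0 A) z + winding_number g z + winding_number (linepath B B0) z
    + (l3 B1 - l3 B0) + (l2 C1 - l2 B1)
    + winding_number (linepath C1 C2) z + (l1 A1 - l1 C2) + (l3 A0 - l3 A1)"
    using D_winding_sum[OF D_off, of z] z h RR by (simp add: l1 l2 l3)
  have rev: "winding_number (linepath C1 C2) z = - winding_number (linepath C2 C1) z"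
    using winding_number_reversepath[of "linepath C2 C1" z] h closed_segment_Re_Im[of z C2 C1] by fastforce
  have Q: "(l1 C2 - l1 ?q1) + winding_number (linepath C2 C1) z + (l2 ?q4 - l2 C1) + (l3 ?q1 - l3 ?q4) = (if Re z < c then 1 else 0)"
    using winding_rectangle[of z M x c] h by (simp add: x_def l1 l2 l3)
  have k1: "l1 A1 - l1 ?q1 = l3 A1 - l3 ?q1"
    using l1[of ?q1 A1] l3[of ?q1 A1] h RR by (simp add: x_def)
  have k2: "l2 B1 - l2 ?q4 = l3 B1 - l3 ?q4"
    using l2[of ?q4 B1] l3[of ?q4 B1] h RR by (simp add: x_def)
  have e: "winding_number g z = w z - winding_number (linepath A0 A) z - winding_number (linepath B B0) z - (l3 A0 - l3 B0)"
    "l1 A1 = l3 A1 - l3 ?q1 + l1 ?q1" "l2 B1 = l3 B1 - l3 ?q4 + l2 ?q4"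
    using T k1 k2 by (auto simp: algebra_simps)
  show ?thesis unfolding Dd rev Q[symmetric] e by (simp add: algebra_simps)
qed

lemma open_no_poles: "open (- (L \<union> Rt))"
  by (intro open_Compl closed_Un closed_if_finite_right L_finite finite_imp_closed Rt_finite)

lemma integrable_off_poles:
  "valid_path p \<Longrightarrow> path_image p \<subseteq> - (L \<union> Rt) \<Longrightarrow> f contour_integrable_on p"
  by (rule contour_integrable_holomorphic_simple[OF holo open_no_poles])

lemma D_subset: "path_image D \<subseteq> - (L \<union> Rt)"
  using D_off by blast

lemma D_integral_sum:
  "contour_integral D f = contour_integral (linepath A0 A) f + contour_integral g f + contour_integral (linepath B B0) f
    + contour_integral (linepath B0 B1) f + contour_integral (linepath B1 C1) f + contour_integral (linepath C1 C2) f
    + contour_integral (linepath C2 A1) f + contour_integral (linepath A1 A0) f"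
proof -
  have "f contour_integrable_on linepath A0 A" "f contour_integrable_on g" "f contour_integrable_on linepath B B0"
    "f contour_integrable_on linepath B0 B1" "f contour_integrable_on linepath B1 C1" "f contour_integrable_on linepath C1 C2"
    "f contour_integrable_on linepath C2 A1" "f contour_integrable_on linepath A1 A0"
    using D_subset path_g unfolding D_image by (auto intro!: integrable_off_poles)
  then show ?thesis unfolding D_def using path_g by simp
qed

text \<open>The residue theorem needs finitely many poles, whereas \<open>L\<close> is infinite. A
  half-plane containing \<open>D\<close> and \<open>Rt\<close> cuts \<open>L\<close> down to a
  finite set, and \<open>D\<close> has winding number 0 about its points.\<close>

lemma D_residues:
  "contour_integral D f = 2 * pi * \<i> * (\<Sum>p\<in>Rt. (w p - (if Re p < c then 1 else 0)) * residue f p)"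
proof -
  have "bounded (path_image D)" using D_path by (simp add: bounded_path_image valid_path_imp_path)
  then obtain K where K: "\<And>p. p \<in> path_image D \<Longrightarrow> norm p \<le> K" unfolding bounded_iff by auto
  obtain x where x: "x < - K" "\<And>p. p \<in> Rt \<Longrightarrow> x < Re p"
  proof -
    define x where "x = Min (insert (- K) (Re ` Rt)) - 1"
    have m: "Min (insert (- K) (Re ` Rt)) \<le> y" if "y \<in> insert (- K) (Re ` Rt)" for y
      using that Rt_finite by (intro Min_le) auto
    show ?thesis
    proof (rule that[of x])
      show "x < - K" using m[of "- K"] by (simp add: x_def)
      show "x < Re p" if "p \<in> Rt" for p using m[of "Re p"] that by (simp add: x_def)
    qed
  qed
  define S where "S = {p. x < Re p}"
  define Lx where "Lx = {p\<in>L. x \<le> Re p}"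
  have fin: "finite Lx" unfolding Lx_def by (rule L_finite)
  have sub: "path_image D \<subseteq> S"
  proof
    fix p assume "p \<in> path_image D"
    then show "p \<in> S" using K[of p] abs_Re_le_cmod[of p] x by (simp add: S_def)
  qed
  have conv: "convex S" unfolding S_def by (rule convex_halfplanes)
  have "contour_integral D f = 2 * pi * \<i> * (\<Sum>p\<in>Lx \<union> Rt. winding_number D p * residue f p)"
  proof (rule Residue_theorem[of S])
    show "open S" unfolding S_def by (rule open_halfspace_Re_gt)
    show "connected S" using conv by (rule convex_connected)
    show "finite (Lx \<union> Rt)" using fin Rt_finite by simp
    show "f holomorphic_on S - (Lx \<union> Rt)"
      by (rule holomorphic_on_subset[OF holo]) (auto simp: S_def Lx_def)
    show "path_image D \<subseteq> S - (Lx \<union> Rt)" using sub D_subset by (auto simp: Lx_def)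
    show "\<forall>z. z \<notin> S \<longrightarrow> winding_number D z = 0"
      using winding_number_zero_outside[OF _ conv _ _ sub] D_path by (auto simp: valid_path_imp_path)
  qed (use D_path in auto)
  also have "(\<Sum>p\<in>Lx \<union> Rt. winding_number D p * residue f p) = (\<Sum>p\<in>Rt. winding_number D p * residue f p)"
    using fin Rt_finite by (intro sum.mono_neutral_right) (auto simp: Lx_def D_winding_left)
  also have "\<dots> = (\<Sum>p\<in>Rt. (w p - (if Re p < c then 1 else 0)) * residue f p)"
    by (intro sum.cong) (auto simp: D_winding_right)
  finally show ?thesis .
qed

text \<open>The poles of \<open>L\<close> have finitely many heights, so a gap remains between the
  lowest one and the incoming rays of both loops.\<close>

lemma min_height: obtains y where "Im A < y" "- M < y" "\<And>z. z \<in> L \<Longrightarrow> y \<le> Im z"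
proof (rule that[of "Min (Im ` L)"])
  show "Im A < Min (Im ` L)" "- M < Min (Im ` L)"
    using Im_L_finite L_ne pole_height L_Im by (subst Min_gr_iff; force)+
  show "Min (Im ` L) \<le> Im z" if "z \<in> L" for z
    using Im_L_finite that by (intro Min_le) auto
qed

lemma max_height: obtains y where "y < Im B" "y < M" "\<And>z. z \<in> L \<Longrightarrow> Im z \<le> y"
proof (rule that[of "Max (Im ` L)"])
  show "Max (Im ` L) < Im B" "Max (Im ` L) < M"
    using Im_L_finite L_ne pole_height L_Im by (subst Max_less_iff; force)+
  show "Im z \<le> Max (Im ` L)" if "z \<in> L" for z
    using Im_L_finite that by (intro Max_ge) auto
qed

text \<open>The set \<Omega> lies below all left poles and, by the margin 1 in \<open>R0_Rt\<close>,
  to the left of the remaining ones while still containing both rays. The strip between the heights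
  of \<open>A0\<close> and \<open>A1\<close> has no left pole, so the decay assumption
  applies.\<close>

lemma ray_A_diff: "ray_integral f A0 - ray_integral f A1 = contour_integral (linepath A1 A0) f"
proof -
  obtain y where y: "Im A < y" "- M < y" "\<And>z. z \<in> L \<Longrightarrow> y \<le> Im z" by (rule min_height) blast
  let ?\<Omega> = "{z. Im z < y} \<inter> {z. Re z < Re A - R0 + 1}"
  show ?thesis
  proof (rule ray_integral_diff)
    show "f holomorphic_on ?\<Omega>"
      using y(3) R0_Rt by (intro holomorphic_on_subset[OF holo]) (force simp: not_less)
    show "open ?\<Omega>" by (intro open_Int open_halfspace_Im_lt open_halfspace_Re_lt)
    show "convex ?\<Omega>" by (intro convex_Int convex_halfplanes)
    show "ray_decay f (min (Im A0) (Im A1)) (max (Im A0) (Im A1))"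
      by (rule decay) (use y in fastforce)
  qed (use y in auto)
qed

lemma ray_B_diff: "ray_integral f B0 - ray_integral f B1 = contour_integral (linepath B1 B0) f"
proof -
  obtain y where y: "y < Im B" "y < M" "\<And>z. z \<in> L \<Longrightarrow> Im z \<le> y" by (rule max_height) blast
  let ?\<Omega> = "{z. y < Im z} \<inter> {z. Re z < Re B - R0 + 1}"
  show ?thesis
  proof (rule ray_integral_diff)
    show "f holomorphic_on ?\<Omega>"
      using y(3) R0_Rt by (intro holomorphic_on_subset[OF holo]) (force simp: not_less)
    show "open ?\<Omega>" by (intro open_Int open_halfspace_Im_gt open_halfspace_Re_lt)
    show "convex ?\<Omega>" by (intro convex_Int convex_halfplanes)
    show "ray_decay f (min (Im B0) (Im B1)) (max (Im B0) (Im B1))"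
      by (rule decay) (use y in fastforce)
  qed (use y in auto)
qed

text \<open>Left of the cut the assumptions on heights exclude poles, and right of it the assumption
  on the segment does, so the whole ray is free of them. The splitting is then a limit of splittings
  of segments.\<close>

lemma ray_extend:
  assumes R: "R \<ge> 0" and seg: "closed_segment (P - of_real R) P \<subseteq> - (L \<union> Rt)"
    and h: "\<And>z. z \<in> L \<Longrightarrow> Im z \<noteq> Im P" "\<And>z. z \<in> Rt \<Longrightarrow> Im z \<noteq> Im P \<or> Re P - R < Re z"
  shows "ray_integral f P = ray_integral f (P - of_real R) + contour_integral (linepath (P - of_real R) P) f"
proof -
  have cont: "continuous_on (- (L \<union> Rt)) f" by (rule holomorphic_on_imp_continuous_on[OF holo])
  have sub2: "P - of_real R - of_real r \<notin> L \<union> Rt" if "r \<ge> 0" for r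
    using h(1)[of "P - of_real R - of_real r"] h(2)[of "P - of_real R - of_real r"] that by auto
  have sub: "P - of_real r \<notin> L \<union> Rt" if r: "r \<ge> 0" for r
  proof (cases "r \<le> R")
    case False
    then show ?thesis using sub2[of "r - R"] by simp
  next
    case True
    show ?thesis
    proof (cases "R = 0")
      case False
      have "P - of_real r \<in> closed_segment (P - of_real R) P"
        unfolding in_segment using True r False R
        by (intro exI[of _ "1 - r / R"]) (auto simp: scaleR_conv_of_real field_simps)
      then show ?thesis using seg by auto
    qed (use seg r True in auto)
  qed
  have dec: "ray_decay f (Im P) (Im P)"
    using h(1) by (intro decay) (metis linorder_neqE_linordered_idom)
  have "((\<lambda>r. contour_integral (linepath (P - of_real r) P) f) \<longlongrightarrow> ray_integral f P) at_top"
    by (rule ray_integral_tendsto[OF continuous_on_subset[OF cont] dec]) (use sub in auto)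
  moreover have "\<forall>\<^sub>F r in at_top. contour_integral (linepath (P - of_real r) P) f
     = contour_integral (linepath (P - of_real R - of_real (r - R)) (P - of_real R)) f + contour_integral (linepath (P - of_real R) P) f"
    using eventually_gt_at_top[of R]
  proof eventually_elim
    case (elim r)
    have r0: "r > 0" using elim R by simp
    have "P - of_real R \<in> closed_segment (P - of_real r) P"
      unfolding in_segment using elim R r0
      by (intro exI[of _ "1 - R / r"]) (auto simp: scaleR_conv_of_real field_simps)
    moreover have "closed_segment (P - of_real r) P \<subseteq> (\<lambda>r. P - of_real r) ` {0..}"
    proof
      fix w assume "w \<in> closed_segment (P - of_real r) P"
      then obtain u where "0 \<le> u" "u \<le> 1" "w = (1 - u) *\<^sub>R (P - of_real r) + u *\<^sub>R P"
        by (auto simp: in_segment)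
      then show "w \<in> (\<lambda>r. P - of_real r) ` {0..}"
        using r0 by (intro image_eqI[of _ _ "(1 - u) * r"]) (simp_all add: scaleR_conv_of_real algebra_simps mult_left_le)
    qed
    then have "continuous_on (closed_segment (P - of_real r) P) f"
      using sub by (intro continuous_on_subset[OF cont]) auto
    ultimately show ?case using contour_integral_split_linepath[of "P - of_real r" P f "P - of_real R"] by simp
  qed
  ultimately have 1: "((\<lambda>r. contour_integral (linepath (P - of_real R - of_real (r - R)) (P - of_real R)) f + contour_integral (linepath (P - of_real R) P) f)
     \<longlongrightarrow> ray_integral f P) at_top" by (rule Lim_transform_eventually)
  have "((\<lambda>r. contour_integral (linepath (P - of_real R - of_real r) (P - of_real R)) f) \<longlongrightarrow> ray_integral f (P - of_real R)) at_top"
    by (rule ray_integral_tendsto[OF continuous_on_subset[OF cont] dec]) (use sub2 in auto)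
  moreover have "filterlim (\<lambda>r::real. r - R) at_top at_top"
    using filterlim_tendsto_add_at_top[OF tendsto_const[of "- R"] filterlim_ident] by (simp add: add.commute)
  ultimately have "((\<lambda>r. contour_integral (linepath (P - of_real R - of_real (r - R)) (P - of_real R)) f) \<longlongrightarrow> ray_integral f (P - of_real R)) at_top"
    by (rule filterlim_compose)
  then have 2: "((\<lambda>r. contour_integral (linepath (P - of_real R - of_real (r - R)) (P - of_real R)) f + contour_integral (linepath (P - of_real R) P) f)
     \<longlongrightarrow> ray_integral f (P - of_real R) + contour_integral (linepath (P - of_real R) P) f) at_top"
    by (intro tendsto_intros)
  show ?thesis using tendsto_unique[OF trivial_limit_at_top_linorder 1 2] .
qed

lemma loop_integral_eq: "loop_integral h f = ray_integral f (pathstart h) + contour_integral h f - ray_integral f (pathfinish h)"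
  by (simp add: loop_integral_def ray_integral_def)

text \<open>Once the loops are cut at the same abscissas, the outer rays ending at \<open>A0\<close>
  and \<open>A1\<close> differ by the vertical connection, and likewise for \<open>B0\<close> and
  \<open>B1\<close>; these connections are sides of \<open>D\<close>.\<close>

lemma loop_integral_diff_D:
  "loop_integral g f - loop_integral (linepath C2 C1) f = contour_integral D f"
proof -
  have A: "ray_integral f A = ray_integral f A0 + contour_integral (linepath A0 A) f"
    using R0 D_subset pole_height R0_Rt unfolding D_image by (intro ray_extend) force+
  have B: "ray_integral f B = ray_integral f B0 + contour_integral (linepath B0 B) f"
    using R0 D_subset pole_height R0_Rt unfolding D_image by (intro ray_extend) (force simp: closed_segment_commute)+
  have C2: "ray_integral f C2 = ray_integral f A1 + contour_integral (linepath A1 C2) f"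
  proof -
    have e: "C2 - of_real (c - (Re A - R0)) = A1" by (simp add: complex_eq_iff)
    have "ray_integral f C2 = ray_integral f (C2 - of_real (c - (Re A - R0))) + contour_integral (linepath (C2 - of_real (c - (Re A - R0))) C2) f"
      by (rule ray_extend, unfold e) (use R0 D_subset L_Im Rt_Im in \<open>force simp: D_image closed_segment_commute\<close>)+
    then show ?thesis unfolding e .
  qed
  have C1: "ray_integral f C1 = ray_integral f B1 + contour_integral (linepath B1 C1) f"
  proof -
    have e: "C1 - of_real (c - (Re B - R0)) = B1" by (simp add: complex_eq_iff)
    have "ray_integral f C1 = ray_integral f (C1 - of_real (c - (Re B - R0))) + contour_integral (linepath (C1 - of_real (c - (Re B - R0))) C1) f"
      by (rule ray_extend, unfold e) (use R0 D_subset L_Im Rt_Im in \<open>force simp: D_image closed_segment_commute\<close>)+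
    then show ?thesis unfolding e .
  qed
  have rev: "contour_integral (linepath b a) f = - contour_integral (linepath a b) f"
    if "closed_segment a b \<subseteq> path_image D" for a b
  proof -
    have "continuous_on (closed_segment a b) f"
      using that D_subset holomorphic_on_imp_continuous_on[OF holo] by (meson continuous_on_subset)
    then show ?thesis by (metis contour_integral_reverse_linepath add.inverse_inverse)
  qed
  have revs: "contour_integral (linepath A1 C2) f = - contour_integral (linepath C2 A1) f"
    "contour_integral (linepath C2 C1) f = - contour_integral (linepath C1 C2) f"
    "contour_integral (linepath B1 B0) f = - contour_integral (linepath B0 B1) f"
    "contour_integral (linepath B0 B) f = - contour_integral (linepath B B0) f"
    by (rule rev; force simp: D_image)+
  show ?thesis
  proof -
    have a: "ray_integral f A0 = ray_integral f A1 + contour_integral (linepath A1 A0) f"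
      and b: "ray_integral f B0 = ray_integral f B1 - contour_integral (linepath B0 B1) f"
      using ray_A_diff ray_B_diff revs(3) by (simp_all add: algebra_simps)
    show ?thesis unfolding D_integral_sum loop_integral_eq pathstart_linepath pathfinish_linepath A B C1 C2 a b revs
      by (simp add: algebra_simps)
  qed
qed

end

text \<open>A residue theorem for unbounded loops: the subtracted 1 or 0 is the winding number of
  the reference loop about \<open>p\<close>. A common cut distance exists because only the finitely
  many points of \<open>Rt\<close> impose conditions on it.\<close>

theorem loop_integral_diff:
  "loop_integral g f - loop_integral (linepath (Complex c (- M)) (Complex c M)) f
     = 2 * pi * \<i> * (\<Sum>p\<in>Rt. (w p - (if Re p < c then 1 else 0)) * residue f p)"
proof -
  have "\<forall>\<^sub>F R in at_top. R \<ge> 0 \<and> R > Re A - c \<and> R > Re B - c \<and>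
     (\<forall>z\<in>Rt. R > Re A + 1 - Re z \<and> R > Re B + 1 - Re z \<and>
      z \<notin> path_image (truncated_loop g R) \<and> winding_number (truncated_loop g R) z = w z)"
    using Rt_finite right
    by (intro eventually_conj eventually_ball_finite ballI eventually_ge_at_top eventually_gt_at_top)
       (auto simp: eventually_conj_iff)
  then obtain R where R: "R \<ge> 0" "R > Re A - c" "R > Re B - c"
     "\<And>z. z\<in>Rt \<Longrightarrow> R > Re A + 1 - Re z \<and> R > Re B + 1 - Re z \<and>
      z \<notin> path_image (truncated_loop g R) \<and> winding_number (truncated_loop g R) z = w z"
    using eventually_happens'[OF trivial_limit_at_top_linorder] by blast
  have a: "0 \<le> R" "Re A - R < c" "Re B - R < c" using R by auto
  have b: "Re A - R + 1 < Re z \<and> Re B - R + 1 < Re z" if "z \<in> Rt" for z using R(4)[OF that] by auto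
  have d: "z \<notin> path_image (truncated_loop g R) \<and> winding_number (truncated_loop g R) z = w z" if "z \<in> Rt" for z
    using R(4)[OF that] by auto
  show ?thesis using loop_integral_diff_D[OF a b d] D_residues[OF a b d] by simp
qed

end

section \<open>Separating loops\<close>

text \<open>A product of lassos: for each point of \<open>F\<close>, travel from \<open>x\<close> to
  a small circle, run around it clockwise and return. The two passages of the tail cancel, and no
  other point of \<open>P\<close> is inside the circle.\<close>

lemma closed_path_winding_minus_one:
  fixes P F :: "complex set"
  assumes P: "finite P" "F \<subseteq> P" "P \<subseteq> ball 0 \<rho>" and x: "x \<in> ball 0 \<rho> - P"
  shows "\<exists>\<gamma>. valid_path \<gamma> \<and> pathstart \<gamma> = x \<and> pathfinish \<gamma> = x \<and> path_image \<gamma> \<subseteq> ball 0 \<rho> - P \<and>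
    (\<forall>z\<in>P. winding_number \<gamma> z = (if z \<in> F then - 1 else 0))"
proof -
  have "finite F" using P finite_subset by blast
  then show ?thesis using P(2)
  proof (induction F rule: finite_induct)
    case empty
    have w: "winding_number (linepath x x) z = 0" if "z \<in> P" for z
      using that x by (metis DiffD2 winding_number_trivial)
    show ?case
    proof (intro exI conjI ballI)
      show "path_image (linepath x x) \<subseteq> ball 0 \<rho> - P" using x by simp
      show "winding_number (linepath x x) z = (if z \<in> {} then - 1 else 0)" if "z \<in> P" for z
        unfolding empty_iff if_False using that by (rule w)
    qed (rule valid_path_linepath pathstart_linepath pathfinish_linepath)+
  next
    case (insert p F)
    then obtain \<gamma> where \<gamma>: "valid_path \<gamma>" "pathstart \<gamma> = x" "pathfinish \<gamma> = x" "path_image \<gamma> \<subseteq> ball 0 \<rho> - P"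
      "\<And>z. z\<in>P \<Longrightarrow> winding_number \<gamma> z = (if z \<in> F then - 1 else 0)" by auto
    have "open (ball 0 \<rho> - (P - {p}))" using P(1) by (simp add: open_Diff finite_imp_closed)
    moreover have "p \<in> ball 0 \<rho> - (P - {p})" using insert.prems P by auto
    ultimately obtain e where e: "e > 0" "cball p e \<subseteq> ball 0 \<rho> - (P - {p})"
      by (meson open_contains_cball)
    define circ where "circ = circlepath p e"
    have circ: "path_image circ \<subseteq> ball 0 \<rho> - P" "valid_path circ" "pathstart circ = p + of_real e" "pathfinish circ = p + of_real e"
    proof -
      have "path_image circ = sphere p e" using e by (simp add: circ_def)
      moreover have "sphere p e \<subseteq> cball p e" "p \<notin> sphere p e" using e by auto
      ultimately show "path_image circ \<subseteq> ball 0 \<rho> - P" using e by blast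
    qed (auto simp: circ_def)
    have "connected (ball 0 \<rho> - P)" using P(1) by (intro connected_open_delete_finite) auto
    moreover have "open (ball 0 \<rho> - P)" using P(1) by (simp add: open_Diff finite_imp_closed)
    moreover have "p + of_real e \<in> ball 0 \<rho> - P" using circ pathstart_in_path_image by force
    \<comment> \<open>Deleting finitely many points keeps the ball connected, and a polynomial path
      is smooth enough to be a \<open>valid_path\<close>.\<close>
    ultimately obtain q where q: "polynomial_function q" "path_image q \<subseteq> ball 0 \<rho> - P" "pathstart q = x" "pathfinish q = p + of_real e"
      using connected_open_polynomial_connected[of "ball 0 \<rho> - P" x "p + of_real e"] x by blast
    have vq: "valid_path q" using q by (simp add: valid_path_polynomial_function)
    define \<delta> where "\<delta> = q +++ reversepath circ +++ reversepath q"
    have \<delta>: "valid_path \<delta>" "pathstart \<delta> = x" "pathfinish \<delta> = x" "path_image \<delta> \<subseteq> ball 0 \<rho> - P"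
      using vq q circ by (auto simp: \<delta>_def path_image_join)
    have w: "winding_number \<delta> z = (if z = p then - 1 else 0)" if z: "z \<in> P" for z
    proof -
      have off: "z \<notin> path_image q" "z \<notin> path_image circ" using z q circ by auto
      have "winding_number \<delta> z = winding_number q z + (- winding_number circ z + - winding_number q z)"
        unfolding \<delta>_def using off vq q circ
        by (simp add: winding_number_join winding_number_reversepath path_image_join valid_path_imp_path)
      moreover have "winding_number circ z = (if z = p then 1 else 0)"
      proof (cases "z = p")
        case True
        then show ?thesis using e by (simp add: circ_def winding_number_circlepath_centre)
      next
        case False
        then have "z \<notin> cball p e" using z e by blast
        moreover have "path_image circ \<subseteq> cball p e" using e by (simp add: circ_def)
        ultimately have "winding_number circ z = 0"
          using circ by (intro winding_number_zero_outside[of circ "cball p e"]) (auto simp: valid_path_imp_path)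
        then show ?thesis using False by simp
      qed
      ultimately show ?thesis by auto
    qed
    show ?case
    proof (intro exI[of _ "\<gamma> +++ \<delta>"] conjI ballI)
      fix z assume z: "z \<in> P"
      have "z \<notin> path_image \<gamma>" "z \<notin> path_image \<delta>" using z \<gamma> \<delta> by auto
      then have "winding_number (\<gamma> +++ \<delta>) z = winding_number \<gamma> z + winding_number \<delta> z"
        using \<gamma> \<delta> by (intro winding_number_join) (auto simp: valid_path_imp_path)
      then show "winding_number (\<gamma> +++ \<delta>) z = (if z \<in> insert p F then - 1 else 0)"
        using \<gamma>(5)[OF z] w[OF z] insert.hyps by auto
    qed (use \<gamma> \<delta> in \<open>auto simp: path_image_join\<close>)
  qed
qed

text \<open>The two signs of \<open>s\<close> cover the sequences of left poles (s = -1) and the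
  sequence of right points (s = 1).\<close>

lemma finite_nat_shift_ball: "finite {k::nat. norm (z + of_real s * of_nat k :: complex) < \<rho>}" if "\<bar>s\<bar> = 1"
proof (rule finite_subset)
  show "{k::nat. norm (z + of_real s * of_nat k) < \<rho>} \<subseteq> {..nat \<lceil>\<rho> + norm z\<rceil>}"
  proof
    fix k :: nat assume "k \<in> {k. norm (z + of_real s * of_nat k) < \<rho>}"
    moreover have "norm (of_real s * of_nat k :: complex) \<le> norm (z + of_real s * of_nat k) + norm z"
      by (metis add_diff_cancel_left' norm_triangle_ineq4)
    moreover have "norm (of_real s * of_nat k :: complex) = real k" using that by (simp add: norm_mult)
    ultimately have "real k \<le> \<rho> + norm z" by simp
    then show "k \<in> {..nat \<lceil>\<rho> + norm z\<rceil>}" by (simp add: le_nat_iff le_ceiling_iff)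
  qed
qed auto

text \<open>These are points in the variable s. For n = 1 they are the poles -x - l of the upper
  Gamma functions in the variable u = s + n - 1, which is why \<open>left_poles a 1\<close> occurs
  throughout.\<close>

definition left_poles :: "complex list \<Rightarrow> nat \<Rightarrow> complex set" where
  "left_poles a n = {1 - x - of_nat n - of_nat l | x l. x \<in> set a}"

text \<open>
  The definition of a separating loop does not require simplicity, so it suffices to let a vertical
  line make an excursion around each of the finitely many right points on its left.
\<close>

lemma separating_loop_exists:
  assumes a: "\<forall>x\<in>set a. x \<notin> \<int>\<^sub>\<le>\<^sub>0"
  shows "\<exists>g. separating_loop n a g"
proof -
  define L R where "L = left_poles a n" and "R = range (\<lambda>k::nat. 1 - of_nat n + of_nat k :: complex)"
  have disj: "z \<notin> R" if zL: "z \<in> L" for z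
  proof
    assume "z \<in> R"
    then obtain k where "z = 1 - of_nat n + of_nat k" by (auto simp: R_def)
    moreover obtain x l where "x \<in> set a" "z = 1 - x - of_nat n - of_nat l"
      using zL by (auto simp: L_def left_poles_def)
    ultimately have "x \<in> set a" "1 - of_nat n + of_nat k = 1 - x - of_nat n - of_nat l" by simp_all
    then have "x + of_nat (k + l) = 0" by (simp add: algebra_simps)
    then have "x = - of_nat (k + l)" by (metis eq_neg_iff_add_eq_0)
    then show False using a \<open>x \<in> set a\<close> by (metis minus_of_nat_in_nonpos_Ints)
  qed
  define M where "M = (\<Sum>x\<leftarrow>a. norm x) + 1"
  \<comment> \<open>A half-integer, so that the vertical line misses the right points, and large
    enough to have all left poles on its left.\<close>
  define c where "c = real_of_int (\<lceil>M\<rceil> + 1) + 1 / 2"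
  have xM: "norm x < M" if "x \<in> set a" for x
  proof -
    have "norm x \<le> sum_list (map norm a)" by (rule member_le_sum_list) (use that in auto)
    then show ?thesis by (simp add: M_def)
  qed
  have M1: "M \<ge> 1" by (auto simp: M_def intro!: sum_list_nonneg)
  have cM: "c > M + 1" unfolding c_def by (simp; linarith)
  have Lp: "Re z < c" "\<bar>Im z\<bar> < M" if z: "z \<in> L" for z
  proof -
    obtain x l where x: "x \<in> set a" "z = 1 - x - of_nat n - of_nat l" using z by (auto simp: L_def left_poles_def)
    show "Re z < c" using abs_Re_le_cmod[of x] xM[OF x(1)] cM by (simp add: x)
    show "\<bar>Im z\<bar> < M" using abs_Im_le_cmod[of x] xM[OF x(1)] by (simp add: x)
  qed
  have Rp: "Re z \<noteq> c" "\<bar>Im z\<bar> < M" if z: "z \<in> R" for z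
  proof -
    obtain k where k: "z = 1 - of_nat n + of_nat k" using z by (auto simp: R_def)
    have r: "Re z = of_int (1 - int n + int k)" by (simp add: k)
    show "Re z \<noteq> c"
    proof
      assume "Re z = c"
      then have "(of_int (2 * (1 - int n + int k)) :: real) = of_int (2 * (\<lceil>M\<rceil> + 1) + 1)"
        unfolding r c_def by simp
      then have "2 * (1 - int n + int k) = 2 * (\<lceil>M\<rceil> + 1) + 1" by (simp only: of_int_eq_iff)
      then show False by presburger
    qed
    show "\<bar>Im z\<bar> < M" using M1 by (simp add: k)
  qed
  \<comment> \<open>The right points on the wrong side of the line: the straight loop winds once
    around them, and the excursion has to take this 1 away.\<close>
  define F where "F = {z\<in>R. Re z < c}"
  have finF: "finite F"
  proof (rule finite_subset)
    show "F \<subseteq> (\<lambda>k::nat. 1 - of_nat n + of_nat k) ` {..nat \<lceil>c + real n\<rceil>}"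
    proof
      fix z assume "z \<in> F"
      then obtain k where k: "z = 1 - of_nat n + of_nat k" "Re z < c" by (auto simp: F_def R_def)
      have "k \<le> nat \<lceil>c + real n\<rceil>" using k by simp linarith
      then show "z \<in> (\<lambda>k::nat. 1 - of_nat n + of_nat k) ` {..nat \<lceil>c + real n\<rceil>}" using k by auto
    qed
  qed auto
  \<comment> \<open>The excursion is confined to a ball, which contains finitely many left poles and
    right points; about points outside the ball its winding number is 0.\<close>
  define \<rho> where "\<rho> = Max (insert (norm (Complex c M)) (norm ` F)) + 1"
  have \<rho>: "norm (Complex c M) < \<rho>" "norm (Complex c (- M)) < \<rho>" "\<And>z. z \<in> F \<Longrightarrow> norm z < \<rho>"
  proof -
    have m: "y \<le> Max (insert (norm (Complex c M)) (norm ` F))" if "y \<in> insert (norm (Complex c M)) (norm ` F)" for y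
      using that finF by (intro Max_ge) auto
    show "norm (Complex c M) < \<rho>" using m[of "norm (Complex c M)"] by (simp add: \<rho>_def)
    moreover have "norm (Complex c (- M)) = norm (Complex c M)" by (simp add: cmod_def)
    ultimately show "norm (Complex c (- M)) < \<rho>" by simp
    show "norm z < \<rho>" if "z \<in> F" for z using m[of "norm z"] that by (simp add: \<rho>_def)
  qed
  define P where "P = (L \<union> R) \<inter> ball 0 \<rho>"
  have "finite P"
  proof (rule finite_subset)
    show "P \<subseteq> (\<Union>x\<in>set a. (\<lambda>l. 1 - x - of_nat n - of_nat l) ` {l::nat. norm ((1 - x - of_nat n) + of_real (- 1) * of_nat l :: complex) < \<rho>})
      \<union> (\<lambda>l. 1 - of_nat n + of_nat l) ` {l::nat. norm ((1 - of_nat n) + of_real 1 * of_nat l :: complex) < \<rho>}"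
      unfolding P_def L_def R_def left_poles_def by auto
    show "finite \<dots>" by (intro finite_UnI finite_UN_I finite_imageI finite_nat_shift_ball) auto
  qed
  moreover have "F \<subseteq> P" using \<rho> by (auto simp: P_def F_def)
  moreover have xb: "Complex c M \<in> ball 0 \<rho> - P"
    using \<rho> Lp[of "Complex c M"] Rp[of "Complex c M"] by (auto simp: P_def)
  ultimately obtain \<gamma> where \<gamma>: "valid_path \<gamma>" "pathstart \<gamma> = Complex c M" "pathfinish \<gamma> = Complex c M"
      "path_image \<gamma> \<subseteq> ball 0 \<rho> - P" "\<And>z. z\<in>P \<Longrightarrow> winding_number \<gamma> z = (if z \<in> F then - 1 else 0)"
    using closed_path_winding_minus_one[of P F \<rho> "Complex c M"] by (auto simp: P_def)
  have \<gamma>w: "z \<notin> path_image \<gamma>" "winding_number \<gamma> z = (if z \<in> F then - 1 else 0)" if "z \<in> L \<union> R" for z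
  proof -
    show "z \<notin> path_image \<gamma>" using \<gamma>(4) that by (auto simp: P_def)
    show "winding_number \<gamma> z = (if z \<in> F then - 1 else 0)"
    proof (cases "z \<in> ball 0 \<rho>")
      case True
      then show ?thesis using \<gamma>(5) that by (auto simp: P_def)
    next
      case False
      then have "winding_number \<gamma> z = 0"
        using \<gamma> by (intro winding_number_zero_outside[of \<gamma> "ball 0 \<rho>"]) (auto simp: valid_path_imp_path)
      then show ?thesis using False \<rho>(3)[of z] by auto
    qed
  qed
  define g where "g = linepath (Complex c (- M)) (Complex c M) +++ \<gamma>"
  have g: "left_loop g" "pathstart g = Complex c (- M)" "pathfinish g = Complex c M"
    using \<gamma> M1 by (auto simp: g_def left_loop_def)
  have main: "\<forall>\<^sub>F T in at_top. z \<notin> path_image (truncated_loop g T) \<and>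
     winding_number (truncated_loop g T) z = (if Re z < c then 1 else 0) + (if z \<in> F then - 1 else 0)"
    if z: "z \<in> L \<union> R" for z
    using eventually_gt_at_top[of 0] eventually_gt_at_top[of "c - Re z"]
  proof eventually_elim
    case (elim T)
    have h: "Re z \<noteq> c" "\<bar>Im z\<bar> < M" using Lp[of z] Rp[of z] z by auto
    have e: "Complex c y - of_real T = Complex (c - T) y" for y by (simp add: complex_eq_iff)
    have gi: "path_image g = closed_segment (Complex c (- M)) (Complex c M) \<union> path_image \<gamma>"
      using \<gamma> by (simp add: g_def path_image_join)
    have offl: "z \<notin> closed_segment (Complex c (- M)) (Complex c M)"
      using h closed_segment_Re_Im[of z "Complex c (- M)" "Complex c M"] by auto
    have off: "z \<notin> path_image (truncated_loop g T)"
      unfolding path_image_truncated_loop[OF g(1)] g e gi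
      using h elim offl \<gamma>w(1)[OF z] closed_segment_Re_Im[of z "Complex (c - T) (- M)" "Complex c (- M)"]
        closed_segment_Re_Im[of z "Complex c M" "Complex (c - T) M"]
        closed_segment_Re_Im[of z "Complex (c - T) M" "Complex (c - T) (- M)"] by auto
    have "winding_number g z = winding_number (linepath (Complex c (- M)) (Complex c M)) z + winding_number \<gamma> z"
      unfolding g_def using offl \<gamma>w(1)[OF z] \<gamma> by (intro winding_number_join) (auto simp: valid_path_imp_path)
    then have "winding_number (truncated_loop g T) z = (if Re z < c then 1 else 0) + winding_number \<gamma> z"
      using winding_rectangle[of z M "c - T" c] h elim unfolding winding_number_truncated_loop[OF g(1) off] g e
      by (simp add: algebra_simps)
    then show ?case using off \<gamma>w(2)[OF z] by simp
  qed
  have "separating_loop n a g"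
    unfolding separating_loop_def
  proof (intro conjI g ballI allI)
    fix x l assume "x \<in> set a"
    then have z: "1 - x - of_nat n - of_nat l \<in> L" by (auto simp: L_def left_poles_def)
    then have "1 - x - of_nat n - of_nat l \<notin> F" using disj by (auto simp: F_def)
    then show "on_left_of_loop g (1 - x - of_nat n - of_nat l)"
      using main[of "1 - x - of_nat n - of_nat l"] Lp(1)[OF z] z unfolding on_left_of_loop_def by auto
  next
    fix k :: nat
    have z: "1 - of_nat n + of_nat k \<in> R" by (auto simp: R_def)
    then have "(1 - of_nat n + of_nat k :: complex) \<in> F \<longleftrightarrow> Re (1 - of_nat n + of_nat k) < c" by (auto simp: F_def)
    then show "on_right_of_loop g (1 - of_nat n + of_nat k)"
      using main[of "1 - of_nat n + of_nat k"] z unfolding on_right_of_loop_def by (auto split: if_splits)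
  qed
  then show ?thesis by blast
qed

section \<open>Mellin-type integrals over the unit interval\<close>

lemma of_real_powr_exp: "t > 0 \<Longrightarrow> of_real t powr w = exp (w * of_real (ln t) :: complex)"
  by (simp add: powr_def Ln_of_real)

lemma norm_of_real_powr: "t > 0 \<Longrightarrow> norm (of_real t powr w :: complex) = t powr Re w"
  by (simp add: of_real_powr_exp powr_def)

lemma powr_unit_interval_integral:
  fixes r :: real
  assumes "r > 0"
  shows "set_integrable lborel {0<..<1} (\<lambda>t. t powr (r - 1))"
    and "(LBINT t:{0<..<1}. t powr (r - 1)) = 1 / r"
proof -
  have "((\<lambda>t. t powr (r - 1)) has_integral (1 powr r / r - 0 powr r / r)) {0..1}"
  proof (rule fundamental_theorem_of_calculus_interior)
    show "continuous_on {0..1} (\<lambda>t. t powr r / r)"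
      using assms by (intro continuous_intros continuous_on_powr') auto
    show "((\<lambda>t. t powr r / r) has_vector_derivative x powr (r - 1)) (at x)" if "x \<in> {0<..<1}" for x
      using that assms unfolding has_real_derivative_iff_has_vector_derivative[symmetric]
      by (auto intro!: derivative_eq_intros)
  qed auto
  then have hi: "((\<lambda>t. t powr (r - 1)) has_integral 1 / r) {0<..<1}"
    using assms by (simp add: has_integral_Icc_iff_Ioo)
  then have "(\<lambda>t. t powr (r - 1)) absolutely_integrable_on {0<..<1}"
    by (intro nonnegative_absolutely_integrable_1) (auto simp: has_integral_integrable)
  then show si: "set_integrable lborel {0<..<1} (\<lambda>t. t powr (r - 1))"
    unfolding set_integrable_def
    by (subst (asm) integrable_completion) (auto intro!: borel_measurable_continuous_on_indicator continuous_intros)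
  show "(LBINT t:{0<..<1}. t powr (r - 1)) = 1 / r"
    using set_borel_integral_eq_integral(2)[OF si] hi by (simp add: integral_unique)
qed

lemma powr_times_continuous_integrable:
  fixes \<phi> :: "real \<Rightarrow> complex"
  assumes "Re \<beta> > 0" and cont: "continuous_on {0..1} \<phi>" and B: "\<And>t. t \<in> {0..1} \<Longrightarrow> norm (\<phi> t) \<le> B"
  shows "set_integrable lborel {0<..<1} (\<lambda>t. of_real t powr (\<beta> - 1) * \<phi> t)"
    and "(LBINT t:{0<..<1}. norm (of_real t powr (\<beta> - 1) * \<phi> t)) \<le> B / Re \<beta>"
proof -
  have i: "set_integrable lborel {0<..<1} (\<lambda>t. B * t powr (Re \<beta> - 1))"
    using powr_unit_interval_integral(1)[OF assms(1)] by (rule set_integrable_mult_right)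
  have bd: "norm (of_real t powr (\<beta> - 1) * \<phi> t) \<le> B * t powr (Re \<beta> - 1)" if "t \<in> {0<..<1}" for t
    using B[of t] that by (simp add: norm_mult norm_of_real_powr mult.commute mult_right_mono)
  have c0: "continuous_on {0<..<1} \<phi>" by (rule continuous_on_subset[OF cont]) auto
  show si: "set_integrable lborel {0<..<1} (\<lambda>t. of_real t powr (\<beta> - 1) * \<phi> t)"
  proof (rule set_integrable_bound[OF i])
    show "set_borel_measurable lborel {0<..<1} (\<lambda>t. of_real t powr (\<beta> - 1) * \<phi> t)"
      unfolding set_borel_measurable_def using c0
      by (auto intro!: borel_measurable_continuous_on_indicator continuous_intros simp: complex_nonpos_Reals_iff)
    show "AE x in lborel. x \<in> {0<..<1} \<longrightarrow> norm (of_real x powr (\<beta> - 1) * \<phi> x) \<le> norm (B * x powr (Re \<beta> - 1))"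
      using bd by (intro AE_I2 impI order_trans[OF bd]) auto
  qed
  have "(LBINT t:{0<..<1}. norm (of_real t powr (\<beta> - 1) * \<phi> t)) \<le> (LBINT t:{0<..<1}. B * t powr (Re \<beta> - 1))"
    by (rule set_integral_mono[OF set_integrable_norm[OF si] i bd])
  also have "\<dots> = B / Re \<beta>" using powr_unit_interval_integral(2)[OF assms(1)] by simp
  finally show "(LBINT t:{0<..<1}. norm (of_real t powr (\<beta> - 1) * \<phi> t)) \<le> B / Re \<beta>" .
qed

lemma powr_integration_by_parts:
  fixes \<phi> \<phi>' :: "real \<Rightarrow> complex"
  assumes \<beta>: "Re \<beta> > 0" and der: "\<And>t. t \<in> {0..1} \<Longrightarrow> (\<phi> has_vector_derivative \<phi>' t) (at t within {0..1})"
    and cont: "continuous_on {0..1} \<phi>'"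
  shows "(LBINT t:{0<..<1}. of_real t powr (\<beta> - 1) * \<phi> t) = \<phi> 1 / \<beta> - (LBINT t:{0<..<1}. of_real t powr \<beta> * \<phi>' t) / \<beta>"
proof -
  have c: "continuous_on {0..1} \<phi>"
    using der by (meson continuous_on_eq_continuous_within has_vector_derivative_continuous)
  obtain B where B: "\<And>t. t \<in> {0..1} \<Longrightarrow> norm (\<phi> t) \<le> B"
    using compact_imp_bounded[OF compact_continuous_image[OF c compact_Icc]] by (force simp: bounded_iff)
  obtain B' where B': "\<And>t. t \<in> {0..1} \<Longrightarrow> norm (\<phi>' t) \<le> B'"
    using compact_imp_bounded[OF compact_continuous_image[OF cont compact_Icc]] by (force simp: bounded_iff)
  have \<beta>0: "\<beta> \<noteq> 0" using \<beta> by auto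
  \<comment> \<open>At t = 0 the complex power has the value 0 by convention, and |t^\<beta>| =
    t^(Re \<beta>) tends to it. The same value removes the boundary term at 0.\<close>
  have cp: "continuous_on {0..1} (\<lambda>t. of_real t powr \<beta> :: complex)"
  proof (rule continuous_on_eq_continuous_within[THEN iffD2], rule ballI)
    fix t :: real assume t: "t \<in> {0..1}"
    show "continuous (at t within {0..1}) (\<lambda>t. of_real t powr \<beta> :: complex)"
    proof (cases "t = 0")
      case True
      have "((\<lambda>t. norm (of_real t powr \<beta> :: complex)) \<longlongrightarrow> 0) (at 0 within {0..1})"
      proof (rule Lim_transform_eventually)
        have "continuous_on {0..1::real} (\<lambda>t. t powr Re \<beta>)" using \<beta> by (intro continuous_intros continuous_on_powr') auto
        then show "((\<lambda>t::real. t powr Re \<beta>) \<longlongrightarrow> 0) (at 0 within {0..1})"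
          using \<beta> unfolding continuous_on_def by (force simp: powr_def)
        show "\<forall>\<^sub>F t in at 0 within {0..1}. t powr Re \<beta> = norm (of_real t powr \<beta> :: complex)"
          by (auto simp: eventually_at_filter norm_of_real_powr)
      qed
      then show ?thesis using True by (simp add: continuous_within tendsto_norm_zero_iff)
    next
      case False
      then show ?thesis using t unfolding continuous_within
        by (intro tendsto_powr_complex tendsto_intros) (auto simp: complex_nonpos_Reals_iff)
    qed
  qed
  have "((\<lambda>t. of_real t powr (\<beta> - 1) * \<phi> t + of_real t powr \<beta> * \<phi>' t / \<beta>) has_integral
      (of_real 1 powr \<beta> * \<phi> 1 / \<beta> - of_real 0 powr \<beta> * \<phi> 0 / \<beta>)) {0..1}"
  proof (rule fundamental_theorem_of_calculus_interior)
    show "continuous_on {0..1} (\<lambda>t. of_real t powr \<beta> * \<phi> t / \<beta>)"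
      by (intro continuous_on_divide continuous_on_mult cp c continuous_on_const) (simp add: \<beta>0)
    fix t :: real assume t: "t \<in> {0<..<1}"
    have "(\<phi> has_vector_derivative \<phi>' t) (at t within {0<..<1})"
      using t by (intro has_vector_derivative_within_subset[OF der]) auto
    then have d: "(\<phi> has_vector_derivative \<phi>' t) (at t)"
      unfolding at_within_open[OF t open_greaterThanLessThan] .
    have "((\<lambda>z. z powr \<beta>) has_field_derivative \<beta> * of_real t powr (\<beta> - 1)) (at (of_real t))"
      using t by (intro has_field_derivative_powr) (auto simp: complex_nonpos_Reals_iff)
    then have "((\<lambda>t. of_real t powr \<beta>) has_vector_derivative \<beta> * of_real t powr (\<beta> - 1)) (at t)"
      by (rule has_vector_derivative_real_field)
    from has_vector_derivative_divide[OF has_vector_derivative_mult[OF this d], of \<beta>]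
    show "((\<lambda>t. of_real t powr \<beta> * \<phi> t / \<beta>) has_vector_derivative
        of_real t powr (\<beta> - 1) * \<phi> t + of_real t powr \<beta> * \<phi>' t / \<beta>) (at t)"
      using \<beta>0 by (simp add: add_divide_distrib add.commute)
  qed auto
  then have hi: "((\<lambda>t. of_real t powr (\<beta> - 1) * \<phi> t + of_real t powr \<beta> * \<phi>' t / \<beta>) has_integral \<phi> 1 / \<beta>) {0<..<1}"
    using \<beta>0 by (simp add: has_integral_Icc_iff_Ioo)
  have s1: "set_integrable lborel {0<..<1} (\<lambda>t. of_real t powr (\<beta> - 1) * \<phi> t)"
    by (rule powr_times_continuous_integrable(1)[OF \<beta> c B])
  have "set_integrable lborel {0<..<1} (\<lambda>t. of_real t powr ((\<beta> + 1) - 1) * \<phi>' t)"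
    by (rule powr_times_continuous_integrable(1)[OF _ cont B']) (use \<beta> in auto)
  then have s2: "set_integrable lborel {0<..<1} (\<lambda>t. of_real t powr \<beta> * \<phi>' t / \<beta>)"
    by (intro set_integrable_divide) auto
  have "(LBINT t:{0<..<1}. of_real t powr (\<beta> - 1) * \<phi> t) + (LBINT t:{0<..<1}. of_real t powr \<beta> * \<phi>' t / \<beta>) = \<phi> 1 / \<beta>"
    using set_integral_add[OF s1 s2] set_borel_integral_eq_integral(2)[OF set_integral_add(1)[OF s1 s2]] integral_unique[OF hi] by simp
  then show ?thesis by (simp add: eq_diff_eq)
qed

text \<open>The contribution of one piece of the loop, parametrized by \<open>Y\<close>.\<close>

definition mellin_piece :: "real set \<Rightarrow> (real \<Rightarrow> complex) \<Rightarrow> (real \<Rightarrow> complex) \<Rightarrow> real \<Rightarrow> complex" where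
  "mellin_piece Y h e t = (LBINT y:Y. h y * of_real t powr e y)"

text \<open>For fixed y the t-integral of the modulus is at most |h(y)| B / Re (\<beta> y), and
  \<open>int\<close> makes this integrable over \<open>Y\<close>; so the double integral converges
  absolutely.\<close>

lemma mellin_piece_Fubini:
  fixes h \<beta> \<phi> :: "real \<Rightarrow> complex"
  assumes Y: "closed Y" and h: "continuous_on Y h" and \<beta>: "continuous_on Y \<beta>" "\<And>y. y \<in> Y \<Longrightarrow> Re (\<beta> y) > 0"
    and int: "set_integrable lborel Y (\<lambda>y. norm (h y) / Re (\<beta> y))"
    and \<phi>: "continuous_on {0..1} \<phi>"
  shows "set_integrable lborel {0<..<1} (\<lambda>t. mellin_piece Y h (\<lambda>y. \<beta> y - 1) t * \<phi> t)"
    and "(LBINT t:{0<..<1}. mellin_piece Y h (\<lambda>y. \<beta> y - 1) t * \<phi> t)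
       = (LBINT y:Y. h y * (LBINT t:{0<..<1}. of_real t powr (\<beta> y - 1) * \<phi> t))"
    and "set_integrable lborel Y (\<lambda>y. h y * (LBINT t:{0<..<1}. of_real t powr (\<beta> y - 1) * \<phi> t))"
proof -
  obtain B where B: "\<And>t. t \<in> {0..1} \<Longrightarrow> norm (\<phi> t) \<le> B"
    using compact_imp_bounded[OF compact_continuous_image[OF \<phi> compact_Icc]] by (force simp: bounded_iff)
  have B0: "B \<ge> 0" using order_trans[OF norm_ge_zero B[of 0]] by simp
  have Yb [measurable]: "Y \<in> sets borel" using Y by (rule borel_closed)
  define G where "G = (\<lambda>(y, t). h y * (of_real t powr (\<beta> y - 1) * \<phi> t))"
  define F where "F = (\<lambda>p. indicator (Y \<times> {0<..<1::real}) p *\<^sub>R G p)"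
  have Feq: "F (y, t) = indicator {0<..<1} t *\<^sub>R (indicator Y y *\<^sub>R (h y * (of_real t powr (\<beta> y - 1) * \<phi> t)))" for y t
    by (auto simp: F_def G_def indicator_def)
  \<comment> \<open>Joint measurability comes from continuity on the product, where t > 0 allows the
    power to be written as an exponential.\<close>
  have "F \<in> borel_measurable borel"
    unfolding F_def
  proof (rule borel_measurable_continuous_on_indicator)
    show "Y \<times> {0<..<1::real} \<in> sets borel"
      by (intro borel_Times Yb borel_open open_greaterThanLessThan)
    have "continuous_on (Y \<times> {0<..<1}) (\<lambda>p. h (fst p) * (exp ((\<beta> (fst p) - 1) * of_real (ln (snd p))) * \<phi> (snd p)))"
      by (intro continuous_intros continuous_on_compose2[OF h] continuous_on_compose2[OF \<beta>(1)] continuous_on_compose2[OF \<phi>]) auto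
    then show "continuous_on (Y \<times> {0<..<1}) G"
      by (rule continuous_on_cong[THEN iffD1, rotated -1]) (auto simp: G_def of_real_powr_exp)
  qed
  then have Fm: "F \<in> borel_measurable (lborel \<Otimes>\<^sub>M lborel)" by (simp add: lborel_prod)
  then have [measurable]: "F \<in> borel_measurable (borel \<Otimes>\<^sub>M borel)" by (simp cong: measurable_cong_sets)
  have inner: "(\<integral>t. norm (F (y, t)) \<partial>lborel) = indicator Y y *\<^sub>R (norm (h y) * (LBINT t:{0<..<1}. norm (of_real t powr (\<beta> y - 1) * \<phi> t)))" for y
  proof -
    have "(\<lambda>t. norm (F (y, t))) = (\<lambda>t. (indicator Y y * norm (h y)) * (indicator {0<..<1} t *\<^sub>R norm (of_real t powr (\<beta> y - 1) * \<phi> t)))"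
      by (auto simp: Feq norm_mult indicator_def)
    then show ?thesis by (simp add: set_lebesgue_integral_def)
  qed
  have inner2: "(\<integral>t. F (y, t) \<partial>lborel) = indicator Y y *\<^sub>R (h y * (LBINT t:{0<..<1}. of_real t powr (\<beta> y - 1) * \<phi> t))" for y
  proof -
    have e: "(\<lambda>t. F (y, t)) = (\<lambda>t. (indicator Y y *\<^sub>R h y) * (indicator {0<..<1} t *\<^sub>R (of_real t powr (\<beta> y - 1) * \<phi> t)))"
      by (auto simp: Feq indicator_def)
    show ?thesis unfolding e set_lebesgue_integral_def
      by (subst integral_mult_right_zero) simp
  qed
  have outer: "(\<integral>y. F (y, t) \<partial>lborel) = indicator {0<..<1} t *\<^sub>R (mellin_piece Y h (\<lambda>y. \<beta> y - 1) t * \<phi> t)" for t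
  proof -
    have e: "(\<lambda>y. F (y, t)) = (\<lambda>y. (indicator Y y *\<^sub>R (h y * of_real t powr (\<beta> y - 1))) * (indicator {0<..<1} t *\<^sub>R \<phi> t))"
      by (auto simp: Feq indicator_def)
    show ?thesis unfolding e set_lebesgue_integral_def mellin_piece_def
      by (subst integral_mult_left_zero) simp
  qed
  have FI: "integrable (lborel \<Otimes>\<^sub>M lborel) F"
  proof (rule lborel_pair.Fubini_integrable[OF Fm])
    have "integrable lborel (\<lambda>y. B * (indicator Y y *\<^sub>R (norm (h y) / Re (\<beta> y))))"
      using int unfolding set_integrable_def by (rule integrable_mult_right)
    then show "integrable lborel (\<lambda>y. \<integral>t. norm (F (y, t)) \<partial>lborel)"
    proof (rule Bochner_Integration.integrable_bound)
      show "(\<lambda>y. \<integral>t. norm (F (y, t)) \<partial>lborel) \<in> borel_measurable lborel" by measurable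
      show "AE y in lborel. norm (\<integral>t. norm (F (y, t)) \<partial>lborel) \<le> norm (B * (indicator Y y *\<^sub>R (norm (h y) / Re (\<beta> y))))"
      proof (intro AE_I2)
        fix y
        have nn: "(LBINT t:{0<..<1}. norm (of_real t powr (\<beta> y - 1) * \<phi> t)) \<ge> 0"
          unfolding set_lebesgue_integral_def by (intro integral_nonneg_AE) auto
        have "norm (h y) * (LBINT t:{0<..<1}. norm (of_real t powr (\<beta> y - 1) * \<phi> t)) \<le> norm (h y) * (B / Re (\<beta> y))" if "y \<in> Y"
          using powr_times_continuous_integrable(2)[OF \<beta>(2)[OF that] \<phi> B] by (intro mult_left_mono) auto
        then show "norm (\<integral>t. norm (F (y, t)) \<partial>lborel) \<le> norm (B * (indicator Y y *\<^sub>R (norm (h y) / Re (\<beta> y))))"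
          unfolding inner using nn B0 \<beta>(2)[of y] by (auto simp: indicator_def abs_mult mult_ac)
      qed
    qed
    show "AE y in lborel. integrable lborel (\<lambda>t. F (y, t))"
    proof (intro AE_I2)
      fix y show "integrable lborel (\<lambda>t. F (y, t))"
      proof (cases "y \<in> Y")
        case True
        have "integrable lborel (\<lambda>t. h y * (indicator {0<..<1} t *\<^sub>R (of_real t powr (\<beta> y - 1) * \<phi> t)))"
          using powr_times_continuous_integrable(1)[OF \<beta>(2)[OF True] \<phi> B] unfolding set_integrable_def
          by (rule integrable_mult_right)
        moreover have "(\<lambda>t. F (y, t)) = (\<lambda>t. h y * (indicator {0<..<1} t *\<^sub>R (of_real t powr (\<beta> y - 1) * \<phi> t)))"
          using True by (auto simp: Feq indicator_def)
        ultimately show ?thesis by simp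
      qed (simp add: Feq)
    qed
  qed
  show "set_integrable lborel {0<..<1} (\<lambda>t. mellin_piece Y h (\<lambda>y. \<beta> y - 1) t * \<phi> t)"
    using lborel_pair.integrable_snd[of "\<lambda>y t. F (y, t)"] FI unfolding set_integrable_def outer by simp
  show "set_integrable lborel Y (\<lambda>y. h y * (LBINT t:{0<..<1}. of_real t powr (\<beta> y - 1) * \<phi> t))"
    using lborel_pair.integrable_fst[of "\<lambda>y t. F (y, t)"] FI unfolding set_integrable_def inner2 by simp
  show "(LBINT t:{0<..<1}. mellin_piece Y h (\<lambda>y. \<beta> y - 1) t * \<phi> t)
       = (LBINT y:Y. h y * (LBINT t:{0<..<1}. of_real t powr (\<beta> y - 1) * \<phi> t))"
    using lborel_pair.Fubini_integral[of "\<lambda>y t. F (y, t)"] FI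
    unfolding set_lebesgue_integral_def[of _ "{0<..<1}" "\<lambda>t. mellin_piece Y h (\<lambda>y. \<beta> y - 1) t * \<phi> t"]
      set_lebesgue_integral_def[of _ Y] outer inner2 by simp
qed

text \<open>Fubini, integration by parts at fixed y, and Fubini again with weight h/\<beta> and
  exponent raised by one. The second exchange is covered by the same integrability: |h/\<beta>|
  \<le> |h| / Re \<beta>, and Re (\<beta> + 1) \<ge> 1.\<close>

lemma mellin_piece_by_parts:
  fixes h \<beta> \<phi> \<phi>' :: "real \<Rightarrow> complex"
  assumes Y: "closed Y" and h: "continuous_on Y h" and \<beta>: "continuous_on Y \<beta>" "\<And>y. y \<in> Y \<Longrightarrow> Re (\<beta> y) > 0"
    and int: "set_integrable lborel Y (\<lambda>y. norm (h y) / Re (\<beta> y))"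
    and der: "\<And>t. t \<in> {0..1} \<Longrightarrow> (\<phi> has_vector_derivative \<phi>' t) (at t within {0..1})"
    and \<phi>': "continuous_on {0..1} \<phi>'"
  shows "(LBINT t:{0<..<1}. mellin_piece Y h (\<lambda>y. \<beta> y - 1) t * \<phi> t)
     = (LBINT y:Y. h y / \<beta> y) * \<phi> 1 - (LBINT t:{0<..<1}. mellin_piece Y (\<lambda>y. h y / \<beta> y) \<beta> t * \<phi>' t)"
    and "set_integrable lborel Y (\<lambda>y. h y / \<beta> y)"
    and "set_integrable lborel {0<..<1} (\<lambda>t. mellin_piece Y (\<lambda>y. h y / \<beta> y) \<beta> t * \<phi>' t)"
proof -
  have \<phi>: "continuous_on {0..1} \<phi>"
    using der by (meson continuous_on_eq_continuous_within has_vector_derivative_continuous)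
  have Yb [measurable]: "Y \<in> sets borel" using Y by (rule borel_closed)
  have \<beta>0: "\<beta> y \<noteq> 0" if "y \<in> Y" for y using \<beta>(2)[OF that] by auto
  have c: "continuous_on Y (\<lambda>y. h y / \<beta> y)" using h \<beta>(1) \<beta>0 by (intro continuous_intros) auto
  have bd: "norm (h y / \<beta> y) \<le> norm (h y) / Re (\<beta> y)" if "y \<in> Y" for y
    using \<beta>(2)[OF that] complex_Re_le_cmod[of "\<beta> y"] by (auto simp: norm_divide intro!: divide_left_mono mult_pos_pos)
  show si: "set_integrable lborel Y (\<lambda>y. h y / \<beta> y)"
  proof (rule set_integrable_bound[OF int])
    show "set_borel_measurable lborel Y (\<lambda>y. h y / \<beta> y)"
      unfolding set_borel_measurable_def using borel_measurable_continuous_on_indicator[OF Yb c] by simp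
    show "AE y in lborel. y \<in> Y \<longrightarrow> norm (h y / \<beta> y) \<le> norm (norm (h y) / Re (\<beta> y))"
      using bd by (intro AE_I2 impI) (metis abs_ge_self order_trans real_norm_def)
  qed
  have int': "set_integrable lborel Y (\<lambda>y. norm (h y / \<beta> y) / Re (\<beta> y + 1))"
  proof (rule set_integrable_bound[OF si])
    show "set_borel_measurable lborel Y (\<lambda>y. norm (h y / \<beta> y) / Re (\<beta> y + 1))"
    proof -
      have "continuous_on Y (\<lambda>y. norm (h y / \<beta> y) / Re (\<beta> y + 1))"
        by (intro continuous_on_divide continuous_on_norm c continuous_on_Re continuous_on_add \<beta>(1) continuous_on_const)
          (use \<beta>(2) in fastforce)
      from borel_measurable_continuous_on_indicator[OF Yb this] show ?thesis
        unfolding set_borel_measurable_def by simp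
    qed
    show "AE y in lborel. y \<in> Y \<longrightarrow> norm (norm (h y / \<beta> y) / Re (\<beta> y + 1)) \<le> norm (h y / \<beta> y)"
    proof (intro AE_I2 impI)
      fix y assume "y \<in> Y"
      then have "Re (\<beta> y + 1) \<ge> 1" using \<beta>(2)[of y] by simp
      then show "norm (norm (h y / \<beta> y) / Re (\<beta> y + 1)) \<le> norm (h y / \<beta> y)"
        using divide_left_mono[of 1 "Re (\<beta> y + 1)" "norm (h y / \<beta> y)"] by simp
    qed
  qed
  have \<beta>1: "continuous_on Y (\<lambda>y. \<beta> y + 1)" "\<And>y. y \<in> Y \<Longrightarrow> Re (\<beta> y + 1) > 0"
    using \<beta> by (auto intro!: continuous_intros simp: add_pos_pos)
  note F1 = mellin_piece_Fubini[OF Y h \<beta> int \<phi>]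
  note F2 = mellin_piece_Fubini[OF Y c \<beta>1 int' \<phi>', simplified]
  show "set_integrable lborel {0<..<1} (\<lambda>t. mellin_piece Y (\<lambda>y. h y / \<beta> y) \<beta> t * \<phi>' t)" using F2(1) by simp
  have "(LBINT t:{0<..<1}. mellin_piece Y h (\<lambda>y. \<beta> y - 1) t * \<phi> t)
      = (LBINT y:Y. h y * (LBINT t:{0<..<1}. of_real t powr (\<beta> y - 1) * \<phi> t))"
    by (rule F1(2))
  also have "\<dots> = (LBINT y:Y. h y / \<beta> y * \<phi> 1 - h y / \<beta> y * (LBINT t:{0<..<1}. of_real t powr \<beta> y * \<phi>' t))"
  proof (rule set_lebesgue_integral_cong)
    show "\<forall>y. y \<in> Y \<longrightarrow> h y * (LBINT t:{0<..<1}. of_real t powr (\<beta> y - 1) * \<phi> t)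
        = h y / \<beta> y * \<phi> 1 - h y / \<beta> y * (LBINT t:{0<..<1}. of_real t powr \<beta> y * \<phi>' t)"
      using powr_integration_by_parts[OF \<beta>(2) der \<phi>'] \<beta>0 by (auto simp: right_diff_distrib)
  qed auto
  also have "\<dots> = (LBINT y:Y. h y / \<beta> y * \<phi> 1) - (LBINT y:Y. h y / \<beta> y * (LBINT t:{0<..<1}. of_real t powr \<beta> y * \<phi>' t))"
    by (intro set_integral_diff set_integrable_mult_left si) (use F2(3) in simp)
  also have "\<dots> = (LBINT y:Y. h y / \<beta> y) * \<phi> 1 - (LBINT t:{0<..<1}. mellin_piece Y (\<lambda>y. h y / \<beta> y) \<beta> t * \<phi>' t)"
  proof -
    have "(LBINT y:Y. h y / \<beta> y * \<phi> 1) = (LBINT y:Y. h y / \<beta> y) * \<phi> 1" by (rule set_integral_mult_left)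
    then show ?thesis using F2(2) by (simp only:) simp
  qed
  finally show "(LBINT t:{0<..<1}. mellin_piece Y h (\<lambda>y. \<beta> y - 1) t * \<phi> t)
     = (LBINT y:Y. h y / \<beta> y) * \<phi> 1 - (LBINT t:{0<..<1}. mellin_piece Y (\<lambda>y. h y / \<beta> y) \<beta> t * \<phi>' t)" .
qed

lemma contour_integral_linepath_LBINT:
  assumes "continuous_on (closed_segment p q) f"
  shows "contour_integral (linepath p q) f = (LBINT y:{0..1}. f (linepath p q y) * (q - p))"
proof -
  have c: "continuous_on {0..1} (\<lambda>y. f (linepath p q y) * (q - p))"
    using linepath_in_path[of _ p q]
    by (intro continuous_on_mult continuous_on_const continuous_on_compose2[OF assms continuous_on_linepath]) auto
  have "((\<lambda>y. f (linepath p q y) * (q - p)) has_integral contour_integral (linepath p q) f) {0..1}"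
    using has_contour_integral_integral[OF contour_integrable_continuous_linepath[OF assms]]
    by (simp add: has_contour_integral_linepath)
  then show ?thesis
    unfolding set_borel_integral_eq_integral(2)[OF borel_integrable_atLeastAtMost'[OF c]] by (rule integral_unique[symmetric])
qed

section \<open>The Mellin--Barnes integral\<close>

definition Gamma_kernel :: "complex list \<Rightarrow> complex list \<Rightarrow> nat \<Rightarrow> complex \<Rightarrow> complex" where
  "Gamma_kernel a b n u = Gamma_quot a b u / pochhammer (- u) n"

lemma Gamma_kernel_Suc: "Gamma_kernel a b (Suc n) u = Gamma_kernel a b n u / (of_nat n - u)"
  by (simp add: Gamma_kernel_def pochhammer_Suc)

text \<open>Each factor is comparable to u: |u| \<le> |u - j| + j \<le> (1 + n)|u - j|, since |u -
  j| \<ge> 1 and j < n.\<close>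

lemma norm_pochhammer_ge:
  fixes u :: complex
  assumes "u \<noteq> 0" "\<And>j. j < n \<Longrightarrow> 1 \<le> norm (u - of_nat j)"
  shows "norm u ^ n \<le> (1 + real n) ^ n * norm (pochhammer (- u) n)"
proof -
  have "norm u \<le> (1 + real n) * norm (- u + of_nat j)" if "j < n" for j
  proof -
    have "norm u \<le> norm (u - of_nat j) + real j"
      using norm_triangle_ineq[of "u - of_nat j" "of_nat j"] by simp
    also have "real j \<le> real n * norm (u - of_nat j)"
      using that assms(2)[OF that] mult_mono[of "real j" "real n" 1 "norm (u - of_nat j)"] by simp
    finally show ?thesis by (simp add: algebra_simps norm_minus_commute)
  qed
  then have "(\<Prod>j=0..<n. norm u) \<le> (\<Prod>j=0..<n. (1 + real n) * norm (- u + of_nat j))"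
    by (intro prod_mono) auto
  then show ?thesis by (simp add: pochhammer_prod prod_norm prod.distrib)
qed

lemma norm_Gamma_kernel_le:
  assumes "u \<noteq> 0" "\<And>j. j < n \<Longrightarrow> 1 \<le> norm (u - of_nat j)" "norm (Gamma_quot a b u) \<le> C * norm u powr q"
  shows "norm (Gamma_kernel a b n u) \<le> C * (1 + real n) ^ n * norm u powr (q - real n)"
proof -
  have p: "norm u ^ n > 0" using assms(1) by simp
  note le = norm_pochhammer_ge[OF assms(1), of n, OF assms(2)]
  have pp: "norm (pochhammer (- u) n) > 0"
  proof (rule ccontr)
    assume "\<not> ?thesis"
    with le p show False by simp
  qed
  have "norm (Gamma_kernel a b n u) = norm (Gamma_quot a b u) / norm (pochhammer (- u) n)"
    by (simp add: Gamma_kernel_def norm_divide)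
  also have "\<dots> \<le> (C * norm u powr q) / (norm u ^ n / (1 + real n) ^ n)"
  proof (rule frac_le)
    show "0 \<le> C * norm u powr q" using assms(3) norm_ge_zero order_trans by blast
    show "norm u ^ n / (1 + real n) ^ n \<le> norm (pochhammer (- u) n)"
      using le by (simp add: field_simps add_pos_nonneg)
  qed (use assms p in \<open>auto intro!: divide_pos_pos simp: add_pos_nonneg\<close>)
  also have "\<dots> = C * (1 + real n) ^ n * (norm u powr q / norm u powr real n)"
    using assms(1) by (simp add: powr_realpow)
  also have "norm u powr q / norm u powr real n = norm u powr (q - real n)"
    by (simp add: powr_diff)
  finally show ?thesis .
qed

text \<open>The reciprocals of the lower Gamma functions are entire (\<open>rGamma\<close>), so only
  the upper parameters create poles.\<close>

lemma Gamma_quot_holomorphic: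
  assumes "length a = length b" "\<And>x u. x \<in> set a \<Longrightarrow> u \<in> S \<Longrightarrow> x + u \<notin> \<int>\<^sub>\<le>\<^sub>0"
  shows "Gamma_quot a b holomorphic_on S"
  using assms
proof (induction rule: list_induct2)
  case (Cons x a y b)
  have eq: "Gamma_quot (x # a) (y # b) = (\<lambda>u. Gamma (x + u) * rGamma (y + u) * Gamma_quot a b u)"
    by (simp add: fun_eq_iff Gamma_quot_Cons rGamma_inverse_Gamma divide_inverse)
  show ?case unfolding eq using Cons by (intro holomorphic_intros) auto
qed (simp add: Gamma_quot_def[abs_def] Gamma_vec_def shift_vec_def)

lemma Gamma_kernel_holomorphic:
  assumes "length a = length b" "\<And>x u. x \<in> set a \<Longrightarrow> u \<in> S \<Longrightarrow> x + u \<notin> \<int>\<^sub>\<le>\<^sub>0"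
    and "\<And>k. k < n \<Longrightarrow> of_nat k \<notin> S"
  shows "Gamma_kernel a b n holomorphic_on S"
proof -
  have "pochhammer (- u) n \<noteq> 0" if "u \<in> S" for u
    using assms(3) that by (auto simp: pochhammer_eq_0_iff)
  moreover have "(\<lambda>u. pochhammer (- u) n) holomorphic_on S"
    unfolding pochhammer_prod by (intro holomorphic_intros)
  ultimately show ?thesis unfolding Gamma_kernel_def[abs_def]
    using Gamma_quot_holomorphic[OF assms(1,2)] by (intro holomorphic_intros) auto
qed

text \<open>Only the factor j = k of the Pochhammer symbol vanishes at \<open>p\<close>,
  contributing -(s - p); the others have the product (-1)^k k! (n - 1 - k)! there. A free
  \<open>p\<close> lets the formula be used in both variables u and s.\<close>

lemma residue_over_pochhammer:
  assumes S: "open S" "p \<in> S" "Q holomorphic_on S" and k: "k < n"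
  shows "residue (\<lambda>s. Q s / pochhammer (- (s - p + of_nat k)) n) p
    = - (Q p * (- 1) ^ k / (fact k * fact (n - 1 - k)))"
proof -
  define P where "P = (\<lambda>s. \<Prod>j\<in>{..<n} - {k}. (of_nat j - of_nat k) - (s - p))"
  have eq: "Q s / pochhammer (- (s - p + of_nat k)) n = (- Q s / P s) / (s - p)" for s
  proof -
    have "pochhammer (- (s - p + of_nat k)) n = (\<Prod>j\<in>{..<n}. (of_nat j - of_nat k) - (s - p))"
      unfolding pochhammer_prod by (intro prod.cong) (auto simp: algebra_simps)
    also have "\<dots> = - (s - p) * P s" unfolding P_def using k by (subst prod.remove[of _ k]) auto
    finally have e: "pochhammer (- (s - p + of_nat k)) n = - (s - p) * P s" .
    have "y / (- x * z) = (- y / z) / x" for x y z :: complex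
      by (cases "x = 0"; cases "z = 0") (simp_all add: field_simps)
    then show ?thesis unfolding e .
  qed
  \<comment> \<open>The zeros of the other factors differ from \<open>p\<close> by nonzero
    integers.\<close>
  have Pnz: "P s \<noteq> 0" if "s \<in> ball p 1" for s
  proof
    assume "P s = 0"
    then obtain j where j0: "j \<noteq> k" "of_nat j - of_nat k - (s - p) = 0" by (auto simp: P_def)
    then have j: "j \<noteq> k" "s - p = of_nat j - of_nat k" by simp_all
    have "norm (of_nat j - of_nat k :: complex) = \<bar>real j - real k\<bar>"
      by (metis norm_of_real of_real_diff of_real_of_nat_eq)
    moreover have "\<bar>real j - real k\<bar> \<ge> 1" using j(1) by linarith
    ultimately have "norm (s - p) \<ge> 1" unfolding j(2) by simp
    with that show False by (simp add: dist_norm norm_minus_commute)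
  qed
  have "residue (\<lambda>s. (- Q s / P s) / (s - p)) p = - Q p / P p"
  proof (rule residue_simple)
    show "open (S \<inter> ball p 1)" "p \<in> S \<inter> ball p 1" using S by auto
    have "Q holomorphic_on S \<inter> ball p 1" using S(3) by (rule holomorphic_on_subset) auto
    moreover have "P holomorphic_on S \<inter> ball p 1" unfolding P_def by (intro holomorphic_intros)
    ultimately show "(\<lambda>s. - Q s / P s) holomorphic_on S \<inter> ball p 1"
      using Pnz by (intro holomorphic_intros) auto
  qed
  moreover have "P p = (- 1) ^ k * fact k * fact (n - 1 - k)"
  proof -
    have "P p = (\<Prod>j\<in>{..<n} - {k}. of_nat j - of_nat k)" by (simp add: P_def)
    also have "{..<n} - {k} = {..<k} \<union> {k<..<n}" using k by auto
    also have "(\<Prod>j\<in>{..<k} \<union> {k<..<n}. of_nat j - of_nat k) = (\<Prod>j<k. of_nat j - of_nat k) * (\<Prod>j\<in>{k<..<n}. of_nat j - of_nat k :: complex)"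
      by (intro prod.union_disjoint) auto
    also have "(\<Prod>j<k. of_nat j - of_nat k :: complex) = (\<Prod>j<k. - of_nat (Suc j))"
      by (rule prod.reindex_bij_witness[of _ "\<lambda>j. k - 1 - j" "\<lambda>j. k - 1 - j"]) (auto simp: of_nat_diff)
    also have "\<dots> = (- 1) ^ k * fact k"
      by (simp only: prod_uminus fact_prod_Suc of_nat_prod card_lessThan atLeast0LessThan)
    also have "(\<Prod>j\<in>{k<..<n}. of_nat j - of_nat k :: complex) = (\<Prod>j<n - 1 - k. of_nat (Suc j))"
      by (rule prod.reindex_bij_witness[of _ "\<lambda>j. Suc (j + k)" "\<lambda>j. j - k - 1"]) (auto simp: of_nat_diff)
    also have "\<dots> = fact (n - 1 - k)" by (simp only: fact_prod_Suc of_nat_prod atLeast0LessThan)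
    finally show ?thesis .
  qed
  ultimately have "residue (\<lambda>s. (- Q s / P s) / (s - p)) p = - Q p / ((- 1) ^ k * fact k * fact (n - 1 - k))"
    by simp
  then show ?thesis unfolding eq by (cases "even k") simp_all
qed

lemma left_poles_facts:
  assumes "a \<noteq> []"
  shows "left_poles a n \<noteq> {}" "z \<in> left_poles a n \<Longrightarrow> z - 1 \<in> left_poles a n"
    "finite {z\<in>left_poles a n. x \<le> Re z}" "finite (Im ` left_poles a n)"
proof -
  show "left_poles a n \<noteq> {}" using assms by (cases a) (auto simp: left_poles_def)
  show "z \<in> left_poles a n \<Longrightarrow> z - 1 \<in> left_poles a n"
  proof -
    assume "z \<in> left_poles a n"
    then obtain y l where "y \<in> set a" "z = 1 - y - of_nat n - of_nat l" by (auto simp: left_poles_def)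
    then have "y \<in> set a" "z - 1 = 1 - y - of_nat n - of_nat (Suc l)" by auto
    then show "z - 1 \<in> left_poles a n" unfolding left_poles_def by blast
  qed
  have "{z\<in>left_poles a n. x \<le> Re z} \<subseteq> (\<Union>y\<in>set a. (\<lambda>l. 1 - y - of_nat n - of_nat l) ` {..nat \<lceil>1 - Re y - x\<rceil>})"
  proof
    fix z assume "z \<in> {z\<in>left_poles a n. x \<le> Re z}"
    then obtain y l where y: "y \<in> set a" "z = 1 - y - of_nat n - of_nat l" "x \<le> Re z" by (auto simp: left_poles_def)
    have "l \<le> nat \<lceil>1 - Re y - x\<rceil>" using y by simp linarith
    then show "z \<in> (\<Union>y\<in>set a. (\<lambda>l. 1 - y - of_nat n - of_nat l) ` {..nat \<lceil>1 - Re y - x\<rceil>})" using y by auto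
  qed
  then show "finite {z\<in>left_poles a n. x \<le> Re z}" by (rule finite_subset) auto
  have "Im ` left_poles a n \<subseteq> (\<lambda>y. - Im y) ` set a" by (auto simp: left_poles_def)
  then show "finite (Im ` left_poles a n)" by (rule finite_subset) auto
qed

text \<open>With l = -ln t, a single term (l x)^k / k! of the series of exp(l x) dominates the power
  as soon as k \<ge> |q|.\<close>

lemma power_times_exponential_bounded:
  fixes t q :: real
  assumes "0 < t" "t < 1"
  obtains C where "\<And>x. x \<ge> 1 \<Longrightarrow> x powr q * t powr x \<le> C"
proof -
  define k where "k = nat \<lceil>\<bar>q\<bar>\<rceil>"
  define l where "l = - ln t"
  have l: "l > 0" using assms by (simp add: l_def)
  have "x powr q * t powr x \<le> fact k / l ^ k" if "x \<ge> 1" for x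
  proof -
    have "(l * x) ^ k / fact k \<le> exp (l * x)"
    proof -
      have "(\<Sum>i\<in>{k}. (l * x) ^ i /\<^sub>R fact i) \<le> (\<Sum>i. (l * x) ^ i /\<^sub>R fact i)"
        using l that by (intro sum_le_suminf summable_exp_generic) auto
      then show ?thesis by (simp add: exp_def divide_inverse mult.commute)
    qed
    moreover have "t powr x = inverse (exp (l * x))"
      using assms by (simp add: powr_def l_def exp_minus[symmetric] mult.commute)
    moreover have "x powr q \<le> x ^ k"
    proof -
      have "x powr q \<le> x powr real k" using that by (intro powr_mono) (auto simp: k_def, linarith)
      then show ?thesis using that by (simp add: powr_realpow)
    qed
    ultimately have "x powr q * t powr x \<le> x ^ k * inverse (exp (l * x))" and le: "l ^ k * x ^ k \<le> fact k * exp (l * x)"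
      by (simp_all add: mult_right_mono power_mult_distrib divide_le_eq mult.commute)
    moreover have "x ^ k * inverse (exp (l * x)) \<le> fact k / l ^ k"
      using le l by (simp add: field_simps)
    ultimately show ?thesis by linarith
  qed
  then show ?thesis using that by blast
qed

lemma straight_loop_winding:
  assumes "\<bar>Im z\<bar> < M" "Re z \<noteq> c"
  shows "\<forall>\<^sub>F R in at_top. z \<notin> path_image (truncated_loop (linepath (Complex c (- M)) (Complex c M)) R) \<and>
     winding_number (truncated_loop (linepath (Complex c (- M)) (Complex c M)) R) z = (if Re z < c then 1 else 0)"
  using eventually_gt_at_top[of 0] eventually_gt_at_top[of "c - Re z"]
proof eventually_elim
  case (elim R)
  let ?g = "linepath (Complex c (- M)) (Complex c M)"
  have g: "left_loop ?g" using assms by (auto simp: left_loop_def)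
  have e: "Complex c y - of_real R = Complex (c - R) y" for y by (simp add: complex_eq_iff)
  have off: "z \<notin> path_image (truncated_loop ?g R)"
    unfolding path_image_truncated_loop[OF g] pathstart_linepath pathfinish_linepath path_image_linepath e
    using assms elim closed_segment_Re_Im[of z "Complex (c - R) (- M)" "Complex c (- M)"]
      closed_segment_Re_Im[of z "Complex c (- M)" "Complex c M"]
      closed_segment_Re_Im[of z "Complex c M" "Complex (c - R) M"]
      closed_segment_Re_Im[of z "Complex (c - R) M" "Complex (c - R) (- M)"] by auto
  then show ?case
    using winding_rectangle[of z M "c - R" c] assms elim unfolding winding_number_truncated_loop[OF g off]
    by (simp add: e)
qed

text \<open>The order n is deliberately not fixed: one abscissa \<open>c\<close> and one height
  \<open>M\<close> serve consecutive orders, so the loop stays the same when n increases.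
  \<open>M\<close> is at once the height of the rays and the threshold of the growth bound, which
  makes the bound available on the rays.\<close>

locale mellin_barnes =
  fixes a b :: "complex list" and c M C :: real
  assumes len: "length a = length b" and a_ne: "a \<noteq> []"
    and c_Re: "x \<in> set a \<Longrightarrow> - Re x < c" and c_nat: "of_nat k \<noteq> c"
    and M1: "M \<ge> 1" and M_norm: "x \<in> set a \<Longrightarrow> norm x < M" and C0: "C \<ge> 0"
    and bound: "M \<le> \<bar>Im u\<bar> \<or> M \<le> Re u \<Longrightarrow> norm (Gamma_quot a b u) \<le> C * norm u powr (- Re (psi a b))"
begin

lemma not_pole: "x + u \<notin> \<int>\<^sub>\<le>\<^sub>0" if "x \<in> set a" "u \<notin> left_poles a 1"
proof
  assume "x + u \<in> \<int>\<^sub>\<le>\<^sub>0"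
  then obtain l where "x + u = - of_nat l" by (auto elim!: nonpos_Ints_cases')
  then have "u = 1 - x - of_nat 1 - of_nat l" by (simp add: algebra_simps eq_neg_iff_add_eq_0)
  then show False using that unfolding left_poles_def by blast
qed

lemma left_poles_shift: "s + of_nat n - 1 \<in> left_poles a 1 \<longleftrightarrow> s \<in> left_poles a n"
  unfolding left_poles_def by (auto simp: algebra_simps)

lemma left_poles_bounds: "z \<in> left_poles a n \<Longrightarrow> Re z < c + 1 - real n" "z \<in> left_poles a n \<Longrightarrow> \<bar>Im z\<bar> < M"
proof -
  assume "z \<in> left_poles a n"
  then obtain x l where x: "x \<in> set a" "z = 1 - x - of_nat n - of_nat l" by (auto simp: left_poles_def)
  show "Re z < c + 1 - real n" using c_Re[OF x(1)] by (simp add: x)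
  show "\<bar>Im z\<bar> < M" using abs_Im_le_cmod[of x] M_norm[OF x(1)] by (simp add: x)
qed

lemma Gamma_kernel_holomorphic': "Gamma_kernel a b n holomorphic_on - (left_poles a 1 \<union> of_nat ` {..<n})"
  by (rule Gamma_kernel_holomorphic[OF len]) (auto simp: not_pole)

lemma norm_diff_nat_ge: "M \<le> \<bar>Im u\<bar> \<Longrightarrow> 1 \<le> norm (u - of_nat j)"
  using abs_Im_le_cmod[of "u - of_nat j"] M1 by simp

lemma Gamma_kernel_bound_Im:
  assumes "M \<le> \<bar>Im u\<bar>"
  shows "norm (Gamma_kernel a b n u) \<le> C * (1 + real n) ^ n * norm u powr (- Re (psi a b) - real n)"
  using assms M1 by (intro norm_Gamma_kernel_le norm_diff_nat_ge bound) auto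

lemma Gamma_kernel_bound_Re:
  assumes "M \<le> Re u" "real n \<le> Re u"
  shows "norm (Gamma_kernel a b n u) \<le> C * (1 + real n) ^ n * norm u powr (- Re (psi a b) - real n)"
proof (intro norm_Gamma_kernel_le bound)
  fix j assume "j < n"
  then show "1 \<le> norm (u - of_nat j)" using assms complex_Re_le_cmod[of "u - of_nat j"] by simp
qed (use assms M1 in auto)

text \<open>The rays of an arbitrary separating loop may run closer to the poles than the height
  \<open>M\<close>. Moving them to the heights \<open>M\<close> and \<open>- M\<close> takes place
  at the left end of pole-free strips.\<close>

lemma Gamma_kernel_strip_bound:
  assumes "\<And>z. z \<in> left_poles a 1 \<Longrightarrow> Im z < y1 \<or> y2 < Im z"
  obtains C' \<rho> where "C' \<ge> 0" "\<rho> < 0"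
    "\<And>u. y1 \<le> Im u \<Longrightarrow> Im u \<le> y2 \<Longrightarrow> Re u \<le> \<rho> \<Longrightarrow>
       norm (Gamma_kernel a b n u) \<le> C' * norm u powr (- Re (psi a b) - real n)"
proof -
  have "y \<noteq> - Im x" if "x \<in> set a" "y1 \<le> y" "y \<le> y2" for x y
  proof -
    have "1 - x - of_nat 1 - of_nat 0 \<in> left_poles a 1" using that(1) unfolding left_poles_def by blast
    from assms[OF this] show ?thesis using that by auto
  qed
  then obtain C' \<rho> where *: "C' \<ge> 0" "\<rho> < 0"
    "\<And>u. y1 \<le> Im u \<Longrightarrow> Im u \<le> y2 \<Longrightarrow> Re u \<le> \<rho> \<Longrightarrow> norm (Gamma_quot a b u) \<le> C' * norm u powr (- Re (psi a b))"
    using Gamma_quot_strip_bound[OF len, of y1 y2] by metis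
  show ?thesis
  proof (rule that[of "C' * (1 + real n) ^ n" "min \<rho> (- 1)"])
    fix u assume u: "y1 \<le> Im u" "Im u \<le> y2" "Re u \<le> min \<rho> (- 1)"
    have "1 \<le> norm (u - of_nat j)" for j
      using u abs_Re_le_cmod[of "u - of_nat j"] by simp
    then show "norm (Gamma_kernel a b n u) \<le> C' * (1 + real n) ^ n * norm u powr (- Re (psi a b) - real n)"
      using u * by (intro norm_Gamma_kernel_le *) auto
  qed (use * in auto)
qed

end

lemma set_integral_add_diff:
  fixes f g h :: "'a \<Rightarrow> 'b::{banach, second_countable_topology}"
  assumes "set_integrable N A f" "set_integrable N A g" "set_integrable N A h"
  shows "(LINT x:A|N. f x + g x - h x) = (LINT x:A|N. f x) + (LINT x:A|N. g x) - (LINT x:A|N. h x)"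
  using set_integral_diff(2)[OF set_integral_add(1)[OF assms(1,2)] assms(3)] set_integral_add(2)[OF assms(1,2)] by simp

section \<open>The integral over the reference loop\<close>

context mellin_barnes begin

abbreviation "lo \<equiv> Complex c (- M)"
abbreviation "hi \<equiv> Complex c M"

abbreviation "ray_value n P \<equiv> \<lambda>r. Gamma_kernel a b n (P - of_real r)"
abbreviation "ray_exponent n P \<equiv> \<lambda>r. of_nat n - (P - of_real r)"
abbreviation "segment_value n \<equiv> \<lambda>y. Gamma_kernel a b n (linepath lo hi y) * (hi - lo)"
abbreviation "segment_exponent n \<equiv> \<lambda>y. of_nat n - linepath lo hi y"

text \<open>The integral of \<open>Gamma_kernel a b n u\<close> times t^(n - 1 - u) over the
  reference loop, cut into three real integrals. The exponents have the form \<beta> - 1 with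
  \<beta> = n - u, as integration by parts expects.\<close>

definition loop_mellin :: "nat \<Rightarrow> real \<Rightarrow> complex" where
  "loop_mellin n t = mellin_piece {0..} (ray_value n lo) (\<lambda>r. ray_exponent n lo r - 1) t
    + mellin_piece {0..1} (segment_value n) (\<lambda>y. segment_exponent n y - 1) t
    - mellin_piece {0..} (ray_value n hi) (\<lambda>r. ray_exponent n hi r - 1) t"

text \<open>At \<open>Suc n\<close> this is the factor of \<phi>(1) in the boundary term.\<close>

definition loop_value :: "nat \<Rightarrow> complex" where
  "loop_value n = loop_integral (linepath lo hi) (Gamma_kernel a b n)"

lemma Gamma_kernel_continuous:
  assumes "\<And>u. u \<in> S \<Longrightarrow> \<bar>Im u\<bar> = M \<or> Re u = c"
  shows "continuous_on S (Gamma_kernel a b n)"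
proof (rule continuous_on_subset[OF holomorphic_on_imp_continuous_on[OF Gamma_kernel_holomorphic']])
  show "S \<subseteq> - (left_poles a 1 \<union> of_nat ` {..<n})"
    using left_poles_bounds[of _ 1] assms c_nat M1 by fastforce
qed

text \<open>The kernel decays like a power of -Re z with exponent -Re \<psi> - n; dividing by Re (n
  - z) adds the missing power, and -1 - (Re \<psi> + n) is integrable by the choice of n.\<close>

lemma ray_piece_integrable:
  assumes P: "\<bar>Im P\<bar> = M" "Re P = c" and n: "c < real n" and s: "0 < Re (psi a b) + real n"
  shows "set_integrable lborel {0..} (\<lambda>r. norm (Gamma_kernel a b n (P - of_real r)) / Re (of_nat n - (P - of_real r)))"
proof -
  \<comment> \<open>Coerced to the complex numbers to fit \<open>ray_set_integrable\<close>, which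
    asks only for continuity and decay.\<close>
  define f where "f = (\<lambda>z. of_real (norm (Gamma_kernel a b n z) / (real n - Re z)) :: complex)"
  have nf: "norm (f z) = \<bar>norm (Gamma_kernel a b n z) / (real n - Re z)\<bar>" for z unfolding f_def by (rule norm_of_real)
  have "set_integrable lborel {0..} (\<lambda>r. f (P - of_real r))"
  proof (rule ray_set_integrable[of _ _ "Im P" "Im P"])
    have "continuous_on ((\<lambda>r. P - of_real r) ` {0..}) (Gamma_kernel a b n)"
      using P by (intro Gamma_kernel_continuous) auto
    then show "continuous_on ((\<lambda>r. P - of_real r) ` {0..}) f"
      unfolding f_def using P n by (intro continuous_intros) auto
    show "ray_decay f (Im P) (Im P)"
      unfolding ray_decay_def
    proof (intro exI conjI allI impI)
      show "0 < Re (psi a b) + real n" "- 1 < (0::real)" using s by auto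
      fix z assume z: "Im P \<le> Im z" "Im z \<le> Im P" "Re z \<le> - 1"
      have "norm (Gamma_kernel a b n z) \<le> C * (1 + real n) ^ n * norm z powr (- Re (psi a b) - real n)"
        using z P by (intro Gamma_kernel_bound_Im) auto
      also have "\<dots> \<le> C * (1 + real n) ^ n * (- Re z) powr (- Re (psi a b) - real n)"
        using z s C0 abs_Re_le_cmod[of z] by (intro mult_left_mono powr_mono2') auto
      finally have k: "norm (Gamma_kernel a b n z) \<le> C * (1 + real n) ^ n * (- Re z) powr (- Re (psi a b) - real n)" .
      have "norm (f z) = \<bar>norm (Gamma_kernel a b n z) / (real n - Re z)\<bar>" by (rule nf)
      also have "\<dots> = norm (Gamma_kernel a b n z) / (real n - Re z)" using z by simp
      also have "\<dots> \<le> (C * (1 + real n) ^ n * (- Re z) powr (- Re (psi a b) - real n)) / (- Re z)"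
        using z k C0 by (intro frac_le) (auto intro!: mult_nonneg_nonneg)
      also have "\<dots> = C * (1 + real n) ^ n * (- Re z) powr (- 1 - (Re (psi a b) + real n))"
      proof -
        have "- 1 - (Re (psi a b) + real n) = (- Re (psi a b) - real n) - 1" by simp
        then show ?thesis using z by (simp only: powr_diff) simp
      qed
      finally show "norm (f z) \<le> C * (1 + real n) ^ n * (- Re z) powr (- 1 - (Re (psi a b) + real n))" .
    qed
  qed auto
  from set_integrable_norm[OF this]
  have "set_integrable lborel {0..} (\<lambda>r. norm (f (P - of_real r)))" .
  then show ?thesis
    by (rule set_integrable_cong[THEN iffD1, rotated -1]) (use P n in \<open>auto simp: nf\<close>)
qed

lemma segment_piece_integrable:
  assumes n: "c < real n"
  shows "set_integrable lborel {0..1} (\<lambda>y. norm (Gamma_kernel a b n (linepath lo hi y) * (hi - lo)) / Re (of_nat n - linepath lo hi y))"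
proof (rule borel_integrable_atLeastAtMost')
  have "continuous_on {0..1} (\<lambda>y. Gamma_kernel a b n (linepath lo hi y))"
    by (rule continuous_on_compose2[OF Gamma_kernel_continuous[of "linepath lo hi ` {0..1}"]])
       (auto simp: linepath_def algebra_simps intro!: continuous_intros)
  then show "continuous_on {0..1} (\<lambda>y. norm (Gamma_kernel a b n (linepath lo hi y) * (hi - lo)) / Re (of_nat n - linepath lo hi y))"
    using n by (intro continuous_intros) (auto simp: linepath_def algebra_simps)
qed

lemma pieces_continuous:
  "\<bar>Im P\<bar> = M \<Longrightarrow> Re P = c \<Longrightarrow> continuous_on {0..} (\<lambda>r. Gamma_kernel a b n (P - of_real r))"
  "continuous_on {0..1} (\<lambda>y. Gamma_kernel a b n (linepath lo hi y) * (hi - lo))"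
proof -
  assume "\<bar>Im P\<bar> = M" "Re P = c"
  then show "continuous_on {0..} (\<lambda>r. Gamma_kernel a b n (P - of_real r))"
    by (intro continuous_on_compose2[OF Gamma_kernel_continuous[of "(\<lambda>r. P - of_real r) ` {0..}"]])
       (auto intro!: continuous_intros)
next
  show "continuous_on {0..1} (\<lambda>y. Gamma_kernel a b n (linepath lo hi y) * (hi - lo))"
    by (intro continuous_on_mult continuous_on_const continuous_on_compose2[OF Gamma_kernel_continuous[of "linepath lo hi ` {0..1}"]])
       (auto simp: linepath_def algebra_simps intro!: continuous_intros)
qed

lemma loop_value_Suc: "loop_value (Suc n) = (LBINT r:{0..}. ray_value n lo r / ray_exponent n lo r)
    + (LBINT y:{0..1}. segment_value n y / segment_exponent n y)
    - (LBINT r:{0..}. ray_value n hi r / ray_exponent n hi r)"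
proof -
  have "contour_integral (linepath lo hi) (Gamma_kernel a b (Suc n)) = (LBINT y:{0..1}. Gamma_kernel a b (Suc n) (linepath lo hi y) * (hi - lo))"
  proof (intro contour_integral_linepath_LBINT Gamma_kernel_continuous)
    show "\<bar>Im u\<bar> = M \<or> Re u = c" if "u \<in> closed_segment lo hi" for u
      using closed_segment_Re_Im(1,2)[OF that] by simp
  qed
  then show ?thesis
    unfolding loop_value_def loop_integral_def by (simp add: Gamma_kernel_Suc)
qed

lemma loop_mellin_by_parts:
  assumes n: "c < real n" and s: "0 < Re (psi a b) + real n"
    and der: "\<And>t. t \<in> {0..1} \<Longrightarrow> (\<phi> has_vector_derivative \<phi>' t) (at t within {0..1})"
    and \<phi>': "continuous_on {0..1} \<phi>'"
  shows "set_integrable lborel {0<..<1} (\<lambda>t. loop_mellin n t * \<phi> t)"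
    "(LBINT t:{0<..<1}. loop_mellin n t * \<phi> t) = loop_value (Suc n) * \<phi> 1 - (LBINT t:{0<..<1}. loop_mellin (Suc n) t * \<phi>' t)"
proof -
  have \<phi>: "continuous_on {0..1} \<phi>"
    using der by (meson continuous_on_eq_continuous_within has_vector_derivative_continuous)
  have cb: "continuous_on {0..} (\<lambda>r. of_nat n - (P - of_real r))" for P :: complex
    by (intro continuous_intros)
  have cb2: "continuous_on {0..1} (\<lambda>y. of_nat n - linepath lo hi y)"
    by (intro continuous_intros continuous_on_linepath)
  have p1: "\<bar>Im lo\<bar> = M" "Re lo = c" and p2: "\<bar>Im hi\<bar> = M" "Re hi = c" using M1 by auto
  have rp: "Re (of_nat n - (lo - of_real r)) > 0" "Re (of_nat n - (hi - of_real r)) > 0" if "r \<in> {0..}" for r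
    using that n by auto
  have rp2: "Re (of_nat n - linepath lo hi y) > 0" for y
    using n by (simp add: linepath_def algebra_simps)
  note i1 = ray_piece_integrable[OF p1 n s] and i2 = ray_piece_integrable[OF p2 n s] and i3 = segment_piece_integrable[OF n]
  note F = mellin_piece_Fubini(1)[OF closed_atLeast pieces_continuous(1)[OF p1] cb rp(1) i1 \<phi>]
    mellin_piece_Fubini(1)[OF closed_atLeastAtMost pieces_continuous(2) cb2 rp2 i3 \<phi>]
    mellin_piece_Fubini(1)[OF closed_atLeast pieces_continuous(1)[OF p2] cb rp(2) i2 \<phi>]
  note B1 = mellin_piece_by_parts[OF closed_atLeast pieces_continuous(1)[OF p1] cb rp(1) i1 der \<phi>']
  note B2 = mellin_piece_by_parts[OF closed_atLeastAtMost pieces_continuous(2) cb2 rp2 i3 der \<phi>']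
  note B3 = mellin_piece_by_parts[OF closed_atLeast pieces_continuous(1)[OF p2] cb rp(2) i2 der \<phi>']
  have Vn: "loop_mellin n t * \<phi> t = mellin_piece {0..} (ray_value n lo) (\<lambda>r. ray_exponent n lo r - 1) t * \<phi> t
    + mellin_piece {0..1} (segment_value n) (\<lambda>y. segment_exponent n y - 1) t * \<phi> t
    - mellin_piece {0..} (ray_value n hi) (\<lambda>r. ray_exponent n hi r - 1) t * \<phi> t" for t
    unfolding loop_mellin_def by (simp add: distrib_right left_diff_distrib)
  have VS: "loop_mellin (Suc n) t * \<phi>' t = mellin_piece {0..} (\<lambda>r. ray_value n lo r / ray_exponent n lo r) (ray_exponent n lo) t * \<phi>' t
    + mellin_piece {0..1} (\<lambda>y. segment_value n y / segment_exponent n y) (segment_exponent n) t * \<phi>' t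
    - mellin_piece {0..} (\<lambda>r. ray_value n hi r / ray_exponent n hi r) (ray_exponent n hi) t * \<phi>' t" for t
  proof -
    have e: "of_nat (Suc n) - u - 1 = of_nat n - u" for u :: complex by simp
    show ?thesis unfolding loop_mellin_def Gamma_kernel_Suc e by (simp only: distrib_right left_diff_distrib times_divide_eq_left)
  qed
  show "set_integrable lborel {0<..<1} (\<lambda>t. loop_mellin n t * \<phi> t)"
    unfolding Vn by (intro set_integral_diff(1) set_integral_add(1) F)
  have E1: "(LBINT t:{0<..<1}. loop_mellin n t * \<phi> t) =
      (LBINT t:{0<..<1}. mellin_piece {0..} (ray_value n lo) (\<lambda>r. ray_exponent n lo r - 1) t * \<phi> t)
    + (LBINT t:{0<..<1}. mellin_piece {0..1} (segment_value n) (\<lambda>y. segment_exponent n y - 1) t * \<phi> t)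
    - (LBINT t:{0<..<1}. mellin_piece {0..} (ray_value n hi) (\<lambda>r. ray_exponent n hi r - 1) t * \<phi> t)"
    unfolding Vn by (rule set_integral_add_diff[OF F])
  have E2: "(LBINT t:{0<..<1}. loop_mellin (Suc n) t * \<phi>' t) =
      (LBINT t:{0<..<1}. mellin_piece {0..} (\<lambda>r. ray_value n lo r / ray_exponent n lo r) (ray_exponent n lo) t * \<phi>' t)
    + (LBINT t:{0<..<1}. mellin_piece {0..1} (\<lambda>y. segment_value n y / segment_exponent n y) (segment_exponent n) t * \<phi>' t)
    - (LBINT t:{0<..<1}. mellin_piece {0..} (\<lambda>r. ray_value n hi r / ray_exponent n hi r) (ray_exponent n hi) t * \<phi>' t)"
    unfolding VS by (rule set_integral_add_diff[OF B1(3) B2(3) B3(3)])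
  show "(LBINT t:{0<..<1}. loop_mellin n t * \<phi> t) = loop_value (Suc n) * \<phi> 1 - (LBINT t:{0<..<1}. loop_mellin (Suc n) t * \<phi>' t)"
    unfolding E1 E2 loop_value_Suc
    by (subst B1(1), assumption, assumption, subst B2(1), assumption, subst B3(1), assumption, assumption) (simp only: left_diff_distrib distrib_right diff_diff_eq2 diff_diff_eq add_diff_eq diff_add_eq add_ac)
qed

text \<open>|t^(-s)| = t^(-Re s) decays exponentially to the left and beats every power of |u|,
  whatever n and \<psi> are.\<close>

lemma contour_integrand_decay:
  assumes t: "0 < t" "t < 1" and h: "\<And>z. z \<in> left_poles a n \<Longrightarrow> Im z < y1 \<or> y2 < Im z"
  shows "ray_decay (\<lambda>s. Gamma_kernel a b n (s + of_nat n - 1) * of_real t powr (- s)) y1 y2"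
proof -
  have h1: "Im z < y1 \<or> y2 < Im z" if "z \<in> left_poles a 1" for z
    using h[of "z - of_nat n + 1"] left_poles_shift[of "z - of_nat n + 1" n] that by (simp add: algebra_simps)
  define q where "q = - Re (psi a b) - real n"
  obtain C' \<rho> where C': "C' \<ge> 0" "\<rho> < 0"
    "\<And>u. y1 \<le> Im u \<Longrightarrow> Im u \<le> y2 \<Longrightarrow> Re u \<le> \<rho> \<Longrightarrow> norm (Gamma_kernel a b n u) \<le> C' * norm u powr q"
    unfolding q_def using Gamma_kernel_strip_bound[of y1 y2 n] h1 by metis
  \<comment> \<open>Two powers beyond |q| are reserved: they become the x^(-2) of the decay with
    \<delta> = 1.\<close>
  obtain D where D: "\<And>x. x \<ge> 1 \<Longrightarrow> x powr (\<bar>q\<bar> + 2) * t powr x \<le> D"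
    using power_times_exponential_bounded[OF t] by metis
  \<comment> \<open>Chosen so that |u| \<le> Y x on the strip, with x = -Re s \<ge> 1.\<close>
  define Y where "Y = real n + 2 + \<bar>y1\<bar> + \<bar>y2\<bar>"
  define E where "E = C' * Y powr \<bar>q\<bar> * D"
  show ?thesis
    unfolding ray_decay_def
  proof (intro exI conjI allI impI)
    show "0 < (1::real)" "min (\<rho> - real n) (- 1 - real n) < 0" using C' by auto
    fix s assume s: "y1 \<le> Im s" "Im s \<le> y2" "Re s \<le> min (\<rho> - real n) (- 1 - real n)"
    define u where "u = s + of_nat n - 1"
    define x where "x = - Re s"
    have x: "x \<ge> 1" using s by (simp add: x_def)
    have u: "y1 \<le> Im u" "Im u \<le> y2" "Re u \<le> \<rho>" "Re u \<le> - 1" using s by (auto simp: u_def)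
    have nu: "1 \<le> norm u" using u abs_Re_le_cmod[of u] by linarith
    have "norm u \<le> \<bar>Re u\<bar> + \<bar>Im u\<bar>" by (rule cmod_le)
    also have "\<dots> \<le> x + (real n + 1 + \<bar>y1\<bar> + \<bar>y2\<bar>)" using s u by (simp add: u_def x_def)
    also have "\<dots> \<le> Y * x" using mult_left_mono[OF x, of "real n + 1 + \<bar>y1\<bar> + \<bar>y2\<bar>"] by (simp add: Y_def algebra_simps)
    finally have uY: "norm u \<le> Y * x" .
    have "norm u powr q \<le> norm u powr \<bar>q\<bar>" using nu by (intro powr_mono) auto
    also have "\<dots> \<le> (Y * x) powr \<bar>q\<bar>" using uY nu by (intro powr_mono2) auto
    also have "\<dots> = Y powr \<bar>q\<bar> * x powr \<bar>q\<bar>" by (rule powr_mult)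
    finally have uq: "norm u powr q \<le> Y powr \<bar>q\<bar> * x powr \<bar>q\<bar>" .
    have "norm (Gamma_kernel a b n u * of_real t powr (- s)) = norm (Gamma_kernel a b n u) * t powr x"
      using t by (simp add: norm_mult norm_of_real_powr x_def)
    also have "\<dots> \<le> (C' * norm u powr q) * t powr x" using C'(3)[OF u(1-3)] by (rule mult_right_mono) auto
    also have "\<dots> \<le> (C' * (Y powr \<bar>q\<bar> * x powr \<bar>q\<bar>)) * t powr x"
      using uq C'(1) by (intro mult_right_mono mult_left_mono) auto
    also have "\<dots> = C' * Y powr \<bar>q\<bar> * (x powr (\<bar>q\<bar> + 2) * t powr x) * x powr (- 1 - 1)"
    proof -
      have "x powr (\<bar>q\<bar> + 2) * x powr (- 1 - 1) = x powr \<bar>q\<bar>" by (simp add: powr_add[symmetric])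
      then show ?thesis by (metis (no_types, lifting) mult.assoc mult.commute)
    qed
    also have "\<dots> \<le> C' * Y powr \<bar>q\<bar> * D * x powr (- 1 - 1)"
      using D[OF x] C'(1) by (intro mult_right_mono mult_left_mono) auto
    finally show "norm (Gamma_kernel a b n (s + of_nat n - 1) * of_real t powr (- s)) \<le> E * (- Re s) powr (- 1 - 1)"
      by (simp add: u_def x_def E_def)
  qed
qed

text \<open>The identity Gamma(-u)/Gamma(n - u) = 1/(-u)_n breaks down at u = k \<ge> n, where
  \<open>Gamma\<close> is 0 by convention and the left side is 0 while the right side is not. So the
  regular points k \<ge> n of the kernel have to be excluded as well.\<close>

lemma G_integrand_eq:
  assumes "\<And>k::nat. s \<noteq> 1 - of_nat n + of_nat k"
  shows "G_integrand n a b t s = Gamma_kernel a b n (s + of_nat n - 1) * of_real t powr (- s)"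
proof -
  define u where "u = s + of_nat n - 1"
  have "- u \<notin> \<int>\<^sub>\<le>\<^sub>0"
  proof
    assume "- u \<in> \<int>\<^sub>\<le>\<^sub>0"
    then obtain k where "- u = - of_nat k" by (auto elim!: nonpos_Ints_cases')
    then have "s = 1 - of_nat n + of_nat k" by (simp add: u_def algebra_simps)
    with assms show False by blast
  qed
  then have "Gamma (- u) / Gamma (- u + of_nat n) = 1 / pochhammer (- u) n"
    by (simp add: pochhammer_Gamma)
  moreover have "1 - of_nat n - s = - u" "1 - s = - u + of_nat n" "of_nat n - 1 + s = u" by (auto simp: u_def)
  moreover have "A * g / (B * h) * x = A / B * (g / h) * x" for A B g h x :: complex by simp
  ultimately have "G_integrand n a b t s = Gamma_quot a b u * (Gamma (- u) / Gamma (- u + of_nat n)) * of_real t powr (- s)"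
    unfolding G_integrand_def Gamma_quot_def by (simp only:)
  also have "\<dots> = Gamma_kernel a b n u * of_real t powr (- s)"
    using \<open>Gamma (- u) / Gamma (- u + of_nat n) = 1 / pochhammer (- u) n\<close> by (simp add: Gamma_kernel_def)
  finally show ?thesis by (simp add: u_def)
qed

text \<open>Minus the residue of the kernel of order n at u = k < n, if the Gamma quotient is
  regular there. The sign suits poles that the reference loop encloses and the separating loop does
  not.\<close>

definition residue_coeff :: "nat \<Rightarrow> nat \<Rightarrow> complex" where
  "residue_coeff n k = Gamma_quot a b (of_nat k) * (- 1) ^ k / (fact k * fact (n - 1 - k))"

text \<open>On the right only the n zeros of (-u)_n are singular, so finitely many poles represent
  the infinitely many right points.\<close>

lemma poles_holomorphic:
  assumes "0 < t"
  shows "(\<lambda>s. Gamma_kernel a b n (s + of_nat n - 1) * of_real t powr (- s))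
    holomorphic_on - (left_poles a n \<union> (\<lambda>k. 1 - of_nat n + of_nat k) ` {..<n})"
proof -
  have "(\<lambda>s. s + of_nat n - 1) ` (- (left_poles a n \<union> (\<lambda>k. 1 - of_nat n + of_nat k) ` {..<n})) \<subseteq> - (left_poles a 1 \<union> of_nat ` {..<n})"
  proof (rule image_subsetI)
    fix s :: complex assume "s \<in> - (left_poles a n \<union> (\<lambda>k. 1 - of_nat n + of_nat k) ` {..<n})"
    then have s: "s \<notin> left_poles a n" "s \<notin> (\<lambda>k. 1 - of_nat n + of_nat k) ` {..<n}" by auto
    have "s + of_nat n - 1 \<notin> left_poles a 1" using s left_poles_shift[of s n] by simp
    moreover have "s + of_nat n - 1 \<notin> of_nat ` {..<n}"
    proof
      assume "s + of_nat n - 1 \<in> of_nat ` {..<n}"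
      then obtain k where "k < n" "s + of_nat n - 1 = of_nat k" by auto
      then have "s = 1 - of_nat n + of_nat k" by (simp add: algebra_simps)
      with s \<open>k < n\<close> show False by blast
    qed
    ultimately show "s + of_nat n - 1 \<in> - (left_poles a 1 \<union> of_nat ` {..<n})" by blast
  qed
  then have "(Gamma_kernel a b n \<circ> (\<lambda>s. s + of_nat n - 1)) holomorphic_on - (left_poles a n \<union> (\<lambda>k. 1 - of_nat n + of_nat k) ` {..<n})"
    by (intro holomorphic_on_compose_gen[OF _ Gamma_kernel_holomorphic'] holomorphic_intros) auto
  then show ?thesis using assms
    by (intro holomorphic_intros) (auto simp: o_def)
qed

lemma left_right_disjoint:
  assumes "\<forall>x\<in>set a. x \<notin> \<int>\<^sub>\<le>\<^sub>0"
  shows "1 - of_nat n + of_nat k \<notin> left_poles a n"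
proof
  assume "1 - of_nat n + of_nat k \<in> left_poles a n"
  then obtain x l where x: "x \<in> set a" "1 - of_nat n + of_nat k = 1 - x - of_nat n - of_nat l"
    by (auto simp: left_poles_def)
  then have "x + of_nat (k + l) = 0" by (simp add: algebra_simps)
  then have "x = - of_nat (k + l)" by (metis eq_neg_iff_add_eq_0)
  then show False using assms x by (metis minus_of_nat_in_nonpos_Ints)
qed

text \<open>The number \<open>m\<close> of right poles is kept apart from \<open>n\<close>: in the
  variable u the shift is that of n = 1, while the kernel may have any order.\<close>

lemma poles_left_poles:
  assumes a: "\<forall>x\<in>set a. x \<notin> \<int>\<^sub>\<le>\<^sub>0"
    and "f holomorphic_on - (left_poles a n \<union> (\<lambda>k. 1 - of_nat n + of_nat k) ` {..<m})"
    and "\<And>y1 y2. (\<And>z. z \<in> left_poles a n \<Longrightarrow> Im z < y1 \<or> y2 < Im z) \<Longrightarrow> ray_decay f y1 y2"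
  shows "poles (left_poles a n) ((\<lambda>k. 1 - of_nat n + of_nat k) ` {..<m}) f (c + 1 - real n) M"
proof
  let ?R = "(\<lambda>k. 1 - of_nat n + of_nat k) ` {..<m} :: complex set"
  show "finite ?R" by simp
  show "z \<in> ?R \<Longrightarrow> Re z \<noteq> c + 1 - real n" "z \<in> ?R \<Longrightarrow> \<bar>Im z\<bar> < M" for z using M1 c_nat by auto
  show "left_poles a n \<inter> ?R = {}" using left_right_disjoint[OF a] by auto
qed (use left_poles_facts[OF a_ne] left_poles_bounds[of _ n] assms(2,3) in blast)+

text \<open>Used with d = 1 - n and the power of t for the loop integral in s, and with d = 0 and
  the factor 1 for the boundary term.\<close>

lemma Gamma_kernel_residue:
  assumes a: "\<forall>x\<in>set a. x \<notin> \<int>\<^sub>\<le>\<^sub>0" and k: "k < n" and f: "f analytic_on {of_nat k + d}"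
  shows "residue (\<lambda>s. Gamma_kernel a b n (s - d) * f s) (of_nat k + d) = - (residue_coeff n k * f (of_nat k + d))"
proof -
  obtain S where S: "open S" "of_nat k + d \<in> S" "f holomorphic_on S"
    using f by (auto simp: analytic_at)
  define T where "T = S \<inter> {s. s - d \<notin> left_poles a 1}"
  have cl: "closed (left_poles a 1)"
    by (rule closed_if_finite_right[OF left_poles_facts(3)[OF a_ne]])
  have "open ((\<lambda>s. s - d) -` (- left_poles a 1))"
    using cl by (intro open_vimage continuous_intros) auto
  then have T: "open T" using S by (auto simp: T_def vimage_def intro!: open_Int)
  have kT: "of_nat k + d \<in> T" using S left_right_disjoint[OF a, of 1 k] by (simp add: T_def)
  have "(Gamma_quot a b \<circ> (\<lambda>s. s - d)) holomorphic_on T"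
    by (intro holomorphic_on_compose_gen[OF _ Gamma_quot_holomorphic[OF len, of "- left_poles a 1"]] holomorphic_intros)
       (auto simp: not_pole T_def)
  then have "(\<lambda>s. Gamma_quot a b (s - d) * f s) holomorphic_on T"
    using holomorphic_on_subset[OF S(3), of T] by (intro holomorphic_intros) (auto simp: o_def T_def)
  from residue_over_pochhammer[OF T kT this k]
  show ?thesis by (simp add: Gamma_kernel_def residue_coeff_def algebra_simps)
qed

lemma loop_integral_G_integrand:
  assumes t: "0 < t" "t < 1" and a: "\<forall>x\<in>set a. x \<notin> \<int>\<^sub>\<le>\<^sub>0" and g: "separating_loop n a g"
  shows "loop_integral g (G_integrand n a b t)
    = loop_mellin n t + 2 * pi * \<i> * (\<Sum>k\<in>{k. k < n \<and> real k < c}. residue_coeff n k * of_real t ^ (n - 1 - k))"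
proof -
  define f where "f = (\<lambda>s. Gamma_kernel a b n (s + of_nat n - 1) * of_real t powr (- s))"
  \<comment> \<open>The abscissa c of the variable u, seen in s = u + 1 - n.\<close>
  define c' where "c' = c + 1 - real n"
  define Rt where "Rt = (\<lambda>k. 1 - of_nat n + of_nat k :: complex) ` {..<n}"
  have ll: "left_loop g" using g by (simp add: separating_loop_def)
  have "poles (left_poles a n) Rt f c' M"
    unfolding c'_def Rt_def f_def by (intro poles_left_poles a poles_holomorphic t contour_integrand_decay) blast
  then interpret sl: separated_loop "left_poles a n" Rt f c' M g "\<lambda>_. 0"
    using g ll unfolding separated_loop_def separated_loop_axioms_def separating_loop_def on_right_of_loop_def Rt_def left_poles_def
    by auto
  \<comment> \<open>A point of the infinite loop lies on all sufficiently long truncations, and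
    these contain no right point; so \<open>G_integrand_eq\<close> applies along the whole
    loop.\<close>
  have off: "s \<noteq> 1 - of_nat n + of_nat k" if s: "\<forall>\<^sub>F R in at_top. s \<in> path_image (truncated_loop g R)" for s and k :: nat
  proof
    assume "s = 1 - of_nat n + of_nat k"
    then have "\<forall>\<^sub>F R in at_top. s \<notin> path_image (truncated_loop g R)"
      using g unfolding separating_loop_def on_right_of_loop_def by (auto elim: eventually_mono)
    with s have "\<forall>\<^sub>F R in at_top. s \<notin> path_image (truncated_loop g R) \<and> s \<in> path_image (truncated_loop g R)"
      by (intro eventually_conj)
    then show False using eventually_happens'[OF trivial_limit_at_top_linorder] by blast
  qed
  have onray: "P - of_real r \<in> closed_segment (P - of_real R) P" if "0 \<le> r" "r < R" for P :: complex and r R :: real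
    unfolding in_segment using that
    by (intro exI[of _ "1 - r / R"]) (auto simp: scaleR_conv_of_real field_simps)
  have r1: "G_integrand n a b t (pathstart g - of_real r) = f (pathstart g - of_real r)" if "r \<ge> 0" for r
    unfolding f_def
  proof (rule G_integrand_eq, rule off)
    show "\<forall>\<^sub>F R in at_top. pathstart g - of_real r \<in> path_image (truncated_loop g R)"
      using eventually_gt_at_top[of r] by eventually_elim (use onray that in \<open>auto simp: path_image_truncated_loop[OF ll]\<close>)
  qed
  have r2: "G_integrand n a b t (pathfinish g - of_real r) = f (pathfinish g - of_real r)" if "r \<ge> 0" for r
    unfolding f_def
  proof (rule G_integrand_eq, rule off)
    show "\<forall>\<^sub>F R in at_top. pathfinish g - of_real r \<in> path_image (truncated_loop g R)"
      using eventually_gt_at_top[of r] by eventually_elim (use onray that in \<open>auto simp: path_image_truncated_loop[OF ll] closed_segment_commute\<close>)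
  qed
  have r3: "G_integrand n a b t s = f s" if "s \<in> path_image g" for s
    unfolding f_def by (rule G_integrand_eq, rule off) (simp add: path_image_truncated_loop[OF ll] that)
  have "loop_integral g (G_integrand n a b t) = loop_integral g f"
    unfolding loop_integral_def using r1 r2 r3
    by (intro arg_cong2[of _ _ _ _ "(-)"] arg_cong2[of _ _ _ _ "(+)"] set_lebesgue_integral_cong contour_integral_eq) auto
  also have "\<dots> = loop_integral (linepath (Complex c' (- M)) (Complex c' M)) f
     + 2 * pi * \<i> * (\<Sum>p\<in>Rt. (0 - (if Re p < c' then 1 else 0)) * residue f p)"
    using sl.loop_integral_diff by (simp add: algebra_simps)
  also have "(\<Sum>p\<in>Rt. (0 - (if Re p < c' then 1 else 0)) * residue f p)
     = (\<Sum>k<n. (0 - (if real k < c then 1 else 0)) * residue f (1 - of_nat n + of_nat k))"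
    unfolding Rt_def by (subst sum.reindex) (auto simp: inj_on_def c'_def intro!: sum.cong)
  \<comment> \<open>A right pole below c is enclosed by the reference loop only; the resulting
    factor -1 cancels the sign of the residue.\<close>
  also have "\<dots> = (\<Sum>k<n. if real k < c then residue_coeff n k * of_real t ^ (n - 1 - k) else 0)"
  proof (rule sum.cong)
    fix k assume k: "k \<in> {..<n}"
    have d: "1 - of_nat n + of_nat k = of_nat k + (1 - of_nat n :: complex)" by simp
    have "residue f (of_nat k + (1 - of_nat n)) = - (residue_coeff n k * of_real t powr (- (of_nat k + (1 - of_nat n))))"
    proof -
      have e: "f = (\<lambda>s. Gamma_kernel a b n (s - (1 - of_nat n)) * of_real t powr (- s))"
        by (simp add: f_def fun_eq_iff algebra_simps)
      show ?thesis unfolding e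
        using k t by (intro Gamma_kernel_residue[OF a]) (auto intro!: analytic_intros)
    qed
    moreover have "of_real t powr (- (of_nat k + (1 - of_nat n))) = (of_real t ^ (n - 1 - k) :: complex)"
    proof -
      have "- (of_nat k + (1 - of_nat n)) = (of_nat (n - 1 - k) :: complex)" using k by (simp add: of_nat_diff)
      then show ?thesis using t by (simp add: powr_nat)
    qed
    ultimately show "(0 - (if real k < c then 1 else 0)) * residue f (1 - of_nat n + of_nat k)
       = (if real k < c then residue_coeff n k * of_real t ^ (n - 1 - k) else 0)"
      unfolding d by auto
  qed simp
  also have "\<dots> = (\<Sum>k\<in>{k. k < n \<and> real k < c}. residue_coeff n k * of_real t ^ (n - 1 - k))"
    by (rule sum.mono_neutral_cong_right) auto
  also have "loop_integral (linepath (Complex c' (- M)) (Complex c' M)) f = loop_mellin n t"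
  proof -
    have cd: "Complex c' y = Complex c y + (1 - of_nat n)" for y by (simp add: c'_def complex_eq_iff)
    have lp: "linepath (Complex c' (- M)) (Complex c' M) y = linepath lo hi y + (1 - of_nat n)" for y
      unfolding cd linepath_def by (simp add: scaleR_conv_of_real algebra_simps)
    have fu: "f (u + (1 - of_nat n)) = Gamma_kernel a b n u * of_real t powr (of_nat n - u - 1)" for u
      by (simp add: f_def algebra_simps)
    have ray: "f (Complex c' y - of_real r) = Gamma_kernel a b n (Complex c y - of_real r) * of_real t powr (of_nat n - (Complex c y - of_real r) - 1)" for y r
      using fu[of "Complex c y - of_real r"] unfolding cd by (simp add: algebra_simps)
    have "continuous_on (closed_segment (Complex c' (- M)) (Complex c' M)) f"
    proof (rule continuous_on_subset[OF holomorphic_on_imp_continuous_on[OF sl.holo]])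
      show "closed_segment (Complex c' (- M)) (Complex c' M) \<subseteq> - (left_poles a n \<union> Rt)"
        using closed_segment_Re_Im(1,2)[of _ "Complex c' (- M)" "Complex c' M"] sl.L_Re sl.Rt_Re by fastforce
    qed
    then have "contour_integral (linepath (Complex c' (- M)) (Complex c' M)) f
      = (LBINT y:{0..1}. (Gamma_kernel a b n (linepath lo hi y) * (hi - lo)) * of_real t powr (of_nat n - linepath lo hi y - 1))"
    proof (subst contour_integral_linepath_LBINT)
      have d: "Complex c' M - Complex c' (- M) = hi - lo" by (simp add: complex_eq_iff)
      show "(LBINT y:{0..1}. f (linepath (Complex c' (- M)) (Complex c' M) y) * (Complex c' M - Complex c' (- M)))
        = (LBINT y:{0..1}. (Gamma_kernel a b n (linepath lo hi y) * (hi - lo)) * of_real t powr (of_nat n - linepath lo hi y - 1))"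
        unfolding lp fu d by (intro set_lebesgue_integral_cong) (auto simp: mult_ac)
    qed
    then show ?thesis
      unfolding loop_integral_def loop_mellin_def mellin_piece_def pathstart_linepath pathfinish_linepath ray by simp
  qed
  finally show ?thesis .
qed

text \<open>Without the power of t, the decay comes from the additional factor of order n + 1, and
  Re \<psi> + n > 0 supplies the \<delta>.\<close>

lemma Gamma_kernel_decay:
  assumes q: "0 < Re (psi a b) + real n" and h: "\<And>z. z \<in> left_poles a 1 \<Longrightarrow> Im z < y1 \<or> y2 < Im z"
  shows "ray_decay (Gamma_kernel a b (Suc n)) y1 y2"
proof -
  obtain C' \<rho> where C': "C' \<ge> 0" "\<rho> < 0"
    "\<And>u. y1 \<le> Im u \<Longrightarrow> Im u \<le> y2 \<Longrightarrow> Re u \<le> \<rho> \<Longrightarrow> norm (Gamma_kernel a b (Suc n) u) \<le> C' * norm u powr (- Re (psi a b) - real (Suc n))"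
    using Gamma_kernel_strip_bound[of y1 y2 "Suc n"] h by metis
  show ?thesis
    unfolding ray_decay_def
  proof (intro exI conjI allI impI)
    show "0 < Re (psi a b) + real n" "\<rho> < 0" using q C' by auto
    fix z assume z: "y1 \<le> Im z" "Im z \<le> y2" "Re z \<le> \<rho>"
    have "norm (Gamma_kernel a b (Suc n) z) \<le> C' * norm z powr (- Re (psi a b) - real (Suc n))" using z by (intro C') auto
    also have "\<dots> \<le> C' * (- Re z) powr (- Re (psi a b) - real (Suc n))"
      using z q C' abs_Re_le_cmod[of z] by (intro mult_left_mono powr_mono2') auto
    also have "- Re (psi a b) - real (Suc n) = - 1 - (Re (psi a b) + real n)" by simp
    finally show "norm (Gamma_kernel a b (Suc n) z) \<le> C' * (- Re z) powr (- 1 - (Re (psi a b) + real n))" .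
  qed
qed

text \<open>The blown-up loop encloses every right pole 0, ..., n and the reference loop only those
  below c; the residues with c < k \<le> n make the difference.\<close>

lemma big_loop_integral:
  assumes a: "\<forall>x\<in>set a. x \<notin> \<int>\<^sub>\<le>\<^sub>0" and q: "0 < Re (psi a b) + real n" and X: "M \<le> X" "c < X" "real n < X"
  shows "loop_integral (linepath (Complex X (- X)) (Complex X X)) (Gamma_kernel a b (Suc n))
    = loop_value (Suc n) - 2 * pi * \<i> * (\<Sum>k\<in>{k. k \<le> n \<and> c < real k}. residue_coeff (Suc n) k)"
proof -
  let ?g = "linepath (Complex X (- X)) (Complex X X)"
  define Rt where "Rt = (of_nat ` {..<Suc n} :: complex set)"
  have Rt: "Rt = (\<lambda>k. 1 - of_nat 1 + of_nat k) ` {..<Suc n}" by (simp add: Rt_def)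
  have "poles (left_poles a 1) ((\<lambda>k. 1 - of_nat 1 + of_nat k) ` {..<Suc n}) (Gamma_kernel a b (Suc n)) (c + 1 - real 1) M"
    using Gamma_kernel_holomorphic'[of "Suc n"] Gamma_kernel_decay[OF q] by (intro poles_left_poles a) auto
  then have "poles (left_poles a 1) Rt (Gamma_kernel a b (Suc n)) c M" unfolding Rt by simp
  then interpret sl: separated_loop "left_poles a 1" Rt "Gamma_kernel a b (Suc n)" c M ?g "\<lambda>_. 1"
  proof (intro separated_loop.intro separated_loop_axioms.intro)
    show "left_loop ?g" using X M1 by (auto simp: left_loop_def)
    show "z \<in> left_poles a 1 \<Longrightarrow> on_left_of_loop ?g z" for z
      using straight_loop_winding[of z X X] left_poles_bounds[of z 1] X unfolding on_left_of_loop_def by auto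
    show "z \<in> Rt \<Longrightarrow> \<forall>\<^sub>F R in at_top. z \<notin> path_image (truncated_loop ?g R) \<and> winding_number (truncated_loop ?g R) z = 1" for z
      using straight_loop_winding[of z X X] X M1 by (auto simp: Rt_def)
  qed
  have "loop_integral ?g (Gamma_kernel a b (Suc n)) - loop_value (Suc n) = 2 * pi * \<i> * (\<Sum>p\<in>Rt. (1 - (if Re p < c then 1 else 0)) * residue (Gamma_kernel a b (Suc n)) p)"
    unfolding loop_value_def by (rule sl.loop_integral_diff)
  also have "(\<Sum>p\<in>Rt. (1 - (if Re p < c then 1 else 0)) * residue (Gamma_kernel a b (Suc n)) p)
     = (\<Sum>k<Suc n. (1 - (if real k < c then 1 else 0)) * residue (Gamma_kernel a b (Suc n)) (of_nat k))"
    unfolding Rt_def by (subst sum.reindex) (auto simp: inj_on_def intro!: sum.cong)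
  also have "\<dots> = (\<Sum>k<Suc n. if c < real k then - residue_coeff (Suc n) k else 0)"
  proof (rule sum.cong)
    fix k assume "k \<in> {..<Suc n}"
    then have "residue (\<lambda>s. Gamma_kernel a b (Suc n) (s - 0) * 1) (of_nat k + 0) = - (residue_coeff (Suc n) k * 1)"
      by (intro Gamma_kernel_residue[OF a]) (auto intro!: analytic_intros)
    moreover have "real k \<noteq> c" using c_nat by simp
    ultimately show "(1 - (if real k < c then 1 else 0)) * residue (Gamma_kernel a b (Suc n)) (of_nat k) = (if c < real k then - residue_coeff (Suc n) k else 0)"
      by auto
  qed simp
  also have "\<dots> = (\<Sum>k\<in>{k. k \<le> n \<and> c < real k}. - residue_coeff (Suc n) k)"
    by (rule sum.mono_neutral_cong_right) auto
  finally show ?thesis by (simp add: sum_negf algebra_simps)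
qed

text \<open>With \<sigma> = Re \<psi> + n the kernel is O(|u|^(-1 - \<sigma>)). On the rays one half
  of \<sigma> yields the decay in X and the other half keeps the ray integrable; on the vertical
  side the length 2X costs one power.\<close>

lemma big_loop_integral_bound:
  assumes q: "0 < Re (psi a b) + real n"
  obtains E where "\<And>X. M \<le> X \<Longrightarrow> real (Suc n) \<le> X \<Longrightarrow>
     norm (loop_integral (linepath (Complex X (- X)) (Complex X X)) (Gamma_kernel a b (Suc n))) \<le> E * X powr (- (Re (psi a b) + real n) / 2)"
proof -
  define \<sigma> where "\<sigma> = Re (psi a b) + real n"
  have s: "\<sigma> > 0" using q by (simp add: \<sigma>_def)
  define D where "D = C * (1 + real (Suc n)) ^ Suc n"
  have D: "D \<ge> 0" using C0 by (simp add: D_def)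
  have e: "- Re (psi a b) - real (Suc n) = - 1 - \<sigma>" by (simp add: \<sigma>_def)
  define J where "J = (LBINT r:{0..}. (1 + r) powr (- 1 - \<sigma> / 2))"
  have Ji: "set_integrable lborel {0..} (\<lambda>r::real. (1 + r) powr (- 1 - \<sigma> / 2))"
  proof -
    define f where "f = (\<lambda>z. of_real ((- Re z) powr (- 1 - \<sigma> / 2)) :: complex)"
    have "set_integrable lborel {0..} (\<lambda>r. f (- 1 - of_real r))"
    proof (rule ray_set_integrable[of _ _ 0 0])
      show "continuous_on ((\<lambda>r. - 1 - of_real r) ` {0..}) f"
        unfolding f_def by (intro continuous_intros) auto
      show "ray_decay f 0 0" unfolding ray_decay_def
        by (rule exI[of _ 1], rule exI[of _ "\<sigma> / 2"], rule exI[of _ "-1"]) (use s in \<open>auto simp: f_def\<close>)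
    qed auto
    from set_integrable_norm[OF this] show ?thesis by (simp add: f_def add.commute)
  qed
  have ray: "norm (ray_integral (Gamma_kernel a b (Suc n)) P) \<le> D * (1 / 4) powr (- 1 - \<sigma>) * J * X powr (- \<sigma> / 2)"
    if X: "M \<le> X" and P: "Re P = X" "\<bar>Im P\<bar> = X" for P X
  proof -
    have X1: "X \<ge> 1" using X M1 by simp
    have bd: "norm (Gamma_kernel a b (Suc n) (P - of_real r)) \<le> D * (1 / 4) powr (- 1 - \<sigma>) * X powr (- \<sigma> / 2) * (1 + r) powr (- 1 - \<sigma> / 2)"
      if r: "r \<ge> 0" for r
    proof -
      have "norm (Gamma_kernel a b (Suc n) (P - of_real r)) \<le> D * norm (P - of_real r) powr (- 1 - \<sigma>)"
        using Gamma_kernel_bound_Im[of "P - of_real r" "Suc n"] X P unfolding D_def e by simp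
      also have "\<dots> \<le> D * ((1 / 4) * (X + r)) powr (- 1 - \<sigma>)"
      proof (intro mult_left_mono powr_mono2')
        \<comment> \<open>|P - r| is at least both X and |X - r|; the first is enough for r \<le>
          3X, the second beyond.\<close>
        show "(1 / 4) * (X + r) \<le> norm (P - of_real r)"
          using abs_Re_le_cmod[of "P - of_real r"] abs_Im_le_cmod[of "P - of_real r"] P r by simp
      qed (use s D X1 r in auto)
      also have "((1 / 4) * (X + r)) powr (- 1 - \<sigma>) = (1 / 4) powr (- 1 - \<sigma>) * ((X + r) powr (- \<sigma> / 2) * (X + r) powr (- 1 - \<sigma> / 2))"
      proof -
        have "- \<sigma> / 2 + (- 1 - \<sigma> / 2) = - 1 - \<sigma>" by simp
        then show ?thesis unfolding powr_mult powr_add[symmetric] by (simp only:)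
      qed
      also have "D * ((1 / 4) powr (- 1 - \<sigma>) * ((X + r) powr (- \<sigma> / 2) * (X + r) powr (- 1 - \<sigma> / 2)))
         \<le> D * ((1 / 4) powr (- 1 - \<sigma>) * (X powr (- \<sigma> / 2) * (1 + r) powr (- 1 - \<sigma> / 2)))"
        using s D X1 r by (intro mult_left_mono mult_mono powr_mono2') auto
      finally show ?thesis by (simp add: mult_ac)
    qed
    have int: "set_integrable lborel {0..} (\<lambda>r. Gamma_kernel a b (Suc n) (P - of_real r))"
    proof (rule ray_set_integrable[of _ _ "Im P" "Im P"])
      show "continuous_on ((\<lambda>r. P - of_real r) ` {0..}) (Gamma_kernel a b (Suc n))"
      proof (rule continuous_on_subset[OF holomorphic_on_imp_continuous_on[OF Gamma_kernel_holomorphic']])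
        show "(\<lambda>r. P - of_real r) ` {0..} \<subseteq> - (left_poles a 1 \<union> of_nat ` {..<Suc n})"
        proof (rule image_subsetI)
          fix r :: real
          have im: "\<bar>Im (P - of_real r)\<bar> = X" using P by simp
          then have "P - of_real r \<notin> left_poles a 1" using left_poles_bounds(2)[of "P - of_real r" 1] X by auto
          moreover have "P - of_real r \<noteq> of_nat k" for k using im X1 by (metis abs_zero complex_Im_of_nat not_one_le_zero)
          ultimately show "P - of_real r \<in> - (left_poles a 1 \<union> of_nat ` {..<Suc n})" by blast
        qed
      qed
      show "ray_decay (Gamma_kernel a b (Suc n)) (Im P) (Im P)"
        by (rule Gamma_kernel_decay[OF q]) (use left_poles_bounds(2)[of _ 1] P X in fastforce)
    qed auto
    have "norm (ray_integral (Gamma_kernel a b (Suc n)) P) \<le> (LBINT r:{0..}. norm (Gamma_kernel a b (Suc n) (P - of_real r)))"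
      unfolding ray_integral_def by (rule set_integral_norm_bound[OF int])
    also have "\<dots> \<le> (LBINT r:{0..}. D * (1 / 4) powr (- 1 - \<sigma>) * X powr (- \<sigma> / 2) * (1 + r) powr (- 1 - \<sigma> / 2))"
      by (rule set_integral_mono[OF set_integrable_norm[OF int] set_integrable_mult_right[OF Ji]]) (use bd in auto)
    also have "\<dots> = D * (1 / 4) powr (- 1 - \<sigma>) * J * X powr (- \<sigma> / 2)"
      unfolding J_def by simp
    finally show ?thesis .
  qed
  show ?thesis
  proof (rule that)
    fix X assume X: "M \<le> X" "real (Suc n) \<le> X"
    have X1: "X \<ge> 1" using X M1 by simp
    let ?P = "Complex X (- X)" and ?Q = "Complex X X"
    have "norm (contour_integral (linepath ?P ?Q) (Gamma_kernel a b (Suc n))) \<le> D * X powr (- 1 - \<sigma>) * norm (?Q - ?P)"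
    proof (rule contour_integral_bound_linepath)
      have re: "Re u = X" if "u \<in> closed_segment ?P ?Q" for u using closed_segment_Re_Im(1,2)[OF that] by simp
      have "continuous_on (closed_segment ?P ?Q) (Gamma_kernel a b (Suc n))"
      proof (rule continuous_on_subset[OF holomorphic_on_imp_continuous_on[OF Gamma_kernel_holomorphic']])
        have "of_nat k \<noteq> u" if "u \<in> closed_segment ?P ?Q" "k < Suc n" for u k
          using re[OF that(1)] that(2) X by auto
        moreover have "u \<notin> left_poles a 1" if "u \<in> closed_segment ?P ?Q" for u
        proof
          assume "u \<in> left_poles a 1"
          then obtain x l where x: "x \<in> set a" "u = 1 - x - of_nat 1 - of_nat l" by (auto simp: left_poles_def)
          have "Re u \<le> norm x" using abs_Re_le_cmod[of x] by (simp add: x)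
          then show False using re[OF that] M_norm[OF x(1)] X by simp
        qed
        ultimately show "closed_segment ?P ?Q \<subseteq> - (left_poles a 1 \<union> of_nat ` {..<Suc n})" by blast
      qed
      then show "Gamma_kernel a b (Suc n) contour_integrable_on linepath ?P ?Q"
        by (rule contour_integrable_continuous_linepath)
      fix u assume u: "u \<in> closed_segment ?P ?Q"
      have "norm (Gamma_kernel a b (Suc n) u) \<le> D * norm u powr (- 1 - \<sigma>)"
        using Gamma_kernel_bound_Re[of u "Suc n"] X re[OF u] unfolding D_def e by simp
      also have "\<dots> \<le> D * X powr (- 1 - \<sigma>)"
        using s D X1 re[OF u] complex_Re_le_cmod[of u] by (intro mult_left_mono powr_mono2') auto
      finally show "norm (Gamma_kernel a b (Suc n) u) \<le> D * X powr (- 1 - \<sigma>)" .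
    qed (use D in auto)
    also have "norm (?Q - ?P) = 2 * X"
    proof -
      have "?Q - ?P = of_real (2 * X) * \<i>" by (simp add: complex_eq_iff)
      also have "norm \<dots> = 2 * X" unfolding norm_mult norm_of_real using X1 by simp
      finally show ?thesis .
    qed
    also have "D * X powr (- 1 - \<sigma>) * (2 * X) = 2 * D * X powr (- \<sigma>)"
    proof -
      have "X powr (- 1 - \<sigma>) * X = X powr (- 1 - \<sigma>) * X powr 1" using X1 by simp
      also have "\<dots> = X powr (- \<sigma>)" by (simp only: powr_add[symmetric]) simp
      finally show ?thesis by simp
    qed
    also have "\<dots> \<le> 2 * D * X powr (- \<sigma> / 2)"
      using D X1 s by (intro mult_left_mono powr_mono) auto
    finally have v: "norm (contour_integral (linepath ?P ?Q) (Gamma_kernel a b (Suc n))) \<le> 2 * D * X powr (- \<sigma> / 2)" .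
    have "norm (loop_integral (linepath ?P ?Q) (Gamma_kernel a b (Suc n)))
      \<le> norm (ray_integral (Gamma_kernel a b (Suc n)) ?P) + norm (contour_integral (linepath ?P ?Q) (Gamma_kernel a b (Suc n)))
        + norm (ray_integral (Gamma_kernel a b (Suc n)) ?Q)"
      unfolding loop_integral_def ray_integral_def[symmetric] pathstart_linepath pathfinish_linepath
      using norm_triangle_ineq4 norm_triangle_ineq by (meson add_right_mono order_trans)
    also have "\<dots> \<le> (2 * (D * (1 / 4) powr (- 1 - \<sigma>) * J) + 2 * D) * X powr (- \<sigma> / 2)"
      using ray[OF X(1), of ?P] ray[OF X(1), of ?Q] v X1 by (simp add: distrib_right)
    finally show "norm (loop_integral (linepath ?P ?Q) (Gamma_kernel a b (Suc n)))
       \<le> (2 * (D * (1 / 4) powr (- 1 - \<sigma>) * J) + 2 * D) * X powr (- (Re (psi a b) + real n) / 2)"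
      by (simp add: \<sigma>_def)
  qed
qed

lemma loop_value_Suc_value:
  assumes a: "\<forall>x\<in>set a. x \<notin> \<int>\<^sub>\<le>\<^sub>0" and q: "0 < Re (psi a b) + real n"
  shows "loop_value (Suc n) = 2 * pi * \<i> * (\<Sum>k\<in>{k. k \<le> n \<and> c < real k}. residue_coeff (Suc n) k)"
proof -
  define S where "S = 2 * pi * \<i> * (\<Sum>k\<in>{k. k \<le> n \<and> c < real k}. residue_coeff (Suc n) k)"
  obtain E where E: "\<And>X. M \<le> X \<Longrightarrow> real (Suc n) \<le> X \<Longrightarrow>
     norm (loop_integral (linepath (Complex X (- X)) (Complex X X)) (Gamma_kernel a b (Suc n))) \<le> E * X powr (- (Re (psi a b) + real n) / 2)"
    using big_loop_integral_bound[OF q] by metis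
  have "((\<lambda>X. E * X powr (- (Re (psi a b) + real n) / 2)) \<longlongrightarrow> E * 0) at_top"
    using q by (intro tendsto_intros tendsto_neg_powr filterlim_ident) auto
  \<comment> \<open>The left-hand side is the modulus of the blown-up loop integral but does not
    depend on X, so it is at most the limit 0.\<close>
  moreover have "\<forall>\<^sub>F X in at_top. norm (loop_value (Suc n) - S) \<le> E * X powr (- (Re (psi a b) + real n) / 2)"
    using eventually_ge_at_top[of M] eventually_ge_at_top[of "real (Suc n)"] eventually_gt_at_top[of c]
  proof eventually_elim
    case (elim X)
    then show ?case using E[of X] big_loop_integral[OF a q, of X] by (simp add: S_def)
  qed
  ultimately have "norm (loop_value (Suc n) - S) \<le> E * 0"
    by (intro tendsto_lowerbound[OF _ _ trivial_limit_at_top_linorder])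
  then show ?thesis by (simp add: S_def)
qed

end

section \<open>The functional\<close>

lemma nderiv_0 [simp]: "nderiv 0 \<phi> = \<phi>"
  by (simp add: nderiv_def)

lemma nderiv_Suc: "nderiv (Suc k) \<phi> x = vector_derivative (nderiv k \<phi>) (at x within {0..1})"
  by (simp add: nderiv_def)

lemma CB_inf_has_vector_derivative:
  assumes "\<phi> \<in> CB_inf" "x \<in> {0..1}"
  shows "(nderiv k \<phi> has_vector_derivative nderiv (Suc k) \<phi> x) (at x within {0..1})"
  unfolding nderiv_Suc using assms by (simp add: CB_inf_def vector_derivative_works[symmetric])

lemma nderiv_SucI:
  assumes "x \<in> {0..1}" "(nderiv k \<phi> has_vector_derivative d) (at x within {0..1})"
  shows "nderiv (Suc k) \<phi> x = d"
  unfolding nderiv_Suc using assms by (intro vector_derivative_within_cbox[of 0 1, simplified]) auto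

lemma CB_inf_continuous:
  assumes "\<phi> \<in> CB_inf" shows "continuous_on {0..1} (nderiv k \<phi>)"
  using CB_inf_has_vector_derivative[OF assms]
  by (meson continuous_on_eq_continuous_within has_vector_derivative_continuous)

lemma nderiv_add:
  assumes "\<phi> \<in> CB_inf" "\<eta> \<in> CB_inf" "x \<in> {0..1}"
  shows "nderiv k (\<lambda>x. \<phi> x + \<eta> x) x = nderiv k \<phi> x + nderiv k \<eta> x"
  using assms(3)
proof (induction k arbitrary: x)
  case (Suc k)
  have "((\<lambda>x. nderiv k \<phi> x + nderiv k \<eta> x) has_vector_derivative nderiv (Suc k) \<phi> x + nderiv (Suc k) \<eta> x) (at x within {0..1})"
    using assms Suc.prems by (intro has_vector_derivative_add CB_inf_has_vector_derivative)
  \<comment> \<open>The induction hypothesis gives equality on [0,1] only, which suffices because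
    the derivative is taken within that interval.\<close>
  then have "(nderiv k (\<lambda>x. \<phi> x + \<eta> x) has_vector_derivative nderiv (Suc k) \<phi> x + nderiv (Suc k) \<eta> x) (at x within {0..1})"
    by (rule has_vector_derivative_transform[OF Suc.prems, rotated]) (use Suc.IH in auto)
  then show ?case by (rule nderiv_SucI[OF Suc.prems])
qed simp

lemma nderiv_cmult:
  assumes "\<phi> \<in> CB_inf" "x \<in> {0..1}"
  shows "nderiv k (\<lambda>x. c * \<phi> x) x = c * nderiv k \<phi> x"
  using assms(2)
proof (induction k arbitrary: x)
  case (Suc k)
  have "((\<lambda>x. c * nderiv k \<phi> x) has_vector_derivative c * nderiv (Suc k) \<phi> x) (at x within {0..1})"
    using assms Suc.prems by (intro has_vector_derivative_mult_right CB_inf_has_vector_derivative)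
  then have "(nderiv k (\<lambda>x. c * \<phi> x) has_vector_derivative c * nderiv (Suc k) \<phi> x) (at x within {0..1})"
    by (rule has_vector_derivative_transform[OF Suc.prems, rotated]) (use Suc.IH in auto)
  then show ?case by (rule nderiv_SucI[OF Suc.prems])
qed simp

text \<open>A real \<open>SUP\<close> dominates its family only if the family is bounded above;
  compactness of [0,1] provides this.\<close>

lemma CB_inf_tendsto_bound:
  assumes "\<And>j. \<Phi> j \<in> CB_inf" "\<phi> \<in> CB_inf" "x \<in> {0..1}"
  shows "norm (nderiv k (\<Phi> j) x - nderiv k \<phi> x) \<le> (SUP x\<in>{0..1}. norm (nderiv k (\<Phi> j) x - nderiv k \<phi> x))"
proof (rule cSUP_upper[OF assms(3)])
  have "continuous_on {0..1} (\<lambda>x. norm (nderiv k (\<Phi> j) x - nderiv k \<phi> x))"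
    using assms by (intro continuous_intros CB_inf_continuous)
  then have "bounded ((\<lambda>x. norm (nderiv k (\<Phi> j) x - nderiv k \<phi> x)) ` {0..1})"
    by (intro compact_imp_bounded compact_continuous_image) auto
  then show "bdd_above ((\<lambda>x. norm (nderiv k (\<Phi> j) x - nderiv k \<phi> x)) ` {0..1})"
    by (rule bounded_imp_bdd_above)
qed

lemma set_integrable_mult_continuous:
  fixes H \<phi> :: "real \<Rightarrow> complex"
  assumes H: "set_integrable lborel {0<..<1} H" and \<phi>: "continuous_on {0..1} \<phi>"
  shows "set_integrable lborel {0<..<1} (\<lambda>t. H t * \<phi> t)"
proof -
  obtain B where B: "\<And>t. t \<in> {0..1} \<Longrightarrow> norm (\<phi> t) \<le> B"
    using compact_imp_bounded[OF compact_continuous_image[OF \<phi> compact_Icc]] by (force simp: bounded_iff)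
  have "set_integrable lborel {0<..<1} (\<lambda>t. of_real B * H t)" using H by (rule set_integrable_mult_right)
  then show ?thesis
  proof (rule set_integrable_bound)
    have "continuous_on {0<..<1} \<phi>" by (rule continuous_on_subset[OF \<phi>]) auto
    then have m: "(\<lambda>t. indicator {0<..<1} t *\<^sub>R \<phi> t) \<in> borel_measurable borel"
      by (intro borel_measurable_continuous_on_indicator) auto
    have "(\<lambda>t. indicator {0<..<1} t *\<^sub>R H t) \<in> borel_measurable lborel"
      using H unfolding set_integrable_def by (rule borel_measurable_integrable)
    then have "(\<lambda>t. (indicator {0<..<1} t *\<^sub>R H t) * (indicator {0<..<1} t *\<^sub>R \<phi> t)) \<in> borel_measurable lborel"
      using m by (intro borel_measurable_times) auto
    moreover have "(\<lambda>t. (indicator {0<..<1} t *\<^sub>R H t) * (indicator {0<..<1} t *\<^sub>R \<phi> t)) = (\<lambda>t. indicator {0<..<1} t *\<^sub>R (H t * \<phi> t))"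
      by (auto simp: indicator_def)
    ultimately show "set_borel_measurable lborel {0<..<1} (\<lambda>t. H t * \<phi> t)"
      unfolding set_borel_measurable_def by simp
    show "AE t in lborel. t \<in> {0<..<1} \<longrightarrow> norm (H t * \<phi> t) \<le> norm (of_real B * H t)"
    proof (intro AE_I2 impI)
      fix t :: real assume "t \<in> {0<..<1}"
      then have "norm (\<phi> t) \<le> \<bar>B\<bar>" using B[of t] by auto
      then show "norm (H t * \<phi> t) \<le> norm (of_real B * H t)"
        using mult_left_mono[of "norm (\<phi> t)" "\<bar>B\<bar>" "norm (H t)"] by (simp add: norm_mult mult.commute)
    qed
  qed
qed

text \<open>Integrability of the kernel suffices: the finite sum evaluates derivatives at 1, and the
  integral changes by at most the sup distance of the n-th derivatives times the L^1 norm of the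
  kernel.\<close>

lemma G1_continuous_linear_functional:
  assumes H: "set_integrable lborel {0<..<1} (G_hat_over_Gamma n a b)"
  shows "continuous_linear_functional (G1 a b n)"
proof -
  define H where "H = G_hat_over_Gamma n a b"
  have int: "set_integrable lborel {0<..<1} (\<lambda>t. H t * nderiv n \<phi> t)" if "\<phi> \<in> CB_inf" for \<phi>
    unfolding H_def by (rule set_integrable_mult_continuous[OF H CB_inf_continuous[OF that]])
  define h where "h = (\<lambda>k. hypergeometric (a @ [- of_nat k]) b 1)"
  have G1: "G1 a b n \<phi> = (\<Sum>k<n. (-1) ^ k * nderiv k \<phi> 1 / fact k * h k) + (-1) ^ n * Gamma_vec b * (LBINT t:{0<..<1}. H t * nderiv n \<phi> t)" for \<phi>
    by (simp add: G1_def H_def h_def)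
  show ?thesis
    unfolding continuous_linear_functional_def
  proof (intro conjI ballI allI impI)
    fix \<phi> \<eta> assume \<phi>: "\<phi> \<in> CB_inf" and \<eta>: "\<eta> \<in> CB_inf"
    have "(LBINT t:{0<..<1}. H t * nderiv n (\<lambda>x. \<phi> x + \<eta> x) t) = (LBINT t:{0<..<1}. H t * nderiv n \<phi> t + H t * nderiv n \<eta> t)"
      by (intro set_lebesgue_integral_cong) (auto simp: nderiv_add[OF \<phi> \<eta>] distrib_left)
    also have "\<dots> = (LBINT t:{0<..<1}. H t * nderiv n \<phi> t) + (LBINT t:{0<..<1}. H t * nderiv n \<eta> t)"
      by (rule set_integral_add(2)[OF int[OF \<phi>] int[OF \<eta>]])
    finally show "G1 a b n (\<lambda>x. \<phi> x + \<eta> x) = G1 a b n \<phi> + G1 a b n \<eta>"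
      unfolding G1 by (simp add: nderiv_add[OF \<phi> \<eta>] sum.distrib distrib_left distrib_right add_divide_distrib)
  next
    fix c \<phi> assume \<phi>: "\<phi> \<in> CB_inf"
    have "(LBINT t:{0<..<1}. H t * nderiv n (\<lambda>x. c * \<phi> x) t) = (LBINT t:{0<..<1}. c * (H t * nderiv n \<phi> t))"
      by (intro set_lebesgue_integral_cong) (auto simp: nderiv_cmult[OF \<phi>])
    then show "G1 a b n (\<lambda>x. c * \<phi> x) = c * G1 a b n \<phi>"
      unfolding G1 by (simp add: nderiv_cmult[OF \<phi>] sum_distrib_left distrib_left mult_ac)
  next
    fix \<Phi> \<phi> assume \<Phi>: "\<forall>j. \<Phi> j \<in> CB_inf" and \<phi>: "\<phi> \<in> CB_inf" and lim: "CB_inf_tendsto \<Phi> \<phi>"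
    define \<epsilon> where "\<epsilon> = (\<lambda>k j. SUP x\<in>{0..1}. norm (nderiv k (\<Phi> j) x - nderiv k \<phi> x))"
    have \<epsilon>: "\<epsilon> k \<longlonglongrightarrow> 0" for k using lim by (simp add: CB_inf_tendsto_def \<epsilon>_def)
    have bd: "norm (nderiv k (\<Phi> j) x - nderiv k \<phi> x) \<le> \<epsilon> k j" if "x \<in> {0..1}" for k j x
      unfolding \<epsilon>_def using \<Phi> \<phi> that by (intro CB_inf_tendsto_bound) auto
    have pt: "(\<lambda>j. nderiv k (\<Phi> j) 1) \<longlonglongrightarrow> nderiv k \<phi> 1" for k
    proof -
      have "(\<lambda>j. nderiv k (\<Phi> j) 1 - nderiv k \<phi> 1) \<longlonglongrightarrow> 0"
        by (rule Lim_null_comparison[OF _ \<epsilon>[of k]]) (use bd in auto)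
      then show ?thesis by (simp add: LIM_zero_iff)
    qed
    have "(\<lambda>j. (LBINT t:{0<..<1}. H t * nderiv n (\<Phi> j) t) - (LBINT t:{0<..<1}. H t * nderiv n \<phi> t)) \<longlonglongrightarrow> 0"
    proof (rule Lim_null_comparison)
      show "\<forall>\<^sub>F j in sequentially. norm ((LBINT t:{0<..<1}. H t * nderiv n (\<Phi> j) t) - (LBINT t:{0<..<1}. H t * nderiv n \<phi> t))
         \<le> \<epsilon> n j * (LBINT t:{0<..<1}. norm (H t))"
      proof (intro always_eventually allI)
        fix j
        have i: "set_integrable lborel {0<..<1} (\<lambda>t. H t * nderiv n (\<Phi> j) t - H t * nderiv n \<phi> t)"
          using \<Phi> \<phi> by (intro set_integral_diff(1) int) auto
        have "(LBINT t:{0<..<1}. H t * nderiv n (\<Phi> j) t) - (LBINT t:{0<..<1}. H t * nderiv n \<phi> t)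
           = (LBINT t:{0<..<1}. H t * nderiv n (\<Phi> j) t - H t * nderiv n \<phi> t)"
          using \<Phi> \<phi> by (intro set_integral_diff(2)[symmetric] int) auto
        also have "norm \<dots> \<le> (LBINT t:{0<..<1}. norm (H t * nderiv n (\<Phi> j) t - H t * nderiv n \<phi> t))"
          by (rule set_integral_norm_bound[OF i])
        also have "\<dots> \<le> (LBINT t:{0<..<1}. \<epsilon> n j * norm (H t))"
        proof (rule set_integral_mono[OF set_integrable_norm[OF i]])
          show "set_integrable lborel {0<..<1} (\<lambda>t. \<epsilon> n j * norm (H t))"
            using set_integrable_norm[OF H] unfolding H_def by (rule set_integrable_mult_right)
          fix t :: real assume "t \<in> {0<..<1}"
          then have "norm (H t) * norm (nderiv n (\<Phi> j) t - nderiv n \<phi> t) \<le> norm (H t) * \<epsilon> n j"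
            using bd[of t n j] by (intro mult_left_mono) auto
          then show "norm (H t * nderiv n (\<Phi> j) t - H t * nderiv n \<phi> t) \<le> \<epsilon> n j * norm (H t)"
            by (simp add: norm_mult[symmetric] right_diff_distrib mult.commute)
        qed
        finally show "norm ((LBINT t:{0<..<1}. H t * nderiv n (\<Phi> j) t) - (LBINT t:{0<..<1}. H t * nderiv n \<phi> t))
           \<le> \<epsilon> n j * (LBINT t:{0<..<1}. norm (H t))" by simp
      qed
      show "(\<lambda>j. \<epsilon> n j * (LBINT t:{0<..<1}. norm (H t))) \<longlonglongrightarrow> 0"
        using tendsto_mult_right[OF \<epsilon>[of n], of "LBINT t:{0<..<1}. norm (H t)"] by simp
    qed
    then have "(\<lambda>j. LBINT t:{0<..<1}. H t * nderiv n (\<Phi> j) t) \<longlonglongrightarrow> (LBINT t:{0<..<1}. H t * nderiv n \<phi> t)"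
      by (simp add: LIM_zero_iff)
    then show "(\<lambda>j. G1 a b n (\<Phi> j)) \<longlonglongrightarrow> G1 a b n \<phi>"
      unfolding G1 using pt by (intro tendsto_intros) auto
  qed
qed

section \<open>Coefficients of the terminating hypergeometric sums\<close>

lemma Gamma_vec_shift_nat:
  assumes "\<forall>x\<in>set xs. x \<notin> \<int>\<^sub>\<le>\<^sub>0"
  shows "Gamma_vec (shift_vec xs (of_nat k)) = Gamma_vec xs * pochhammer_vec xs k"
  using assms
  by (induction xs) (auto simp: Gamma_vec_def shift_vec_def pochhammer_vec_def pochhammer_Gamma Gamma_eq_zero_iff)

lemma Gamma_vec_eq_0_iff: "Gamma_vec xs = 0 \<longleftrightarrow> (\<exists>x\<in>set xs. x \<in> \<int>\<^sub>\<le>\<^sub>0)"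
  by (induction xs) (auto simp: Gamma_vec_def Gamma_eq_zero_iff)

lemma pochhammer_vec_eq_0:
  assumes "x \<in> set xs" "x \<in> \<int>\<^sub>\<le>\<^sub>0" "- Re x < real k"
  shows "pochhammer_vec xs k = 0"
proof -
  obtain m where m: "x = - of_nat m" using assms(2) by (auto elim!: nonpos_Ints_cases')
  then have "pochhammer x k = 0" using assms(3) by (simp add: pochhammer_of_nat_eq_0_iff)
  then show ?thesis using assms(1) unfolding pochhammer_vec_def by (auto simp: prod_list_zero_iff)
qed

lemma pochhammer_minus_nat_over_fact:
  assumes "k \<le> n"
  shows "pochhammer (- of_nat n) k / fact k = ((- 1) ^ k * fact n / (fact k * fact (n - k)) :: complex)"
proof -
  have "(of_nat (n choose k) :: complex) = (- 1) ^ k * pochhammer (- of_nat n) k / fact k"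
    by (simp add: binomial_gbinomial gbinomial_pochhammer)
  then have "pochhammer (- of_nat n) k / fact k = (- 1) ^ k * (of_nat (n choose k) :: complex)"
    by (cases "even k") simp_all
  then show ?thesis using binomial_fact[OF assms, where 'a = complex] by simp
qed

text \<open>\<open>residue_coeff\<close> divided by \<open>Gamma_vec a\<close>, in a form that keeps
  its meaning when \<open>Gamma_vec a\<close> is 0. Up to a factor independent of k these are also
  the terms of the terminating series.\<close>

definition hyper_coeff :: "complex list \<Rightarrow> complex list \<Rightarrow> nat \<Rightarrow> nat \<Rightarrow> complex" where
  "hyper_coeff a b n k = pochhammer_vec a k / Gamma_vec (shift_vec b (of_nat k)) * (- 1) ^ k / (fact k * fact (n - 1 - k))"

lemma hypergeometric_terminating:
  assumes b: "\<forall>x\<in>set b. x \<notin> \<int>\<^sub>\<le>\<^sub>0"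
  shows "hypergeometric (a @ [- of_nat n]) b 1 = Gamma_vec b * fact n * (\<Sum>k\<le>n. hyper_coeff a b (Suc n) k)"
proof -
  have "hypergeometric (a @ [- of_nat n]) b 1 = (\<Sum>k\<le>n. pochhammer_vec (a @ [- of_nat n]) k / pochhammer_vec b k * 1 ^ k / fact k)"
    unfolding hypergeometric_def
    by (rule suminf_finite) (auto simp: pochhammer_vec_def pochhammer_of_nat_eq_0_iff not_le)
  also have "\<dots> = (\<Sum>k\<le>n. Gamma_vec b * fact n * hyper_coeff a b (Suc n) k)"
  proof (rule sum.cong)
    fix k assume k: "k \<in> {..n}"
    have nz: "Gamma_vec b \<noteq> 0" using b by (simp add: Gamma_vec_eq_0_iff)
    have "pochhammer_vec (a @ [- of_nat n]) k / pochhammer_vec b k * 1 ^ k / fact k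
      = pochhammer_vec a k / pochhammer_vec b k * (pochhammer (- of_nat n) k / fact k)"
      by (simp add: pochhammer_vec_def)
    also have "\<dots> = pochhammer_vec a k / pochhammer_vec b k * ((- 1) ^ k * fact n / (fact k * fact (n - k)))"
      using k by (subst pochhammer_minus_nat_over_fact) auto
    also have "\<dots> = Gamma_vec b * fact n * hyper_coeff a b (Suc n) k"
      using nz by (simp add: hyper_coeff_def Gamma_vec_shift_nat[OF b])
    finally show "pochhammer_vec (a @ [- of_nat n]) k / pochhammer_vec b k * 1 ^ k / fact k = Gamma_vec b * fact n * hyper_coeff a b (Suc n) k" .
  qed simp
  finally show ?thesis by (simp add: sum_distrib_left)
qed

text \<open>This is the division by \<beta> = n - u at u = k, so the monomials follow the same
  recursion as the loop integral.\<close>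

lemma hyper_coeff_Suc: "k < n \<Longrightarrow> hyper_coeff a b (Suc n) k = hyper_coeff a b n k / of_nat (n - k)"
proof -
  assume k: "k < n"
  have "n - k = Suc (n - 1 - k)" using k by simp
  then have "fact (n - k) = (of_nat (n - k) * fact (n - 1 - k) :: complex)" by (metis fact_Suc)
  then show ?thesis by (simp add: hyper_coeff_def)
qed

section \<open>From one order to the next\<close>

context mellin_barnes begin

abbreviation "small \<equiv> {k. real k < c}"

lemma finite_small: "finite small"
  by (rule finite_subset[of _ "{..nat \<lceil>c\<rceil>}"]) (auto, linarith)

lemma residue_coeff_eq:
  assumes "\<forall>x\<in>set a. x \<notin> \<int>\<^sub>\<le>\<^sub>0"
  shows "residue_coeff n k = Gamma_vec a * hyper_coeff a b n k"
  by (simp add: residue_coeff_def hyper_coeff_def Gamma_quot_def Gamma_vec_shift_nat[OF assms])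

text \<open>For x = -m the Pochhammer symbol vanishes from k = m + 1 on, and m = -Re x < c.\<close>

lemma hyper_coeff_eq_0:
  assumes "x \<in> set a" "x \<in> \<int>\<^sub>\<le>\<^sub>0" "c < real k"
  shows "hyper_coeff a b n k = 0"
  using pochhammer_vec_eq_0[OF assms(1,2), of k] c_Re[OF assms(1)] assms(3) by (simp add: hyper_coeff_def)

text \<open>
  If a component of \<open>a\<close> is a non-positive integer, then \<open>Gamma_vec a = 0\<close>, division by it gives \<open>0\<close>, and the
  first summand disappears, as the extension by continuity requires.
\<close>

lemma G_hat_over_Gamma_eq:
  assumes t: "0 < t" "t < 1" and n: "c < real n"
  shows "G_hat_over_Gamma n a b t = loop_mellin n t / (2 * pi * \<i> * Gamma_vec a)
     + (\<Sum>k\<in>small. hyper_coeff a b n k * of_real t ^ (n - 1 - k))"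
proof (cases "\<exists>x\<in>set a. x \<in> \<int>\<^sub>\<le>\<^sub>0")
  case False
  then have a: "\<forall>x\<in>set a. x \<notin> \<int>\<^sub>\<le>\<^sub>0" by auto
  then have nz: "Gamma_vec a \<noteq> 0" by (simp add: Gamma_vec_eq_0_iff)
  have g: "separating_loop n a (SOME g. separating_loop n a g)"
    using separating_loop_exists[OF a] by (rule someI_ex)
  have "{k. k < n \<and> real k < c} = small" using n by auto
  then have "G_hat n a b t = loop_mellin n t / (2 * pi * \<i>) + (\<Sum>k\<in>small. residue_coeff n k * of_real t ^ (n - 1 - k))"
    unfolding G_hat_def loop_integral_G_integrand[OF t a g] by (simp add: add_divide_distrib)
  also have "(\<Sum>k\<in>small. residue_coeff n k * of_real t ^ (n - 1 - k)) = Gamma_vec a * (\<Sum>k\<in>small. hyper_coeff a b n k * of_real t ^ (n - 1 - k))"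
    by (simp add: residue_coeff_eq[OF a] sum_distrib_left mult_ac)
  finally show ?thesis using False nz by (simp add: G_hat_over_Gamma_def add_divide_distrib)
next
  case True
  then obtain x where x: "x \<in> set a" "x \<in> \<int>\<^sub>\<le>\<^sub>0" by auto
  have G0: "Gamma_vec a = 0" using True by (simp add: Gamma_vec_eq_0_iff)
  show ?thesis
  proof (cases "n = 0")
    case True
    \<comment> \<open>Order 0 forces c < 0, so there are no monomials and both sides are 0.\<close>
    then have "small = {}" using n by auto
    then show ?thesis using x True G0 by (auto simp: G_hat_over_Gamma_def)
  next
    case False
    have "G_hat_over_Gamma n a b t = of_real t ^ (n - 1) / fact (n - 1) *
             (\<Sum>j=0..n-1. pochhammer (1 - of_nat n) j * pochhammer_vec a j /
                        (Gamma_vec (shift_vec b (of_nat j)) * fact j) * of_real t powi (- int j))"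
      using x False by (auto simp: G_hat_over_Gamma_def)
    also have "\<dots> = (\<Sum>j=0..n-1. hyper_coeff a b n j * of_real t ^ (n - 1 - j))"
      unfolding sum_distrib_left
    proof (rule sum.cong)
      fix j assume j: "j \<in> {0..n-1}"
      have e: "1 - of_nat n = - (of_nat (n - 1) :: complex)" using False by (simp add: of_nat_diff)
      have tj: "of_real t ^ (n - 1) * of_real t powi (- int j) = (of_real t ^ (n - 1 - j) :: complex)"
      proof -
        have "n - 1 = j + (n - 1 - j)" using j by simp
        then have "of_real t ^ (n - 1) = (of_real t ^ j * of_real t ^ (n - 1 - j) :: complex)" by (metis power_add)
        then show ?thesis using t by (simp add: power_int_minus)
      qed
      have "of_real t ^ (n - 1) / fact (n - 1) * (pochhammer (1 - of_nat n) j * pochhammer_vec a j /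
                        (Gamma_vec (shift_vec b (of_nat j)) * fact j) * of_real t powi (- int j))
        = (pochhammer (- of_nat (n - 1)) j / fact j) / fact (n - 1) * pochhammer_vec a j /
                        Gamma_vec (shift_vec b (of_nat j)) * (of_real t ^ (n - 1) * of_real t powi (- int j))"
        unfolding e by (simp add: mult_ac)
      also have "\<dots> = hyper_coeff a b n j * of_real t ^ (n - 1 - j)"
        unfolding tj using j by (subst pochhammer_minus_nat_over_fact) (auto simp: hyper_coeff_def mult_ac)
      finally show "of_real t ^ (n - 1) / fact (n - 1) * (pochhammer (1 - of_nat n) j * pochhammer_vec a j /
                        (Gamma_vec (shift_vec b (of_nat j)) * fact j) * of_real t powi (- int j))
        = hyper_coeff a b n j * of_real t ^ (n - 1 - j)" .
    qed simp
    \<comment> \<open>The polynomial in the extension by continuity runs over all j < n; those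
      beyond \<open>c\<close> have coefficient 0.\<close>
    also have "\<dots> = (\<Sum>j\<in>small. hyper_coeff a b n j * of_real t ^ (n - 1 - j))"
    proof (rule sum.mono_neutral_right)
      show "small \<subseteq> {0..n - 1}" using n by auto
      show "\<forall>j\<in>{0..n - 1} - small. hyper_coeff a b n j * of_real t ^ (n - 1 - j) = 0"
      proof
        fix j assume "j \<in> {0..n - 1} - small"
        then have "c < real j" using c_nat[of j] by (auto simp: not_less)
        then show "hyper_coeff a b n j * of_real t ^ (n - 1 - j) = 0" using hyper_coeff_eq_0[OF x] by simp
      qed
    qed auto
    finally show ?thesis using G0 by simp
  qed
qed

lemma power_by_parts:
  assumes m: "k < n" and der: "\<And>t. t \<in> {0..1} \<Longrightarrow> (\<phi> has_vector_derivative \<phi>' t) (at t within {0..1})"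
    and \<phi>': "continuous_on {0..1} \<phi>'"
  shows "set_integrable lborel {0<..<1} (\<lambda>t. of_real t ^ (n - 1 - k) * \<phi> t :: complex)"
    "(LBINT t:{0<..<1}. of_real t ^ (n - 1 - k) * \<phi> t)
      = \<phi> 1 / of_nat (n - k) - (LBINT t:{0<..<1}. of_real t ^ (n - k) * \<phi>' t) / of_nat (n - k)"
proof -
  have \<phi>: "continuous_on {0..1} \<phi>"
    using der by (meson continuous_on_eq_continuous_within has_vector_derivative_continuous)
  have "continuous_on {0..1} (\<lambda>t. of_real t ^ (n - 1 - k) * \<phi> t)" using \<phi> by (intro continuous_intros)
  then have "set_integrable lborel {0..1} (\<lambda>t. of_real t ^ (n - 1 - k) * \<phi> t)"
    by (rule borel_integrable_atLeastAtMost')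
  then show "set_integrable lborel {0<..<1} (\<lambda>t. of_real t ^ (n - 1 - k) * \<phi> t)"
    by (rule set_integrable_subset) auto
  have e: "of_nat (n - k) - 1 = (of_nat (n - 1 - k) :: complex)" using m by (simp add: of_nat_diff)
  have "(LBINT t:{0<..<1}. of_real t powr (of_nat (n - k) - 1) * \<phi> t)
    = \<phi> 1 / of_nat (n - k) - (LBINT t:{0<..<1}. of_real t powr of_nat (n - k) * \<phi>' t) / of_nat (n - k)"
    using m by (intro powr_integration_by_parts der \<phi>') auto
  moreover have "(LBINT t:{0<..<1}. of_real t powr (of_nat (n - k) - 1) * \<phi> t) = (LBINT t:{0<..<1}. of_real t ^ (n - 1 - k) * \<phi> t)"
    unfolding e by (intro set_lebesgue_integral_cong) (auto simp: powr_nat)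
  moreover have "(LBINT t:{0<..<1}. of_real t powr of_nat (n - k) * \<phi>' t) = (LBINT t:{0<..<1}. of_real t ^ (n - k) * \<phi>' t)"
    by (intro set_lebesgue_integral_cong) (auto simp: powr_nat)
  ultimately show "(LBINT t:{0<..<1}. of_real t ^ (n - 1 - k) * \<phi> t)
      = \<phi> 1 / of_nat (n - k) - (LBINT t:{0<..<1}. of_real t ^ (n - k) * \<phi>' t) / of_nat (n - k)" by simp
qed

lemma G_hat_over_Gamma_integral:
  assumes n: "c < real n" and s: "0 < Re (psi a b) + real n"
    and der: "\<And>t. t \<in> {0..1} \<Longrightarrow> (\<phi> has_vector_derivative \<phi>' t) (at t within {0..1})"
    and \<phi>': "continuous_on {0..1} \<phi>'"
  shows "set_integrable lborel {0<..<1} (\<lambda>t. G_hat_over_Gamma n a b t * \<phi> t)"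
    "(LBINT t:{0<..<1}. G_hat_over_Gamma n a b t * \<phi> t)
      = (LBINT t:{0<..<1}. loop_mellin n t * \<phi> t) / (2 * pi * \<i> * Gamma_vec a)
       + (\<Sum>k\<in>small. hyper_coeff a b n k * (LBINT t:{0<..<1}. of_real t ^ (n - 1 - k) * \<phi> t))"
proof -
  have kn: "k < n" if "k \<in> small" for k using that n by auto
  have eq: "G_hat_over_Gamma n a b t * \<phi> t = loop_mellin n t * \<phi> t / (2 * pi * \<i> * Gamma_vec a)
      + (\<Sum>k\<in>small. hyper_coeff a b n k * (of_real t ^ (n - 1 - k) * \<phi> t))" if "t \<in> {0<..<1}" for t
    using G_hat_over_Gamma_eq[of t n] that n by (simp add: distrib_right sum_distrib_right mult.assoc)
  have i1: "set_integrable lborel {0<..<1} (\<lambda>t. loop_mellin n t * \<phi> t / (2 * pi * \<i> * Gamma_vec a))"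
    using loop_mellin_by_parts(1)[OF n s der \<phi>'] by (intro set_integrable_divide) auto
  have i2: "set_integrable lborel {0<..<1} (\<lambda>t. hyper_coeff a b n k * (of_real t ^ (n - 1 - k) * \<phi> t))" if "k \<in> small" for k
    using power_by_parts(1)[OF kn[OF that] der \<phi>'] by (rule set_integrable_mult_right)
  have i3: "set_integrable lborel {0<..<1} (\<lambda>t. \<Sum>k\<in>small. hyper_coeff a b n k * (of_real t ^ (n - 1 - k) * \<phi> t))"
    unfolding set_integrable_def scaleR_sum_right using i2 unfolding set_integrable_def by (intro Bochner_Integration.integrable_sum) auto
  show "set_integrable lborel {0<..<1} (\<lambda>t. G_hat_over_Gamma n a b t * \<phi> t)"
    using set_integral_add(1)[OF i1 i3] eq by (subst set_integrable_cong[OF refl refl eq]) auto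
  have "(LBINT t:{0<..<1}. G_hat_over_Gamma n a b t * \<phi> t) = (LBINT t:{0<..<1}. loop_mellin n t * \<phi> t / (2 * pi * \<i> * Gamma_vec a)
      + (\<Sum>k\<in>small. hyper_coeff a b n k * (of_real t ^ (n - 1 - k) * \<phi> t)))"
    using eq by (intro set_lebesgue_integral_cong) auto
  also have "\<dots> = (LBINT t:{0<..<1}. loop_mellin n t * \<phi> t / (2 * pi * \<i> * Gamma_vec a))
     + (LBINT t:{0<..<1}. \<Sum>k\<in>small. hyper_coeff a b n k * (of_real t ^ (n - 1 - k) * \<phi> t))"
    by (rule set_integral_add(2)[OF i1 i3])
  also have "(LBINT t:{0<..<1}. \<Sum>k\<in>small. hyper_coeff a b n k * (of_real t ^ (n - 1 - k) * \<phi> t))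
     = (\<Sum>k\<in>small. LBINT t:{0<..<1}. hyper_coeff a b n k * (of_real t ^ (n - 1 - k) * \<phi> t))"
    unfolding set_lebesgue_integral_def scaleR_sum_right
    using i2 unfolding set_integrable_def by (intro Bochner_Integration.integral_sum) auto
  finally show "(LBINT t:{0<..<1}. G_hat_over_Gamma n a b t * \<phi> t)
      = (LBINT t:{0<..<1}. loop_mellin n t * \<phi> t) / (2 * pi * \<i> * Gamma_vec a)
       + (\<Sum>k\<in>small. hyper_coeff a b n k * (LBINT t:{0<..<1}. of_real t ^ (n - 1 - k) * \<phi> t))"
    by simp
qed

text \<open>The loop supplies the indices c < k \<le> n and the monomials those below
  \<open>c\<close>; as \<open>c\<close> is not a natural number, together they exhaust 0, ..., n. In
  the degenerate case the loop part is 0 by division by 0, and the coefficients beyond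
  \<open>c\<close> vanish as well.\<close>

lemma boundary_value:
  assumes n: "c < real n" and s: "0 < Re (psi a b) + real n"
  shows "loop_value (Suc n) / (2 * pi * \<i> * Gamma_vec a) + (\<Sum>k\<in>small. hyper_coeff a b (Suc n) k) = (\<Sum>k\<le>n. hyper_coeff a b (Suc n) k)"
proof -
  let ?large = "{k. k \<le> n \<and> c < real k}"
  have "loop_value (Suc n) / (2 * pi * \<i> * Gamma_vec a) = (\<Sum>k\<in>?large. hyper_coeff a b (Suc n) k)"
  proof (cases "\<exists>x\<in>set a. x \<in> \<int>\<^sub>\<le>\<^sub>0")
    case True
    then have "Gamma_vec a = 0" by (simp add: Gamma_vec_eq_0_iff)
    moreover have "(\<Sum>k\<in>?large. hyper_coeff a b (Suc n) k) = 0"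
      using True hyper_coeff_eq_0 by (intro sum.neutral) auto
    ultimately show ?thesis by simp
  next
    case False
    then have a: "\<forall>x\<in>set a. x \<notin> \<int>\<^sub>\<le>\<^sub>0" by auto
    then have nz: "Gamma_vec a \<noteq> 0" by (simp add: Gamma_vec_eq_0_iff)
    show ?thesis unfolding loop_value_Suc_value[OF a s] residue_coeff_eq[OF a] sum_distrib_left[symmetric] using nz by simp
  qed
  moreover have "{..n} = ?large \<union> small"
    using n c_nat by (auto simp: not_less) (metis less_eq_real_def not_le)
  moreover have "?large \<inter> small = {}" by auto
  ultimately show ?thesis using finite_small by (simp add: sum.union_disjoint)
qed

lemma G_hat_over_Gamma_by_parts:
  assumes n: "c < real n" and s: "0 < Re (psi a b) + real n"
    and der: "\<And>t. t \<in> {0..1} \<Longrightarrow> (\<phi> has_vector_derivative \<phi>' t) (at t within {0..1})"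
    and der': "\<And>t. t \<in> {0..1} \<Longrightarrow> (\<phi>' has_vector_derivative \<phi>'' t) (at t within {0..1})"
    and \<phi>'': "continuous_on {0..1} \<phi>''"
  shows "(LBINT t:{0<..<1}. G_hat_over_Gamma n a b t * \<phi> t)
    = (\<Sum>k\<le>n. hyper_coeff a b (Suc n) k) * \<phi> 1 - (LBINT t:{0<..<1}. G_hat_over_Gamma (Suc n) a b t * \<phi>' t)"
proof -
  have \<phi>': "continuous_on {0..1} \<phi>'"
    using der' by (meson continuous_on_eq_continuous_within has_vector_derivative_continuous)
  have n': "c < real (Suc n)" and s': "0 < Re (psi a b) + real (Suc n)" using n s by auto
  have "(\<Sum>k\<in>small. hyper_coeff a b n k * (LBINT t:{0<..<1}. of_real t ^ (n - 1 - k) * \<phi> t))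
     = (\<Sum>k\<in>small. hyper_coeff a b (Suc n) k * \<phi> 1 - hyper_coeff a b (Suc n) k * (LBINT t:{0<..<1}. of_real t ^ (n - k) * \<phi>' t))"
  proof (rule sum.cong)
    fix k assume "k \<in> small"
    then have k: "k < n" using n by auto
    show "hyper_coeff a b n k * (LBINT t:{0<..<1}. of_real t ^ (n - 1 - k) * \<phi> t)
      = hyper_coeff a b (Suc n) k * \<phi> 1 - hyper_coeff a b (Suc n) k * (LBINT t:{0<..<1}. of_real t ^ (n - k) * \<phi>' t)"
    proof -
      have "(LBINT t:{0<..<1}. of_real t ^ (n - 1 - k) * \<phi> t)
         = \<phi> 1 / of_nat (n - k) - (LBINT t:{0<..<1}. of_real t ^ (n - k) * \<phi>' t) / of_nat (n - k)"
        by (rule power_by_parts(2)[OF k]) (use der \<phi>' in auto)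
      then show ?thesis unfolding hyper_coeff_Suc[OF k] by (simp only:) (simp add: right_diff_distrib)
    qed
  qed simp
  also have "\<dots> = (\<Sum>k\<in>small. hyper_coeff a b (Suc n) k) * \<phi> 1
     - (\<Sum>k\<in>small. hyper_coeff a b (Suc n) k * (LBINT t:{0<..<1}. of_real t ^ (Suc n - 1 - k) * \<phi>' t))"
    by (simp add: sum_subtractf sum_distrib_right)
  finally have poly: "(\<Sum>k\<in>small. hyper_coeff a b n k * (LBINT t:{0<..<1}. of_real t ^ (n - 1 - k) * \<phi> t))
     = (\<Sum>k\<in>small. hyper_coeff a b (Suc n) k) * \<phi> 1
     - (\<Sum>k\<in>small. hyper_coeff a b (Suc n) k * (LBINT t:{0<..<1}. of_real t ^ (Suc n - 1 - k) * \<phi>' t))" .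
  have loop_mellin: "(LBINT t:{0<..<1}. loop_mellin n t * \<phi> t) = loop_value (Suc n) * \<phi> 1 - (LBINT t:{0<..<1}. loop_mellin (Suc n) t * \<phi>' t)"
    by (rule loop_mellin_by_parts(2)[OF n s der \<phi>'])
  have "(LBINT t:{0<..<1}. G_hat_over_Gamma n a b t * \<phi> t)
      = (LBINT t:{0<..<1}. loop_mellin n t * \<phi> t) / (2 * pi * \<i> * Gamma_vec a)
       + (\<Sum>k\<in>small. hyper_coeff a b n k * (LBINT t:{0<..<1}. of_real t ^ (n - 1 - k) * \<phi> t))"
    by (rule G_hat_over_Gamma_integral(2)[OF n s der \<phi>'])
  moreover have "(LBINT t:{0<..<1}. G_hat_over_Gamma (Suc n) a b t * \<phi>' t)
      = (LBINT t:{0<..<1}. loop_mellin (Suc n) t * \<phi>' t) / (2 * pi * \<i> * Gamma_vec a)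
       + (\<Sum>k\<in>small. hyper_coeff a b (Suc n) k * (LBINT t:{0<..<1}. of_real t ^ (Suc n - 1 - k) * \<phi>' t))"
    by (rule G_hat_over_Gamma_integral(2)[OF n' s' der' \<phi>''])
  ultimately show ?thesis
    unfolding loop_mellin poly boundary_value[OF n s, symmetric] by (simp add: diff_divide_distrib distrib_right)
qed

lemma G_hat_over_Gamma_integrable:
  assumes "c < real n" "0 < Re (psi a b) + real n"
  shows "set_integrable lborel {0<..<1} (G_hat_over_Gamma n a b)"
  using G_hat_over_Gamma_integral(1)[OF assms, of "\<lambda>_. 1" "\<lambda>_. 0"] by simp

text \<open>The n! in \<open>hypergeometric_terminating\<close> cancels the n! under the derivative,
  so the new summand k = n is exactly the boundary term of order n; its companion integral carries
  the minus sign that turns (-1)^n into (-1)^(n+1).\<close>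

lemma G1_Suc:
  assumes n: "c < real n" and s: "0 < Re (psi a b) + real n" and b: "\<forall>x\<in>set b. x \<notin> \<int>\<^sub>\<le>\<^sub>0" and \<phi>: "\<phi> \<in> CB_inf"
  shows "G1 a b (Suc n) \<phi> = G1 a b n \<phi>"
proof -
  have eq: "(LBINT t:{0<..<1}. G_hat_over_Gamma n a b t * nderiv n \<phi> t)
    = (\<Sum>k\<le>n. hyper_coeff a b (Suc n) k) * nderiv n \<phi> 1 - (LBINT t:{0<..<1}. G_hat_over_Gamma (Suc n) a b t * nderiv (Suc n) \<phi> t)"
    by (rule G_hat_over_Gamma_by_parts[OF n s CB_inf_has_vector_derivative[OF \<phi>] CB_inf_has_vector_derivative[OF \<phi>] CB_inf_continuous[OF \<phi>]])
  show ?thesis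
    unfolding G1_def eq hypergeometric_terminating[OF b] sum.lessThan_Suc by (simp add: algebra_simps)
qed

lemma G1_eq:
  assumes "n \<le> m" and n: "c < real n" and s: "0 < Re (psi a b) + real n" and b: "\<forall>x\<in>set b. x \<notin> \<int>\<^sub>\<le>\<^sub>0" and \<phi>: "\<phi> \<in> CB_inf"
  shows "G1 a b m \<phi> = G1 a b n \<phi>"
  using assms(1)
proof (induction m rule: dec_induct)
  case (step m)
  then show ?case using n s by (subst G1_Suc[OF _ _ b \<phi>]) auto
qed simp

end

lemma mellin_barnes_exists:
  assumes len: "length a = length b" and a: "a \<noteq> []" and n: "admissible a b n"
  obtains c M C where "mellin_barnes a b c M C" "c < real n" "0 < Re (psi a b) + real n"
proof -
  obtain C K where CK: "C \<ge> 0" "K \<ge> 1" "\<And>x. x \<in> set a \<Longrightarrow> norm x < K"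
    "\<And>u. K \<le> \<bar>Im u\<bar> \<or> K \<le> Re u \<Longrightarrow> norm (Gamma_quot a b u) \<le> C * norm u powr (- Re (psi a b))"
    using Gamma_quot_bound[OF len] by metis
  \<comment> \<open>An abscissa above \<open>r\<close> is right of all left poles and above n - 1;
    together with c < n this keeps it from being an integer.\<close>
  define r where "r = max (- min_Re a) (real n - 1)"
  define c where "c = (r + real n) / 2"
  have r: "r < real n" using n by (auto simp: admissible_def r_def)
  have c: "r < c" "c < real n" using r by (auto simp: c_def)
  have "mellin_barnes a b c K C"
  proof
    show "- Re x < c" if "x \<in> set a" for x
    proof -
      have "min_Re a \<le> Re x" unfolding min_Re_def using that by (intro Min_le) auto
      then show ?thesis using c by (auto simp: r_def)
    qed
    show "real k \<noteq> c" for k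
    proof
      assume "real k = c"
      then have "real n < real (Suc k)" "real k < real n" using c by (auto simp: r_def)
      then have "n < Suc k" "k < n" by (simp_all only: of_nat_less_iff)
      then show False by simp
    qed
  qed (use CK len a in auto)
  moreover have "0 < Re (psi a b) + real n" using n by (auto simp: admissible_def)
  ultimately show ?thesis using that c by blast
qed

theorem theorem1:
  fixes p :: nat and a b :: "complex list"
  assumes "p \<ge> 1" and "length a = p" and "length b = p"
    and "\<forall>x\<in>set b. x \<notin> \<int>\<^sub>\<le>\<^sub>0"
  shows "(\<forall>n. admissible a b n \<longrightarrow>
            (\<forall>\<phi>\<in>CB_inf. set_integrable lborel {0<..<1}
                           (\<lambda>t. G_hat_over_Gamma n a b t * nderiv n \<phi> t)) \<and>
            continuous_linear_functional (G1 a b n)) \<and>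
         (\<forall>n m. admissible a b n \<longrightarrow> admissible a b m \<longrightarrow>
            (\<forall>\<phi>\<in>CB_inf. G1 a b n \<phi> = G1 a b m \<phi>))"
proof -
  have len: "length a = length b" and a: "a \<noteq> []" using assms by auto
  have int: "set_integrable lborel {0<..<1} (G_hat_over_Gamma n a b)" if adm: "admissible a b n" for n
  proof -
    obtain c M C where mb: "mellin_barnes a b c M C" and "c < real n" "0 < Re (psi a b) + real n"
      using mellin_barnes_exists[OF len a adm] .
    then show ?thesis using mellin_barnes.G_hat_over_Gamma_integrable[OF mb] by blast
  qed
  have eq: "G1 a b m \<phi> = G1 a b n \<phi>" if "n \<le> m" and adm: "admissible a b n" and "\<phi> \<in> CB_inf" for n m \<phi>
  proof -
    \<comment> \<open>The loop is chosen for the smaller order, so that c < n \<le> m holds for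
      both.\<close>
    obtain c M C where mb: "mellin_barnes a b c M C" and "c < real n" "0 < Re (psi a b) + real n"
      using mellin_barnes_exists[OF len a adm] .
    then show ?thesis using mellin_barnes.G1_eq[OF mb] that assms(4) by blast
  qed
  have "G1 a b n \<phi> = G1 a b m \<phi>" if "admissible a b n" "admissible a b m" "\<phi> \<in> CB_inf" for n m \<phi>
    using eq[of n m \<phi>] eq[of m n \<phi>] that by (cases "n \<le> m") auto
  then show ?thesis
    using int G1_continuous_linear_functional set_integrable_mult_continuous CB_inf_continuous by blast
qed

end
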